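(* Let $V$ be a vertex operator algebra, $z\in\mathbb{C}^{\times}$, and let $W_1,W_2$ be $V$-modules. The subspace $W_1\diamond_{P(z)}W_2$ of $(W_1\otimes W_2)^*$ is a generalized $V$-module with the following property: given any $V$-module $W_3$, the natural isomorphism $$\mathrm{Hom}(W_3',(W_1\otimes W_2)^* )\stackrel{\sim}{\to}\mathrm{Hom}(W_1\otimes W_2,\overline{W}_3),$$ under which $G$ corresponds to $F$ when $\langle w'_{(3)},F(w_{(1)}\otimes w_{(2)})\rangle=G(w'_{(3)})(w_{(1)}\otimes w_{(2)})$, determines a natural linear isomorphism between the space of all $P(z)$-intertwining maps of type $\binom{W_3}{W_1W_2}$ and the space of all maps of generalized modules from $W_3'$ to $W_1\diamond_{P(z)}W_2$.
   Context: Basic conventions. Everything is over $\mathbb{C}$. $V=(V,Y,\mathbf 1,\omega)$ is a vertex operator algebra ($\mathbb{Z}$-graded, with finite-dimensional weight spaces that vanish for sufficiently negative weight), $Y(\omega,x)=\sum_n L(n)x^{-n-2}$. A $V$-module is a $\mathbb{C}$-graded space $W=\coprod_{n\in\mathbb{C}}W_{(n)}$, graded by $L(0)$-eigenvalues, with a vertex operator map satisfying the usual axioms (lower truncation, vacuum property, Jacobi identity, $L(-1)$-derivative property), such that $\dim W_{(n)}<\infty$ for all $n$ and $W_{(n)}=0$ for $n$ whose real part is sufficiently small. A generalized $V$-module satisfies all these axioms except the last two conditions on the grading. For a module $W$, $\overline W=\prod_nW_{(n)}$ is the formal completion and $W'=\coprod_nW_{(n)}^*$ is the contragredient module, with $\langle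 Y'(v,x)w',w\rangle=\langle w',Y^*(v,x)w\rangle$, where $Y^*(v,x)=Y(e^{xL(1)}(-x^{-2})^{L(0)}v,x^{-1})$; $\langle\cdot,\cdot\rangle$ also denotes the pairing between $W'$ and $\overline W$. Modules $W_i$ have vertex operator maps $Y_i$. Formal delta function: $\delta(x)=\sum_{n\in\mathbb{Z}}x^n$; powers of binomials are expanded in nonnegative powers of the second summand. For $v\in V$, $Y_t(v,x)=v\otimes t^{-1}\delta(x/t)$, so the coefficient of $x^{-n-1}$ is $v\otimes t^n$. $\iota_+$ denotes expansion of a rational function of $t$ in the direction of positive powers of $t$. A $P(z)$-intertwining map of type $\binom{W_3}{W_1W_2}$ is a linear map $F:W_1\otimes W_2\to\overline{W}_3$ with $$x_0^{-1}\delta\bigl(\tfrac{x_1-z}{x_0}\bigr)Y_3(v,x_1)F(w_{(1)}\otimes w_{(2)})=z^{-1}\delta\bigl(\tfrac{x_1-x_0}{z}\bigr)F(Y_1(v,x_0)w_{(1)}\otimes w_{(2)})+x_0^{-1}\delta\bigl(\tfrac{z-x_1}{-x_0}\bigr)F(w_{(1)}\otimes Y_2(v,x_1)w_{(2)})$$ for $v\in V$, $w_{(i)}\in W_i$. The linear map $\tau_{P(z)}:V\otimes\iota_+\mathbb{C}[t,t^{-1},(z^{-1}-t)^{-1}]\to\mathrm{End}\,(W_1\otimes W_2)^*$ is defined by $$\Bigl(\tau_{P(z)}\bigl(x_0^{-1}\delta\bigl(\tfrac{x_1^{-1}-z}{x_0}\bigr)Y_t(v,x_1)\bigr)\lambda\Bigr)(w_{(1)}\otimes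 w_{(2)})=z^{-1}\delta\bigl(\tfrac{x_1^{-1}-x_0}{z}\bigr)\lambda\bigl(Y_1(e^{x_1L(1)}(-x_1^{-2})^{L(0)}v,x_0)w_{(1)}\otimes w_{(2)}\bigr)+x_0^{-1}\delta\bigl(\tfrac{z-x_1^{-1}}{-x_0}\bigr)\lambda\bigl(w_{(1)}\otimes Y_2^*(v,x_1)w_{(2)}\bigr).$$ Put $Y'_{P(z)}(v,x)=\tau_{P(z)}(Y_t(v,x))$ and $Y'_{P(z)}(\omega,x)=\sum_nL'_{P(z)}(n)x^{-n-2}$. An element $\lambda\in(W_1\otimes W_2)^*$ satisfies the $P(z)$-compatibility condition if for all $v\in V$: $Y'_{P(z)}(v,x)\lambda$ involves only finitely many negative powers of $x$, and $\tau_{P(z)}\bigl(x_0^{-1}\delta(\tfrac{x_1^{-1}-z}{x_0})Y_t(v,x_1)\bigr)\lambda=x_0^{-1}\delta(\tfrac{x_1^{-1}-z}{x_0})Y'_{P(z)}(v,x_1)\lambda$. A subspace $W\subset(W_1\otimes W_2)^*$ is called a $V$-module (resp. generalized $V$-module) if it is $\mathbb{C}$-graded by its $L'_{P(z)}(0)$-eigenspaces and is a module (resp. generalized module) with this grading and the action $Y'_{P(z)}(\cdot,x)$; it is $P(z)$-compatible if each of its elements satisfies the $P(z)$-compatibility condition. $W_1\diamond_{P(z)}W_2\subset(W_1\otimes W_2)^*$ is defined as the sum (equivalently, the union) of all subspaces that are $P(z)$-compatible $V$-modules. *)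

theory Defs
  imports Complex_Main "HOL-Library.Function_Algebras" "HOL-Library.Groups_Big_Fun"
begin

section \<open>Formal calculus\<close>

text \<open>
  Formal series are stored by their coefficients: a series in one variable \<open>x\<close> is a function on
  \<open>int\<close> whose value at \<open>k\<close> is the coefficient of \<open>x\<^sup>k\<close>, and a vertex operator
  \<open>Y(v,x)\<close> is the family of the coefficients of \<open>x\<^sup>k\<close> (so \<open>v\<^sub>n\<close> is its coefficient at
  \<open>k = -n-1\<close>). Products of series are convolutions, written with \<open>Sum_any\<close>, the sum of a finitely
  supported family; in all the products below lower truncation makes the supports finite.

  \<open>delta3 i j k\<close> is the coefficient of \<open>A\<^sup>i B\<^sup>j C\<^sup>k\<close> in
  \<open>C\<^sup>-\<^sup>1 \<delta>((A - B)/C) = \<Sum>n. C\<^sup>-\<^sup>n\<^sup>-\<^sup>1 (A - B)\<^sup>n\<close>, with \<open>(A - B)\<^sup>n\<close> expanded in nonnegative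
  powers of \<open>B\<close>.
\<close>

definition delta3 :: "int \<Rightarrow> int \<Rightarrow> int \<Rightarrow> complex" where
  "delta3 i j k =
     (if 0 \<le> j \<and> i + j = - k - 1 then (-1) ^ nat j * (of_int (i + j) gchoose nat j) else 0)"

text \<open>
  The coefficients of \<open>y\<^sup>a x\<^sub>0\<^sup>c\<close> in
  \<open>x\<^sub>0\<^sup>-\<^sup>1 \<delta>((y - z)/x\<^sub>0)\<close>, \<open>z\<^sup>-\<^sup>1 \<delta>((y - x\<^sub>0)/z)\<close> and
  \<open>x\<^sub>0\<^sup>-\<^sup>1 \<delta>((z - y)/(-x\<^sub>0))\<close>, for a number \<open>z\<close>. The three series are homogeneous of total
  degree \<open>-1\<close> in \<open>y\<close>, \<open>z\<close>, \<open>x\<^sub>0\<close>, so the power of \<open>z\<close> is \<open>-1-a-c\<close>. In the last one,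
  \<open>x\<^sub>0\<^sup>-\<^sup>1 \<delta>((z - y)/(-x\<^sub>0)) = - C\<^sup>-\<^sup>1 \<delta>((z - y)/C)\<close> with \<open>C = -x\<^sub>0\<close>.
\<close>

definition delta_y_z_x0 :: "complex \<Rightarrow> int \<Rightarrow> int \<Rightarrow> complex" where
  "delta_y_z_x0 z a c = delta3 a (-1-a-c) c * z powi (-1-a-c)"

definition delta_y_x0_z :: "complex \<Rightarrow> int \<Rightarrow> int \<Rightarrow> complex" where
  "delta_y_x0_z z a c = delta3 a c (-1-a-c) * z powi (-1-a-c)"

definition delta_z_y_x0 :: "complex \<Rightarrow> int \<Rightarrow> int \<Rightarrow> complex" where
  "delta_z_y_x0 z a c = (-1) powi (c + 1) * delta3 (-1-a-c) a c * z powi (-1-a-c)"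


section \<open>Linear algebra on subspaces\<close>

definition linear_on ::
  "(complex \<Rightarrow> 'x \<Rightarrow> 'x) \<Rightarrow> 'x::ab_group_add set \<Rightarrow> (complex \<Rightarrow> 'y \<Rightarrow> 'y) \<Rightarrow> ('x \<Rightarrow> 'y::ab_group_add) \<Rightarrow> bool"
  where
  "linear_on s A t f \<longleftrightarrow>
     (\<forall>x\<in>A. \<forall>y\<in>A. f (x + y) = f x + f y) \<and> (\<forall>c. \<forall>x\<in>A. f (s c x) = t c (f x))"

text \<open>Linear maps out of a subspace are normalized to be \<open>0\<close> off it, so that they form a vector space.\<close>

definition hom_space ::
  "(complex \<Rightarrow> 'x \<Rightarrow> 'x) \<Rightarrow> 'x::ab_group_add set \<Rightarrow> (complex \<Rightarrow> 'y \<Rightarrow> 'y) \<Rightarrow> 'y::ab_group_add set \<Rightarrow> ('x \<Rightarrow> 'y) set"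
  where
  "hom_space s A t B = {f. linear_on s A t f \<and> f ` A \<subseteq> B \<and> (\<forall>x. x \<notin> A \<longrightarrow> f x = 0)}"

definition linear_iso ::
  "(complex \<Rightarrow> 'x \<Rightarrow> 'x) \<Rightarrow> 'x::ab_group_add set \<Rightarrow> (complex \<Rightarrow> 'y \<Rightarrow> 'y) \<Rightarrow> 'y::ab_group_add set \<Rightarrow> ('x \<Rightarrow> 'y) \<Rightarrow> bool"
  where
  "linear_iso s A t B f \<longleftrightarrow>
     module.subspace s A \<and> module.subspace t B \<and> linear_on s A t f \<and> bij_betw f A B"

definition is_direct_sum :: "('i \<Rightarrow> 'w::ab_group_add set) \<Rightarrow> 'w set \<Rightarrow> bool" where
  "is_direct_sum E W \<longleftrightarrow>
     (\<forall>i. E i \<subseteq> W) \<and>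
     (\<forall>w\<in>W. \<exists>!f. (\<forall>i. f i \<in> E i) \<and> finite {i. f i \<noteq> 0} \<and> Sum_any f = w)"

definition component :: "('i \<Rightarrow> 'w::ab_group_add set) \<Rightarrow> 'i \<Rightarrow> 'w \<Rightarrow> 'w" where
  "component E i w = (THE f. (\<forall>i. f i \<in> E i) \<and> finite {i. f i \<noteq> 0} \<and> Sum_any f = w) i"

definition finite_dimensional :: "(complex \<Rightarrow> 'w \<Rightarrow> 'w) \<Rightarrow> 'w::ab_group_add set \<Rightarrow> bool" where
  "finite_dimensional s E \<longleftrightarrow> (\<exists>B. finite B \<and> E = module.span s B)"


section \<open>Vertex operator algebras and modules\<close>

text \<open>
  \<open>('v, 'w) vact\<close> carries the complex scalar multiplication of \<open>'w\<close> and the coefficients of a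
  vertex operator map: \<open>vop M v k w\<close> is the coefficient of \<open>x\<^sup>k\<close> in \<open>Y(v,x)w\<close>.
\<close>

record ('v, 'w) vact =
  scl :: "complex \<Rightarrow> 'w \<Rightarrow> 'w"
  vop :: "'v \<Rightarrow> int \<Rightarrow> 'w \<Rightarrow> 'w"

record 'v voa =
  reg :: "('v, 'v) vact"
  vac :: 'v
  conf :: 'v

definition Lmode :: "'v voa \<Rightarrow> ('v, 'w) vact \<Rightarrow> int \<Rightarrow> 'w \<Rightarrow> 'w" where
  "Lmode V M n = vop M (conf V) (- n - 2)"

definition weight_space :: "'v voa \<Rightarrow> ('v, 'w) vact \<Rightarrow> 'w set \<Rightarrow> complex \<Rightarrow> 'w set" where
  "weight_space V M W n = {w \<in> W. Lmode V M 0 w = scl M n w}"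

text \<open>
  The coefficients of \<open>x\<^sub>0\<^sup>c x\<^sub>1\<^sup>a x\<^sub>2\<^sup>b\<close> in the Jacobi identity
  \[x_0^{-1}\delta((x_1-x_2)/x_0) Y(u,x_1)Y(v,x_2)w - x_0^{-1}\delta((x_2-x_1)/(-x_0)) Y(v,x_2)Y(u,x_1)w
    = x_2^{-1}\delta((x_1-x_0)/x_2) Y(Y(u,x_0)v,x_2)w.\]
\<close>

definition jacobi_identity :: "'v::ab_group_add voa \<Rightarrow> ('v, 'w::ab_group_add) vact \<Rightarrow> 'w set \<Rightarrow> bool" where
  "jacobi_identity V M W \<longleftrightarrow>
     (\<forall>u v. \<forall>w\<in>W. \<forall>a b c.
        Sum_any (\<lambda>(a', b'). scl M (delta3 a' b' c) (vop M u (a - a') (vop M v (b - b') w)))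
      - Sum_any (\<lambda>(a', b'). scl M ((-1) powi (c + 1) * delta3 b' a' c)
                              (vop M v (b - b') (vop M u (a - a') w)))
      = Sum_any (\<lambda>(b', c'). scl M (delta3 a c' b') (vop M (vop (reg V) u (c - c') v) (b - b') w)))"

text \<open>The module axioms for the subspace \<open>W\<close> of \<open>'w\<close>, apart from those on the grading.\<close>

definition vertex_action :: "'v::ab_group_add voa \<Rightarrow> ('v, 'w::ab_group_add) vact \<Rightarrow> 'w set \<Rightarrow> bool" where
  "vertex_action V M W \<longleftrightarrow>
     vector_space (scl M) \<and> module.subspace (scl M) W \<and>
     (\<forall>v k. \<forall>w\<in>W. vop M v k w \<in> W) \<and>
     (\<forall>v k. linear_on (scl M) W (scl M) (vop M v k)) \<and>
     (\<forall>k. \<forall>w\<in>W. linear_on (scl (reg V)) UNIV (scl M) (\<lambda>v. vop M v k w)) \<and>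
     (\<forall>v. \<forall>w\<in>W. \<exists>N. \<forall>k<N. vop M v k w = 0) \<and>
     (\<forall>k. \<forall>w\<in>W. vop M (vac V) k w = (if k = 0 then w else 0)) \<and>
     jacobi_identity V M W \<and>
     (\<forall>v k. \<forall>w\<in>W. vop M (Lmode V (reg V) (-1) v) k w = scl M (of_int (k + 1)) (vop M v (k + 1) w))"

definition voa_weight_space :: "'v voa \<Rightarrow> int \<Rightarrow> 'v set" where
  "voa_weight_space V n = weight_space V (reg V) UNIV (of_int n)"

definition vertex_operator_algebra :: "'v::ab_group_add voa \<Rightarrow> bool" where
  "vertex_operator_algebra V \<longleftrightarrow>
     vertex_action V (reg V) UNIV \<and>
     (\<forall>v k. k < 0 \<longrightarrow> vop (reg V) v k (vac V) = 0) \<and>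
     (\<forall>v. vop (reg V) v 0 (vac V) = v) \<and>
     (\<exists>rank. \<forall>m n v.
        Lmode V (reg V) m (Lmode V (reg V) n v) - Lmode V (reg V) n (Lmode V (reg V) m v)
        = scl (reg V) (of_int (m - n)) (Lmode V (reg V) (m + n) v)
          + (if m + n = 0 then scl (reg V) (of_int (m ^ 3 - m) / 12 * rank) v else 0)) \<and>
     is_direct_sum (voa_weight_space V) UNIV \<and>
     vac V \<in> voa_weight_space V 0 \<and> conf V \<in> voa_weight_space V 2 \<and>
     (\<forall>n. finite_dimensional (scl (reg V)) (voa_weight_space V n)) \<and>
     (\<exists>N. \<forall>n<N. voa_weight_space V n = {0})"

definition generalized_module :: "'v::ab_group_add voa \<Rightarrow> ('v, 'w::ab_group_add) vact \<Rightarrow> 'w set \<Rightarrow> bool" where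
  "generalized_module V M W \<longleftrightarrow> vertex_action V M W \<and> is_direct_sum (weight_space V M W) W"

definition vmodule :: "'v::ab_group_add voa \<Rightarrow> ('v, 'w::ab_group_add) vact \<Rightarrow> 'w set \<Rightarrow> bool" where
  "vmodule V M W \<longleftrightarrow>
     generalized_module V M W \<and>
     (\<forall>n. finite_dimensional (scl M) (weight_space V M W n)) \<and>
     (\<exists>r. \<forall>n. Re n < r \<longrightarrow> weight_space V M W n = {0})"

definition module_maps ::
  "('v, 'x) vact \<Rightarrow> 'x::ab_group_add set \<Rightarrow> ('v, 'y) vact \<Rightarrow> 'y::ab_group_add set \<Rightarrow> ('x \<Rightarrow> 'y) set" where
  "module_maps M A N B =
     {f \<in> hom_space (scl M) A (scl N) B. \<forall>v k. \<forall>w\<in>A. f (vop M v k w) = vop N v k (f w)}"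


section \<open>Contragredient modules and completions\<close>

text \<open>\<open>theta V v j\<close> is the coefficient of \<open>x\<^sup>j\<close> in \<open>e\<^bsup>xL(1)\<^esup> (-x\<^sup>-\<^sup>2)\<^bsup>L(0)\<^esup> v\<close>.\<close>

definition theta :: "'v::ab_group_add voa \<Rightarrow> 'v \<Rightarrow> int \<Rightarrow> 'v" where
  "theta V v j =
     Sum_any (\<lambda>(i::nat, m::int).
       if int i - 2 * m = j
       then scl (reg V) ((-1) powi m / fact i)
              ((Lmode V (reg V) 1 ^^ i) (component (voa_weight_space V) m v))
       else 0)"

text \<open>\<open>vop_star V M v k\<close> is the coefficient of \<open>x\<^sup>k\<close> in \<open>Y\<^sup>*(v,x)\<close>.\<close>

definition vop_star ::
  "'v::ab_group_add voa \<Rightarrow> ('v, 'w::ab_group_add) vact \<Rightarrow> 'v \<Rightarrow> int \<Rightarrow> 'w \<Rightarrow> 'w" where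
  "vop_star V M v k w = Sum_any (\<lambda>j. vop M (theta V v j) (j - k) w)"

text \<open>
  A family in the direct sum of the dual spaces of the weight spaces is regarded as a linear
  functional on the whole space, vanishing on all but finitely many weight spaces.
\<close>

definition contragredient :: "'v voa \<Rightarrow> ('v, 'w::ab_group_add) vact \<Rightarrow> ('w \<Rightarrow> complex) set" where
  "contragredient V M =
     {f. linear_on (scl M) UNIV (*) f \<and> finite {n. \<exists>w\<in>weight_space V M UNIV n. f w \<noteq> 0}}"

definition contragredient_act ::
  "'v::ab_group_add voa \<Rightarrow> ('v, 'w::ab_group_add) vact \<Rightarrow> ('v, 'w \<Rightarrow> complex) vact" where
  "contragredient_act V M =
     \<lparr>scl = (\<lambda>c f w. c * f w), vop = (\<lambda>v k f w. f (vop_star V M v k w))\<rparr>"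

definition completion :: "'v voa \<Rightarrow> ('v, 'w) vact \<Rightarrow> (complex \<Rightarrow> 'w) set" where
  "completion V M = {f. \<forall>n. f n \<in> weight_space V M UNIV n}"

definition vop_completion ::
  "'v voa \<Rightarrow> ('v, 'w::ab_group_add) vact \<Rightarrow> 'v \<Rightarrow> int \<Rightarrow> (complex \<Rightarrow> 'w) \<Rightarrow> complex \<Rightarrow> 'w" where
  "vop_completion V M v k f n =
     Sum_any (\<lambda>m. component (weight_space V M UNIV) n (vop M v k (f m)))"

definition pairing :: "('w \<Rightarrow> complex) \<Rightarrow> (complex \<Rightarrow> 'w) \<Rightarrow> complex" where
  "pairing w' f = Sum_any (\<lambda>n. w' (f n))"


section \<open>\<open>P(z)\<close>-intertwining maps\<close>

text \<open>
  Linear maps on \<open>W\<^sub>1 \<otimes> W\<^sub>2\<close> are represented by the corresponding bilinear maps on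
  \<open>W\<^sub>1 \<times> W\<^sub>2\<close>. In particular \<open>tensor_dual\<close> is \<open>(W\<^sub>1 \<otimes> W\<^sub>2)\<^sup>*\<close>.
\<close>

definition bilinear_map ::
  "(complex \<Rightarrow> 'a \<Rightarrow> 'a) \<Rightarrow> (complex \<Rightarrow> 'b \<Rightarrow> 'b) \<Rightarrow> (complex \<Rightarrow> 'c \<Rightarrow> 'c) \<Rightarrow>
   ('a::ab_group_add \<Rightarrow> 'b::ab_group_add \<Rightarrow> 'c::ab_group_add) \<Rightarrow> bool" where
  "bilinear_map s1 s2 s3 f \<longleftrightarrow>
     (\<forall>w1. linear_on s2 UNIV s3 (f w1)) \<and> (\<forall>w2. linear_on s1 UNIV s3 (\<lambda>w1. f w1 w2))"

definition tensor_dual ::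
  "('v, 'a::ab_group_add) vact \<Rightarrow> ('v, 'b::ab_group_add) vact \<Rightarrow> ('a \<Rightarrow> 'b \<Rightarrow> complex) set" where
  "tensor_dual M1 M2 = {l. bilinear_map (scl M1) (scl M2) (*) l}"

definition scl_completion :: "('v, 'c) vact \<Rightarrow> complex \<Rightarrow> (complex \<Rightarrow> 'c) \<Rightarrow> complex \<Rightarrow> 'c" where
  "scl_completion M c f n = scl M c (f n)"

definition tensor_hom_scl ::
  "('v, 'c) vact \<Rightarrow> complex \<Rightarrow> ('a \<Rightarrow> 'b \<Rightarrow> complex \<Rightarrow> 'c) \<Rightarrow> 'a \<Rightarrow> 'b \<Rightarrow> complex \<Rightarrow> 'c" where
  "tensor_hom_scl M3 c F w1 w2 = scl_completion M3 c (F w1 w2)"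

definition tensor_hom ::
  "'v voa \<Rightarrow> ('v, 'a::ab_group_add) vact \<Rightarrow> ('v, 'b::ab_group_add) vact \<Rightarrow> ('v, 'c::ab_group_add) vact \<Rightarrow>
   ('a \<Rightarrow> 'b \<Rightarrow> complex \<Rightarrow> 'c) set" where
  "tensor_hom V M1 M2 M3 =
     {F. bilinear_map (scl M1) (scl M2) (scl_completion M3) F \<and> (\<forall>w1 w2. F w1 w2 \<in> completion V M3)}"

text \<open>The coefficients of \<open>x\<^sub>1\<^sup>a x\<^sub>0\<^sup>c\<close> in the component of weight \<open>n\<close> of the defining identity.\<close>

definition intertwining_maps ::
  "'v::ab_group_add voa \<Rightarrow> complex \<Rightarrow> ('v, 'a::ab_group_add) vact \<Rightarrow> ('v, 'b::ab_group_add) vact \<Rightarrow>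
   ('v, 'c::ab_group_add) vact \<Rightarrow> ('a \<Rightarrow> 'b \<Rightarrow> complex \<Rightarrow> 'c) set" where
  "intertwining_maps V z M1 M2 M3 =
     {F \<in> tensor_hom V M1 M2 M3. \<forall>v w1 w2 a c n.
        Sum_any (\<lambda>a'. scl M3 (delta_y_z_x0 z a' c) (vop_completion V M3 v (a - a') (F w1 w2) n))
      = Sum_any (\<lambda>c'. scl M3 (delta_y_x0_z z a c') (F (vop M1 v (c - c') w1) w2 n))
      + Sum_any (\<lambda>a'. scl M3 (delta_z_y_x0 z a' c) (F w1 (vop M2 v (a - a') w2) n))}"


section \<open>The action \<open>\<tau>\<^bsub>P(z)\<^esub>\<close> on \<open>(W\<^sub>1 \<otimes> W\<^sub>2)\<^sup>*\<close>\<close>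

text \<open>
  Elements of \<open>V \<otimes> \<iota>\<^sub>+\<complex>[t, t\<^sup>-\<^sup>1, (z\<^sup>-\<^sup>1 - t)\<^sup>-\<^sup>1]\<close> are written as Laurent series in \<open>t\<close> with
  coefficients in \<open>V\<close>, that is, as functions \<open>int \<Rightarrow> 'v\<close>. \<open>Yt v k\<close> is the coefficient
  \<open>v \<otimes> t\<^sup>-\<^sup>k\<^sup>-\<^sup>1\<close> of \<open>x\<^sup>k\<close> in \<open>Y\<^sub>t(v,x)\<close>, and \<open>tau_gen V z v a c\<close> is the coefficient of
  \<open>x\<^sub>1\<^sup>a x\<^sub>0\<^sup>c\<close> in \<open>x\<^sub>0\<^sup>-\<^sup>1 \<delta>((x\<^sub>1\<^sup>-\<^sup>1 - z)/x\<^sub>0) Y\<^sub>t(v,x\<^sub>1)\<close>. With \<open>m = -a-1\<close> and \<open>n = -c-1\<close> this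
  is \<open>v \<otimes> \<iota>\<^sub>+(t\<^sup>m (t\<^sup>-\<^sup>1 - z)\<^sup>n)\<close>; these elements span the whole space.
\<close>

definition Yt :: "'v::zero \<Rightarrow> int \<Rightarrow> int \<Rightarrow> 'v" where
  "Yt v k = (\<lambda>j. if j = - k - 1 then v else 0)"

definition tau_gen :: "'v::ab_group_add voa \<Rightarrow> complex \<Rightarrow> 'v \<Rightarrow> int \<Rightarrow> int \<Rightarrow> int \<Rightarrow> 'v" where
  "tau_gen V z v a c =
     (\<lambda>j. Sum_any (\<lambda>a'. scl (reg V) (delta_y_z_x0 z (- a') c) (Yt v (a - a') j)))"

definition laurent_scl :: "'v voa \<Rightarrow> complex \<Rightarrow> (int \<Rightarrow> 'v) \<Rightarrow> int \<Rightarrow> 'v" where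
  "laurent_scl V c xi j = scl (reg V) c (xi j)"

definition tau_domain :: "'v::ab_group_add voa \<Rightarrow> complex \<Rightarrow> (int \<Rightarrow> 'v) set" where
  "tau_domain V z = module.span (laurent_scl V) {tau_gen V z v a c | v a c. True}"

definition tensor_dual_scl :: "complex \<Rightarrow> ('a \<Rightarrow> 'b \<Rightarrow> complex) \<Rightarrow> 'a \<Rightarrow> 'b \<Rightarrow> complex" where
  "tensor_dual_scl c l w1 w2 = c * l w1 w2"

text \<open>
  The coefficient of \<open>x\<^sub>1\<^sup>a x\<^sub>0\<^sup>c\<close> in the right-hand side of the definition of \<open>\<tau>\<^bsub>P(z)\<^esub>\<close>. The delta
  functions contain \<open>x\<^sub>1\<^sup>-\<^sup>1\<close>, so the coefficient of \<open>x\<^sub>1\<^bsup>a'\<^esup>\<close> in them is the one at \<open>y\<^bsup>-a'\<^esup>\<close>.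
\<close>

definition tau_rhs ::
  "'v::ab_group_add voa \<Rightarrow> complex \<Rightarrow> ('v, 'a::ab_group_add) vact \<Rightarrow> ('v, 'b::ab_group_add) vact \<Rightarrow>
   'v \<Rightarrow> int \<Rightarrow> int \<Rightarrow> ('a \<Rightarrow> 'b \<Rightarrow> complex) \<Rightarrow> 'a \<Rightarrow> 'b \<Rightarrow> complex" where
  "tau_rhs V z M1 M2 v a c l w1 w2 =
     Sum_any (\<lambda>(a', c'). delta_y_x0_z z (- a') c' * l (vop M1 (theta V v (a - a')) (c - c') w1) w2)
   + Sum_any (\<lambda>a'. delta_z_y_x0 z (- a') c * l w1 (vop_star V M2 v (a - a') w2))"

text \<open>
  On \<open>tau_domain\<close> and \<open>tensor_dual\<close>, \<open>tau\<close> is the linear map determined by its values on the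
  spanning elements. The map exists because the linear relations among the \<open>tau_gen V z v a c\<close>,
  which follow from linearity in \<open>v\<close> and from multiplication of the delta function by
  \<open>x\<^sub>0 = x\<^sub>1\<^sup>-\<^sup>1 - z\<close>, also hold for the right-hand sides.
\<close>

definition tau ::
  "'v::ab_group_add voa \<Rightarrow> complex \<Rightarrow> ('v, 'a::ab_group_add) vact \<Rightarrow> ('v, 'b::ab_group_add) vact \<Rightarrow>
   (int \<Rightarrow> 'v) \<Rightarrow> ('a \<Rightarrow> 'b \<Rightarrow> complex) \<Rightarrow> 'a \<Rightarrow> 'b \<Rightarrow> complex" where
  "tau V z M1 M2 =
     (SOME T.
        (\<forall>l\<in>tensor_dual M1 M2.
           linear_on (laurent_scl V) (tau_domain V z) tensor_dual_scl (\<lambda>xi. T xi l)) \<and>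
        (\<forall>v a c. \<forall>l\<in>tensor_dual M1 M2. T (tau_gen V z v a c) l = tau_rhs V z M1 M2 v a c l))"

definition tensor_dual_act ::
  "'v::ab_group_add voa \<Rightarrow> complex \<Rightarrow> ('v, 'a::ab_group_add) vact \<Rightarrow> ('v, 'b::ab_group_add) vact \<Rightarrow>
   ('v, 'a \<Rightarrow> 'b \<Rightarrow> complex) vact" where
  "tensor_dual_act V z M1 M2 =
     \<lparr>scl = tensor_dual_scl, vop = (\<lambda>v k. tau V z M1 M2 (Yt v k))\<rparr>"

definition P_compatible ::
  "'v::ab_group_add voa \<Rightarrow> complex \<Rightarrow> ('v, 'a::ab_group_add) vact \<Rightarrow> ('v, 'b::ab_group_add) vact \<Rightarrow>
   ('a \<Rightarrow> 'b \<Rightarrow> complex) \<Rightarrow> bool" where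
  "P_compatible V z M1 M2 l \<longleftrightarrow>
     (\<forall>v. (\<exists>N. \<forall>k<N. vop (tensor_dual_act V z M1 M2) v k l = 0) \<and>
          (\<forall>a c. tau V z M1 M2 (tau_gen V z v a c) l =
             Sum_any (\<lambda>a'. tensor_dual_scl (delta_y_z_x0 z (- a') c)
                             (vop (tensor_dual_act V z M1 M2) v (a - a') l))))"

definition diamond ::
  "'v::ab_group_add voa \<Rightarrow> complex \<Rightarrow> ('v, 'a::ab_group_add) vact \<Rightarrow> ('v, 'b::ab_group_add) vact \<Rightarrow>
   ('a \<Rightarrow> 'b \<Rightarrow> complex) set" where
  "diamond V z M1 M2 =
     module.span tensor_dual_scl
       (\<Union> {W. W \<subseteq> tensor_dual M1 M2 \<and> vmodule V (tensor_dual_act V z M1 M2) W \<and>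
               (\<forall>l\<in>W. P_compatible V z M1 M2 l)})"


section \<open>The correspondence between \<open>F\<close> and \<open>G\<close>\<close>

definition contragredient_hom_scl ::
  "complex \<Rightarrow> (('c \<Rightarrow> complex) \<Rightarrow> 'a \<Rightarrow> 'b \<Rightarrow> complex) \<Rightarrow> ('c \<Rightarrow> complex) \<Rightarrow> 'a \<Rightarrow> 'b \<Rightarrow> complex" where
  "contragredient_hom_scl c G w' = tensor_dual_scl c (G w')"

definition transpose_map ::
  "'v voa \<Rightarrow> ('v, 'c::ab_group_add) vact \<Rightarrow> ('a \<Rightarrow> 'b \<Rightarrow> complex \<Rightarrow> 'c) \<Rightarrow>
   ('c \<Rightarrow> complex) \<Rightarrow> 'a \<Rightarrow> 'b \<Rightarrow> complex" where
  "transpose_map V M3 F w' w1 w2 = (if w' \<in> contragredient V M3 then pairing w' (F w1 w2) else 0)"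

end

theory Submission
  imports Defs "HOL-Computational_Algebra.Formal_Power_Series"
begin

text \<open>
  Both conditions on a map are tested against elements \<open>w'\<close> of \<open>W\<^sub>3'\<close>. An element \<open>F\<close> of
  \<open>Hom(W\<^sub>1 \<otimes> W\<^sub>2, \<overline>W\<^sub>3)\<close> satisfies the defining identity of an intertwining map for \<open>u\<close> if and only if
  the transposed map \<open>G\<close> satisfies a scalar identity for all \<open>u\<close> and \<open>w'\<close>. Replacing \<open>u\<close> by
  \<open>e\<^bsup>xL(1)\<^esup> (-x\<^sup>-\<^sup>2)\<^bsup>L(0)\<^esup> v\<close>, an invertible change of vectors, turns this identity into
  \<open>\<tau>(x\<^sub>0\<^sup>-\<^sup>1 \<delta>((x\<^sub>1\<^sup>-\<^sup>1 - z)/x\<^sub>0) Y\<^sub>t(v,x\<^sub>1)) G(w') = x\<^sub>0\<^sup>-\<^sup>1 \<delta>((x\<^sub>1\<^sup>-\<^sup>1 - z)/x\<^sub>0) G(Y'(v,x\<^sub>1)w')\<close>.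
  Its residue in \<open>x\<^sub>0\<close> says that \<open>G\<close> intertwines the actions of \<open>V\<close>, and then the whole identity is the
  compatibility condition for \<open>G(w')\<close>. Hence \<open>G(W\<^sub>3')\<close> is a compatible module, because \<open>W\<^sub>3'\<close> is a
  module, and it lies in \<open>W\<^sub>1 \<diamond> W\<^sub>2\<close>. The Jacobi identity for \<open>W\<^sub>3'\<close> is that of \<open>W\<^sub>3\<close> read backwards,
  up to the commutation of powers of \<open>L(1)\<close> with the modes of \<open>V\<close> and a Vandermonde identity.
\<close>

section \<open>Finitely supported sums and linear maps\<close>

text \<open>Every delta function that occurs is supported on a ray once enough exponents are fixed,
  so all formal identities become sums over a natural number with explicit binomial coefficients. A
  residue is then the choice -1 for one exponent, and multiplication of a delta function by x_0 is
  Pascal's rule. The recurring obstacle is finiteness: \<open>Sum_any\<close> of an infinitely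
  supported family is 0, so sums may be split or exchanged only after a truncation argument. On W_3'
  these come from the grading: a functional sees finitely many weights, the real parts of the
  weights are bounded below, and modes shift weights, so a functional kills all modes of large
  degree uniformly in the vector. Finite-dimensional weight spaces enter through dual bases, which
  also rebuild F from G. A second obstacle is that \<open>tau\<close> is given by a choice: a linear
  map with the prescribed values has to be exhibited. Instead of listing the relations among the
  generators, one multiplies by t^{-1} - z until only a Laurent polynomial is left, where the value
  is forced.\<close>

lemma Sum_any_reindex_inj:
  assumes "inj h" and "\<And>x. x \<notin> range h \<Longrightarrow> g x = 0"
  shows "Sum_any g = Sum_any (\<lambda>i. g (h i))"
proof -
  have "{x. g x \<noteq> 0} = h ` {i. g (h i) \<noteq> 0}"
    using assms(2) by (fastforce simp: image_iff)
  moreover have "inj_on h {i. g (h i) \<noteq> 0}"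
    using assms(1) by (rule inj_on_subset) simp
  ultimately show ?thesis
    by (simp add: Sum_any.expand_set sum.reindex)
qed

lemma Sum_any_eq_sum_lessThan:
  fixes f :: "nat \<Rightarrow> 'w::comm_monoid_add"
  assumes "\<And>i. N \<le> i \<Longrightarrow> f i = 0"
  shows "Sum_any f = sum f {..<N}"
proof (rule Sum_any.expand_superset)
  show "{i. f i \<noteq> 0} \<subseteq> {..<N}"
    using assms not_le by auto
qed simp

lemma finite_support_natI:
  fixes f :: "nat \<Rightarrow> 'w::zero"
  assumes "\<And>i. N \<le> i \<Longrightarrow> f i = 0"
  shows "finite {i. f i \<noteq> 0}"
  by (rule finite_subset[of _ "{..<N}"]) (use assms not_le in auto)

lemma Sum_any_single:
  assumes "\<And>i. i \<noteq> k \<Longrightarrow> f i = 0"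
  shows "Sum_any f = f k"
  using Sum_any.expand_superset[of "{k}" f] assms by auto

lemma Sum_any_apply:
  fixes F :: "'i \<Rightarrow> 'x \<Rightarrow> 'w::comm_monoid_add"
  assumes "finite {i. F i \<noteq> 0}"
  shows "Sum_any F x = Sum_any (\<lambda>i. F i x)"
proof -
  have "Sum_any (\<lambda>i. F i x) = (\<Sum>i\<in>{i. F i \<noteq> 0}. F i x)"
    by (rule Sum_any.expand_superset) (use assms in auto)
  moreover have "(\<Sum>i\<in>A. F i) x = (\<Sum>i\<in>A. F i x)" for A
    by (induction A rule: infinite_finite_induct) auto
  ultimately show ?thesis
    by (simp add: Sum_any.expand_set)
qed

lemma Sum_any_diff:
  fixes f g :: "'i \<Rightarrow> 'w::ab_group_add"
  assumes "finite {i. f i \<noteq> 0}" "finite {i. g i \<noteq> 0}"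
  shows "Sum_any (\<lambda>i. f i - g i) = Sum_any f - Sum_any g"
proof -
  let ?A = "{i. f i \<noteq> 0} \<union> {i. g i \<noteq> 0}"
  have "Sum_any (\<lambda>i. f i - g i) = sum (\<lambda>i. f i - g i) ?A" "Sum_any f = sum f ?A" "Sum_any g = sum g ?A"
    by (rule Sum_any.expand_superset; use assms in auto)+
  then show ?thesis
    by (simp add: sum_subtractf)
qed

lemma linear_onI:
  assumes "\<And>x y. x \<in> A \<Longrightarrow> y \<in> A \<Longrightarrow> f (x + y) = f x + f y"
    and "\<And>c x. x \<in> A \<Longrightarrow> f (s c x) = t c (f x)"
  shows "linear_on s A t f"
  using assms by (auto simp: linear_on_def)

lemma linear_on_add: "linear_on s A t f \<Longrightarrow> x \<in> A \<Longrightarrow> y \<in> A \<Longrightarrow> f (x + y) = f x + f y"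
  by (auto simp: linear_on_def)

lemma linear_on_scale: "linear_on s A t f \<Longrightarrow> x \<in> A \<Longrightarrow> f (s c x) = t c (f x)"
  by (auto simp: linear_on_def)

lemma linear_on_0:
  assumes "linear_on s A t f" "0 \<in> A"
  shows "f 0 = 0"
  using linear_on_add[OF assms(1) assms(2) assms(2)] by simp

lemma linear_on_sum:
  assumes f: "linear_on s A t f" and A: "module.subspace s A" "vector_space s" and "\<And>i. i \<in> I \<Longrightarrow> g i \<in> A"
  shows "f (sum g I) = (\<Sum>i\<in>I. f (g i))"
proof -
  interpret vector_space s by fact
  have 0: "0 \<in> A"
    using A subspace_0 by blast
  show ?thesis
    using assms(4)
  proof (induction I rule: infinite_finite_induct)
    case (insert i I)
    then have "sum g I \<in> A"
      using A(1) by (intro subspace_sum) auto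
    then show ?case
      using insert linear_on_add[OF f, of "g i" "sum g I"] by simp
  qed (use linear_on_0[OF f 0] in auto)
qed

lemma linear_on_Sum_any:
  assumes f: "linear_on s A t f" and A: "module.subspace s A" "vector_space s"
    and g: "\<And>i. g i \<in> A" and fin: "finite {i. g i \<noteq> 0}"
  shows "f (Sum_any g) = Sum_any (\<lambda>i. f (g i))"
proof -
  interpret vector_space s by fact
  have "f 0 = 0"
    using linear_on_0[OF f] A subspace_0 by blast
  then have "Sum_any (\<lambda>i. f (g i)) = (\<Sum>i\<in>{i. g i \<noteq> 0}. f (g i))"
    by (intro Sum_any.expand_superset) (use fin in auto)
  then show ?thesis
    using linear_on_sum[OF f A, of "{i. g i \<noteq> 0}" g] g by (simp add: Sum_any.expand_set)
qed

lemma subspace_Sum_any: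
  assumes "module.subspace s A" "vector_space s" "\<And>i. g i \<in> A"
  shows "Sum_any g \<in> A"
proof -
  interpret vector_space s by fact
  show ?thesis
    using assms by (auto simp: Sum_any.expand_set intro: subspace_sum)
qed

context vector_space
begin

lemma scale_Sum_any_right:
  assumes "finite {i. g i \<noteq> 0}"
  shows "scale c (Sum_any g) = Sum_any (\<lambda>i. scale c (g i))"
proof -
  have "Sum_any (\<lambda>i. scale c (g i)) = (\<Sum>i\<in>{i. g i \<noteq> 0}. scale c (g i))"
    by (rule Sum_any.expand_superset) (use assms in auto)
  then show ?thesis
    by (simp add: Sum_any.expand_set scale_sum_right)
qed

lemma finite_scale: "finite {i. g i \<noteq> 0} \<Longrightarrow> finite {i. scale (c i) (g i) \<noteq> 0}"
  by (erule rev_finite_subset) auto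

end


section \<open>Direct sums and eigenspaces\<close>

lemma is_direct_sum_component:
  assumes "is_direct_sum E W" "w \<in> W"
  shows component_mem: "component E i w \<in> E i"
    and component_finite: "finite {i. component E i w \<noteq> 0}"
    and component_sum: "Sum_any (\<lambda>i. component E i w) = w"
proof -
  let ?P = "\<lambda>f. (\<forall>i. f i \<in> E i) \<and> finite {i. f i \<noteq> 0} \<and> Sum_any f = w"
  have "\<exists>!f. ?P f"
    using assms by (auto simp: is_direct_sum_def)
  from theI'[OF this] have P: "?P (\<lambda>i. component E i w)"
    unfolding component_def by simp
  from P show "component E i w \<in> E i" "finite {i. component E i w \<noteq> 0}"
    "Sum_any (\<lambda>i. component E i w) = w"
    by auto
qed

lemma component_eqI:
  assumes "is_direct_sum E W" "w \<in> W" "\<And>i. f i \<in> E i" "finite {i. f i \<noteq> 0}" "Sum_any f = w"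
  shows "component E i w = f i"
proof -
  have "\<exists>!f. (\<forall>i. f i \<in> E i) \<and> finite {i. f i \<noteq> 0} \<and> Sum_any f = w"
    using assms by (auto simp: is_direct_sum_def)
  then have "(THE f. (\<forall>i. f i \<in> E i) \<and> finite {i. f i \<noteq> 0} \<and> Sum_any f = w) = f"
    using assms by (intro the1_equality) auto
  then show ?thesis
    by (simp add: component_def)
qed

text \<open>The index type is left open because V is graded by integers and its modules by complex
  numbers.\<close>

locale direct_sum = vector_space s for s :: "complex \<Rightarrow> 'w::ab_group_add \<Rightarrow> 'w" +
  fixes E :: "'i \<Rightarrow> 'w set"
  assumes direct_sum: "is_direct_sum E UNIV" and subspace_summand: "\<And>i. subspace (E i)"
begin

lemmas comp_mem = component_mem[OF direct_sum UNIV_I]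
lemmas comp_finite = component_finite[OF direct_sum UNIV_I]
lemmas comp_sum = component_sum[OF direct_sum UNIV_I]

lemma comp_add: "component E i (x + y) = component E i x + component E i y"
proof (rule component_eqI[OF direct_sum])
  show "finite {i. component E i x + component E i y \<noteq> 0}"
    by (rule finite_subset[OF _ finite_UnI[OF comp_finite[of x] comp_finite[of y]]]) auto
  show "(Sum_any (\<lambda>i. component E i x + component E i y)) = x + y"
    by (simp add: Sum_any.distrib comp_finite comp_sum)
qed (auto intro: subspace_add[OF subspace_summand] comp_mem)

lemma comp_scale: "component E i (s c x) = s c (component E i x)"
proof (rule component_eqI[OF direct_sum])
  show "finite {i. s c (component E i x) \<noteq> 0}"
    by (rule finite_scale[OF comp_finite])
  show "(Sum_any (\<lambda>i. s c (component E i x))) = s c x"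
    using scale_Sum_any_right[OF comp_finite[of x], of c] by (simp add: comp_sum)
qed (auto intro: subspace_scale[OF subspace_summand] comp_mem)

lemma comp_summand:
  assumes "x \<in> E j"
  shows "component E i x = (if i = j then x else 0)"
proof (rule component_eqI[OF direct_sum])
  show "finite {i. (if i = j then x else 0) \<noteq> 0}"
    by (rule finite_subset[of _ "{j}"]) auto
  show "(Sum_any (\<lambda>i. if i = j then x else 0)) = x"
    by simp
qed (use assms subspace_0[OF subspace_summand] in auto)

lemma direct_sum_induct [case_names zero add summand]:
  assumes "P 0" "\<And>x y. P x \<Longrightarrow> P y \<Longrightarrow> P (x + y)" "\<And>i x. x \<in> E i \<Longrightarrow> P x"
  shows "P x"
proof -
  have "P (\<Sum>i\<in>I. component E i x)" for I
  proof (induction I rule: infinite_finite_induct)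
    case (insert i I)
    then show ?case
      using assms(2) assms(3)[OF comp_mem] by (simp del: add_uminus_conv_diff)
  qed (use assms(1) in auto)
  then have "P (Sum_any (\<lambda>i. component E i x))"
    by (simp add: Sum_any.expand_set)
  then show ?thesis
    by (simp add: comp_sum)
qed

end

text \<open>The index of each vector is its eigenvalue. Subtracting \<open>k\<close> times the
  relation from its image under \<open>D\<close> removes \<open>f k\<close> and multiplies every
  other \<open>f i\<close> by the nonzero number \<open>i - k\<close>.\<close>

lemma eigenvectors_sum_eq_0:
  assumes "vector_space s" and A: "module.subspace s A" and D: "linear_on s A s D" and "finite I"
    and "\<And>i. i \<in> I \<Longrightarrow> f i \<in> A \<and> D (f i) = s i (f i)" and "sum f I = 0"
  shows "\<forall>i\<in>I. f i = 0"
  using assms(4-6)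
proof (induction I arbitrary: f rule: finite_induct)
  case (insert k I)
  interpret vector_space s by fact
  define g where "g i = s (i - k) (f i)" for i
  have fA: "f i \<in> A" "D (f i) = s i (f i)" if "i \<in> insert k I" for i
    using insert.prems(1) that by auto
  have "0 = D (sum f (insert k I))"
    using insert.prems(2) linear_on_0[OF D subspace_0[OF A]] by simp
  also have "\<dots> = (\<Sum>i\<in>insert k I. s i (f i))"
    using fA by (subst linear_on_sum[OF D A assms(1)]) (auto simp del: sum.insert intro: sum.cong)
  finally have "0 = (\<Sum>i\<in>insert k I. s i (f i)) - s k (sum f (insert k I))"
    using insert.prems(2) by simp
  also have "\<dots> = (\<Sum>i\<in>insert k I. g i)"
    by (simp only: g_def scale_sum_right sum_subtractf[symmetric] scale_left_diff_distrib)
  also have "\<dots> = sum g I"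
    using insert.hyps by (simp add: g_def)
  finally have "sum g I = 0" by simp
  moreover have "g i \<in> A \<and> D (g i) = s i (g i)" if "i \<in> I" for i
    using that fA[of i] subspace_scale[OF A] linear_on_scale[OF D, of "f i"]
    by (auto simp: g_def scale_left_commute)
  ultimately have "\<forall>i\<in>I. g i = 0"
    using insert.IH by blast
  then have "\<forall>i\<in>I. f i = 0"
    using insert.hyps by (auto simp: g_def)
  then show ?case
    using insert.prems(2) insert.hyps by simp
qed simp

text \<open>Uniqueness of the decomposition is automatic for eigenspaces, so only existence has to
  be checked for W', for images and for sums of modules.\<close>

lemma is_direct_sum_eigenspacesI:
  assumes s: "vector_space s" and A: "module.subspace s A" and D: "linear_on s A s D"
    and ex: "\<And>w. w \<in> A \<Longrightarrow> \<exists>f. (\<forall>n. f n \<in> A \<and> D (f n) = s n (f n)) \<and> finite {n. f n \<noteq> 0} \<and> Sum_any f = w"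
  shows "is_direct_sum (\<lambda>n. {w \<in> A. D w = s n w}) A"
  unfolding is_direct_sum_def
proof (intro conjI allI ballI)
  fix w assume w: "w \<in> A"
  interpret vector_space s by fact
  show "\<exists>!f. (\<forall>n. f n \<in> {w \<in> A. D w = s n w}) \<and> finite {n. f n \<noteq> 0} \<and> Sum_any f = w"
  proof (rule ex_ex1I)
    show "\<exists>f. (\<forall>n. f n \<in> {w \<in> A. D w = s n w}) \<and> finite {n. f n \<noteq> 0} \<and> Sum_any f = w"
      using ex[OF w] by auto
  next
    fix f g
    assume f: "(\<forall>n. f n \<in> {w \<in> A. D w = s n w}) \<and> finite {n. f n \<noteq> 0} \<and> Sum_any f = w"
      and g: "(\<forall>n. g n \<in> {w \<in> A. D w = s n w}) \<and> finite {n. g n \<noteq> 0} \<and> Sum_any g = w"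
    let ?I = "{n. f n \<noteq> 0} \<union> {n. g n \<noteq> 0}"
    have "sum f ?I = w" "sum g ?I = w"
      using f g Sum_any.expand_superset[of ?I f] Sum_any.expand_superset[of ?I g] by auto
    then have sum0: "(\<Sum>i\<in>?I. f i - g i) = 0"
      by (simp add: sum_subtractf)
    have eig: "f i - g i \<in> A \<and> D (f i - g i) = s i (f i - g i)" for i
    proof -
      have "D (s (-1) (g i)) = s (-1) (s i (g i))" "f i \<in> A" "g i \<in> A" "s (-1) (g i) \<in> A"
        using f g linear_on_scale[OF D, of "g i" "-1"] subspace_neg[OF A, of "g i"] by auto
      then show ?thesis
        using f linear_on_add[OF D, of "f i" "s (-1) (g i)"] subspace_diff[OF A, of "f i" "g i"]
        by (auto simp: scale_right_diff_distrib)
    qed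
    have fin: "finite ?I"
      using f g by simp
    have all: "\<forall>i\<in>?I. f i - g i = 0"
      by (rule eigenvectors_sum_eq_0[where f = "\<lambda>i. f i - g i", OF s A D fin eig sum0])
    have "f i = g i" for i
    proof (cases "i \<in> ?I")
      case True
      then show ?thesis
        using bspec[OF all True] by (metis eq_iff_diff_eq_0)
    next
      case False
      then show ?thesis by simp
    qed
    then show "f = g" ..
  qed
qed auto

lemma is_direct_sumE:
  assumes "is_direct_sum E W" "w \<in> W"
  obtains f where "\<And>i. f i \<in> E i" "finite {i. f i \<noteq> 0}" "Sum_any f = w"
proof -
  have "\<exists>!f. (\<forall>i. f i \<in> E i) \<and> finite {i. f i \<noteq> 0} \<and> Sum_any f = w"
    using assms by (auto simp: is_direct_sum_def)
  then show ?thesis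
    using that by (elim ex1E) blast
qed

section \<open>The Jacobi identity in coefficients\<close>

text \<open>Fixing the exponent \<open>c\<close> of C in C^{-1} delta((A - B)/C) leaves the power (A
  - B)^{-1-c}; this is its coefficient at B^i.\<close>

definition jacobi_coeff :: "int \<Rightarrow> nat \<Rightarrow> complex" where
  "jacobi_coeff c i = (-1) ^ i * (of_int (- 1 - c) gchoose i)"

text \<open>With \<open>a\<close>, \<open>b\<close>, \<open>c\<close> fixed, each of the three delta
  functions has a single free exponent left, so one natural index per sum suffices. This form of the
  Jacobi identity is known as Borcherds' identity.\<close>

definition borcherds_identity ::
  "'v::ab_group_add voa \<Rightarrow> ('v, 'w::ab_group_add) vact \<Rightarrow> 'v \<Rightarrow> 'v \<Rightarrow> 'w \<Rightarrow> int \<Rightarrow> int \<Rightarrow> int \<Rightarrow> bool" where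
  "borcherds_identity V M u v w a b c \<longleftrightarrow>
     (Sum_any (\<lambda>i. scl M (jacobi_coeff c i) (vop M u (a + 1 + c + int i) (vop M v (b - int i) w))))
   - (Sum_any (\<lambda>i. scl M ((-1) powi (c + 1) * jacobi_coeff c i) (vop M v (b + 1 + c + int i) (vop M u (a - int i) w))))
   = (Sum_any (\<lambda>i. scl M (of_int (- a - 1) gchoose i) (vop M (vop (reg V) u (c - int i) v) (b + a + 1 + int i) w)))"

lemma delta3_eq_jacobi_coeff: "delta3 (- 1 - c - int i) (int i) c = jacobi_coeff c i"
  by (simp add: delta3_def jacobi_coeff_def)

text \<open>Negating the upper index removes \<open>i\<close> from it. The sum over the iterates is
  then visibly finite for negative \<open>a\<close>, and its binomials have the shape that a
  Vandermonde identity can absorb.\<close>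

lemma delta3_eq_gbinomial: "delta3 a (int i) (- a - 1 - int i) = (of_int (- a - 1) gchoose i)"
proof -
  have "(of_int (- a - 1) gchoose i) = (- (of_int a + 1) gchoose i :: complex)"
    by simp
  also have "\<dots> = (-1) ^ i * (of_int a + 1 + of_nat i - 1 gchoose i)"
    by (rule gbinomial_minus)
  finally show ?thesis
    by (simp add: delta3_def)
qed

lemma delta3_eq_0:
  assumes "\<And>n. j = int n \<Longrightarrow> i \<noteq> - 1 - k - int n"
  shows "delta3 i j k = 0"
  using assms[of "nat j"] by (auto simp: delta3_def)

lemma jacobi_identity_iff:
  assumes "vector_space (scl M)"
  shows "jacobi_identity V M W \<longleftrightarrow> (\<forall>u v. \<forall>w\<in>W. \<forall>a b c. borcherds_identity V M u v w a b c)"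
proof -
  interpret vector_space "scl M" by fact
  have 1: "Sum_any (\<lambda>(a', b'). scl M (delta3 a' b' c) (vop M u (a - a') (vop M v (b - b') w)))
    = (Sum_any (\<lambda>i. scl M (jacobi_coeff c i) (vop M u (a + 1 + c + int i) (vop M v (b - int i) w))))" for u v w a b c
  proof -
    have "Sum_any (\<lambda>(a', b'). scl M (delta3 a' b' c) (vop M u (a - a') (vop M v (b - b') w)))
      = (Sum_any (\<lambda>i. case (- 1 - c - int i, int i) of (a', b') \<Rightarrow>
           scl M (delta3 a' b' c) (vop M u (a - a') (vop M v (b - b') w))))"
    proof (rule Sum_any_reindex_inj)
      fix p assume "p \<notin> range (\<lambda>i. (- 1 - c - int i, int i))"
      then show "(case p of (a', b') \<Rightarrow> scl M (delta3 a' b' c) (vop M u (a - a') (vop M v (b - b') w))) = 0"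
        by (cases p) (auto simp: image_iff intro: delta3_eq_0)
    qed (simp add: inj_def)
    then show ?thesis
      unfolding prod.case delta3_eq_jacobi_coeff
      by (simp add: algebra_simps)
  qed
  have 2: "Sum_any (\<lambda>(a', b'). scl M ((-1) powi (c + 1) * delta3 b' a' c) (vop M v (b - b') (vop M u (a - a') w)))
    = (Sum_any (\<lambda>i. scl M ((-1) powi (c + 1) * jacobi_coeff c i) (vop M v (b + 1 + c + int i) (vop M u (a - int i) w))))" for u v w a b c
  proof -
    have "Sum_any (\<lambda>(a', b'). scl M ((-1) powi (c + 1) * delta3 b' a' c) (vop M v (b - b') (vop M u (a - a') w)))
      = (Sum_any (\<lambda>i. case (int i, - 1 - c - int i) of (a', b') \<Rightarrow>
           scl M ((-1) powi (c + 1) * delta3 b' a' c) (vop M v (b - b') (vop M u (a - a') w))))"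
    proof (rule Sum_any_reindex_inj)
      fix p assume "p \<notin> range (\<lambda>i. (int i, - 1 - c - int i))"
      then show "(case p of (a', b') \<Rightarrow> scl M ((-1) powi (c + 1) * delta3 b' a' c) (vop M v (b - b') (vop M u (a - a') w))) = 0"
        by (cases p) (auto simp: image_iff intro: delta3_eq_0)
    qed (simp add: inj_def)
    then show ?thesis
      unfolding prod.case delta3_eq_jacobi_coeff
      by (simp add: algebra_simps)
  qed
  have 3: "Sum_any (\<lambda>(b', c'). scl M (delta3 a c' b') (vop M (vop (reg V) u (c - c') v) (b - b') w))
    = (Sum_any (\<lambda>i. scl M (of_int (- a - 1) gchoose i) (vop M (vop (reg V) u (c - int i) v) (b + a + 1 + int i) w)))" for u v w a b c
  proof -
    have "Sum_any (\<lambda>(b', c'). scl M (delta3 a c' b') (vop M (vop (reg V) u (c - c') v) (b - b') w))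
      = (Sum_any (\<lambda>i. case (- a - 1 - int i, int i) of (b', c') \<Rightarrow>
           scl M (delta3 a c' b') (vop M (vop (reg V) u (c - c') v) (b - b') w)))"
    proof (rule Sum_any_reindex_inj)
      fix p assume "p \<notin> range (\<lambda>i. (- a - 1 - int i, int i))"
      then show "(case p of (b', c') \<Rightarrow> scl M (delta3 a c' b') (vop M (vop (reg V) u (c - c') v) (b - b') w)) = 0"
        by (cases p) (auto simp: image_iff intro: delta3_eq_0)
    qed (simp add: inj_def)
    then show ?thesis
      unfolding prod.case delta3_eq_gbinomial
      by (simp add: algebra_simps)
  qed
  show ?thesis
    unfolding jacobi_identity_def borcherds_identity_def 1 2 3 by blast
qed

section \<open>Vertex operator algebras and actions\<close>

locale voa =
  fixes V :: "'v::ab_group_add voa"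
  assumes voa: "vertex_operator_algebra V"

locale vaction = voa V for V :: "'v::ab_group_add voa" +
  fixes M :: "('v, 'w::ab_group_add) vact"
  assumes vertex_action: "vertex_action V M UNIV"
begin

sublocale vs: vector_space "scl M"
  using vertex_action by (simp add: vertex_action_def)

lemma vop_linear: "linear_on (scl M) UNIV (scl M) (vop M v k)"
  using vertex_action by (auto simp: vertex_action_def)

lemma vop_linear_left: "linear_on (scl (reg V)) UNIV (scl M) (\<lambda>v. vop M v k w)"
  using vertex_action by (auto simp: vertex_action_def)

lemma vop_add: "vop M v k (x + y) = vop M v k x + vop M v k y"
  and vop_scale: "vop M v k (scl M t x) = scl M t (vop M v k x)"
  and vop_add_left: "vop M (u + v) k x = vop M u k x + vop M v k x"
  and vop_scale_left: "vop M (scl (reg V) t v) k x = scl M t (vop M v k x)"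
  using vop_linear[of v k] vop_linear_left[of k x] by (auto simp: linear_on_def)

lemma vop_0 [simp]: "vop M v k 0 = 0"
  using vop_add[of v k 0 0] by simp

lemma vop_0_left [simp]: "vop M 0 k x = 0"
  using vop_add_left[of 0 0 k x] by simp

lemma vop_sum: "vop M v k (sum g I) = (\<Sum>i\<in>I. vop M v k (g i))"
  by (induction I rule: infinite_finite_induct) (auto simp: vop_add)

lemma vop_sum_left: "vop M (sum g I) k x = (\<Sum>i\<in>I. vop M (g i) k x)"
  by (induction I rule: infinite_finite_induct) (auto simp: vop_add_left)

lemma vop_Sum_any: "finite {i. g i \<noteq> 0} \<Longrightarrow> vop M v k (Sum_any g) = (Sum_any (\<lambda>i. vop M v k (g i)))"
  by (rule linear_on_Sum_any[OF vop_linear]) (auto simp: vs.vector_space_axioms)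

lemma vop_trunc: obtains N where "\<forall>k<N. vop M v k w = 0"
proof -
  have "\<exists>N. \<forall>k<N. vop M v k w = 0"
    using vertex_action by (simp add: vertex_action_def)
  then show thesis
    using that by blast
qed

lemma vop_vac: "vop M (vac V) k w = (if k = 0 then w else 0)"
  using vertex_action by (auto simp: vertex_action_def)

lemma vop_derivative: "vop M (vop (reg V) (conf V) (- 1) v) k w = scl M (of_int (k + 1)) (vop M v (k + 1) w)"
  using vertex_action by (auto simp: vertex_action_def Lmode_def)

lemma borcherds: "borcherds_identity V M u v w a b c"
  using vertex_action jacobi_identity_iff[OF vs.vector_space_axioms, of V UNIV]
  by (auto simp: vertex_action_def)

text \<open>This is the residue in x_0, that is \<open>c = -1\<close>, where the delta factor of
  each product reduces to its first term.\<close>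

lemma commutator:
  "vop M u a (vop M v b w) - vop M v b (vop M u a w)
    = (Sum_any (\<lambda>i. scl M (of_int (- a - 1) gchoose i) (vop M (vop (reg V) u (- 1 - int i) v) (b + a + 1 + int i) w)))"
proof -
  have coeff: "jacobi_coeff (- 1) i = (if i = 0 then 1 else 0)" for i
    by (cases i) (auto simp: jacobi_coeff_def)
  have "(Sum_any (\<lambda>i. scl M (jacobi_coeff (-1) i) (vop M u (a + 1 + - 1 + int i) (vop M v (b - int i) w))))
      = vop M u a (vop M v b w)"
    by (subst Sum_any_single[of 0]) (auto simp: coeff)
  moreover have "(Sum_any (\<lambda>i. scl M ((-1) powi (- 1 + 1) * jacobi_coeff (-1) i) (vop M v (b + 1 + - 1 + int i) (vop M u (a - int i) w))))
      = vop M v b (vop M u a w)"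
    by (subst Sum_any_single[of 0]) (auto simp: coeff)
  ultimately show ?thesis
    using borcherds[of u v w a b "- 1"] by (simp add: borcherds_identity_def)
qed

end

sublocale voa \<subseteq> reg: vaction V "reg V"
  by unfold_locales (use voa in \<open>auto simp: vertex_operator_algebra_def\<close>)

context vaction
begin

text \<open>For L(n) the upper index in the commutator formula is n + 1, so the sum stops at L(n)v;
  its first term, with L(-1)v, is a derivative. \<open>L1_vop\<close> is the same computation with n
  = 1.\<close>

lemma L0_vop:
  "vop M (conf V) (- 2) (vop M v k w) = vop M v k (vop M (conf V) (- 2) w)
     + vop M (vop (reg V) (conf V) (- 2) v) k w + scl M (of_int k) (vop M v k w)"
proof -
  have g: "(1 gchoose i :: complex) = of_nat (1 choose i)" for i
    using binomial_gbinomial[of 1 i, where 'a = complex] by simp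
  have "(Sum_any (\<lambda>i. scl M (of_int (- (- 2) - 1) gchoose i) (vop M (vop (reg V) (conf V) (- 1 - int i) v) (k + - 2 + 1 + int i) w)))
     = (\<Sum>i<2. scl M (1 gchoose i) (vop M (vop (reg V) (conf V) (- 1 - int i) v) (k - 1 + int i) w))"
    by (subst Sum_any_eq_sum_lessThan[of 2]) (auto simp: g)
  also have "\<dots> = vop M (vop (reg V) (conf V) (- 1) v) (k - 1) w + vop M (vop (reg V) (conf V) (- 2) v) k w"
    by (simp add: numeral_2_eq_2)
  finally show ?thesis
    using commutator[of "conf V" "- 2" v k w] by (simp add: vop_derivative algebra_simps)
qed

lemma L1_vop:
  "vop M (conf V) (- 3) (vop M v k w) = vop M v k (vop M (conf V) (- 3) w)
     + vop M (vop (reg V) (conf V) (- 3) v) k w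
     + scl M 2 (vop M (vop (reg V) (conf V) (- 2) v) (k - 1) w)
     + scl M (of_int (k - 1)) (vop M v (k - 1) w)"
proof -
  have g: "(2 gchoose i :: complex) = of_nat (2 choose i)" for i
    using binomial_gbinomial[of 2 i, where 'a = complex] by simp
  have "(Sum_any (\<lambda>i. scl M (of_int (- (- 3) - 1) gchoose i) (vop M (vop (reg V) (conf V) (- 1 - int i) v) (k + - 3 + 1 + int i) w)))
     = (\<Sum>i<3. scl M (2 gchoose i) (vop M (vop (reg V) (conf V) (- 1 - int i) v) (k - 2 + int i) w))"
    by (subst Sum_any_eq_sum_lessThan[of 3]) (auto simp: g)
  also have "\<dots> = vop M (vop (reg V) (conf V) (- 1) v) (k - 2) w
     + scl M 2 (vop M (vop (reg V) (conf V) (- 2) v) (k - 1) w) + vop M (vop (reg V) (conf V) (- 3) v) k w"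
    by (simp add: eval_nat_numeral g)
  finally show ?thesis
    using commutator[of "conf V" "- 3" v k w] by (simp add: vop_derivative algebra_simps)
qed

lemma weight_space_iff: "w \<in> weight_space V M UNIV n \<longleftrightarrow> vop M (conf V) (- 2) w = scl M n w"
  by (simp add: weight_space_def Lmode_def)

lemma subspace_weight_space: "vs.subspace (weight_space V M UNIV n)"
  by (auto simp: vs.subspace_def weight_space_iff vop_add vop_scale vs.scale_right_distrib vs.scale_left_commute)

end

context voa
begin

abbreviation "Vwt \<equiv> voa_weight_space V"
abbreviation "sV \<equiv> scl (reg V)"
abbreviation "YV \<equiv> vop (reg V)"
abbreviation "L1 \<equiv> vop (reg V) (conf V) (- 3)"

lemma Vwt_iff: "v \<in> Vwt n \<longleftrightarrow> YV (conf V) (- 2) v = sV (of_int n) v"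
  by (simp add: voa_weight_space_def reg.weight_space_iff)

lemma subspace_Vwt: "reg.vs.subspace (Vwt n)"
  unfolding voa_weight_space_def by (rule reg.subspace_weight_space)

sublocale grading: direct_sum sV Vwt
  by unfold_locales (use voa subspace_Vwt in \<open>auto simp: vertex_operator_algebra_def\<close>)

lemma Vwt_bounded: obtains N where "\<forall>n<N. \<forall>v\<in>Vwt n. v = 0"
proof -
  have "\<exists>N. \<forall>n<N. Vwt n = {0}"
    using voa by (simp add: vertex_operator_algebra_def)
  then show thesis
    using that by blast
qed

lemma vop_vac_neg: "k < 0 \<Longrightarrow> YV v k (vac V) = 0"
  and vop_vac_0: "YV v 0 (vac V) = v"
  using voa by (auto simp: vertex_operator_algebra_def)

lemma conf_weight: "conf V \<in> Vwt 2"
  and vac_weight: "vac V \<in> Vwt 0"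
  using voa by (auto simp: vertex_operator_algebra_def)

text \<open>The conformal vector is L(-2) applied to the vacuum. Moving L(1) past L(-2) leaves 3
  L(-1) without central term, and both L(1) and L(-1) kill the vacuum.\<close>

lemma L1_conf: "L1 (conf V) = 0"
proof -
  obtain rank where "Lmode V (reg V) m (Lmode V (reg V) n v) - Lmode V (reg V) n (Lmode V (reg V) m v)
      = sV (of_int (m - n)) (Lmode V (reg V) (m + n) v)
        + (if m + n = 0 then sV (of_int (m ^ 3 - m) / 12 * rank) v else 0)" for m n v
    using voa unfolding vertex_operator_algebra_def by blast
  from this[of 1 "- 2" "vac V"] show ?thesis
    by (simp add: Lmode_def vop_vac_neg vop_vac_0)
qed

text \<open>Writing L(-1)v as a mode of v on the vacuum makes it possible to extract the
  L(-1)-derivative property of W' from its Jacobi identity.\<close>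

lemma derivative_eq: "YV (conf V) (- 1) v = YV v 1 (vac V)"
  using reg.vop_derivative[of v 0 "vac V"] vop_vac_0 by simp

lemma voa_induct [case_names add homogeneous]:
  assumes "\<And>u v. P u \<Longrightarrow> P v \<Longrightarrow> P (u + v)" "\<And>h v. v \<in> Vwt h \<Longrightarrow> P v"
  shows "P v"
  by (rule grading.direct_sum_induct)
    (use assms in \<open>auto intro: assms(2)[OF reg.vs.subspace_0[OF subspace_Vwt]]\<close>)

end

context vaction
begin

lemma vop_weight:
  assumes "v \<in> Vwt h" "w \<in> weight_space V M UNIV n"
  shows "vop M v k w \<in> weight_space V M UNIV (n + of_int (h + k))"
  using assms L0_vop[of v k w]
  by (simp add: Vwt_iff weight_space_iff vop_scale vop_scale_left algebra_simps)

end

context voa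
begin

lemma vop_Vwt: "u \<in> Vwt h \<Longrightarrow> v \<in> Vwt g \<Longrightarrow> YV u k v \<in> Vwt (h + g + k)"
  using reg.vop_weight[of u h v "of_int g" k] by (simp add: voa_weight_space_def algebra_simps)

lemma L1_Vwt: "v \<in> Vwt h \<Longrightarrow> L1 v \<in> Vwt (h - 1)"
  using vop_Vwt[OF conf_weight, of v h "- 3"] by (simp add: algebra_simps)

lemma L1_pow_Vwt: "v \<in> Vwt h \<Longrightarrow> (L1 ^^ i) v \<in> Vwt (h - int i)"
proof (induction i)
  case (Suc i)
  then show ?case
    using L1_Vwt[of "(L1 ^^ i) v" "h - int i"] by (simp add: algebra_simps)
qed simp

lemma L1_pow_linear: "linear_on sV UNIV sV (L1 ^^ i)"
  by (induction i) (auto simp: linear_on_def reg.vop_add reg.vop_scale)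

lemma L1_pow_add: "(L1 ^^ i) (x + y) = (L1 ^^ i) x + (L1 ^^ i) y"
  and L1_pow_scale: "(L1 ^^ i) (sV c x) = sV c ((L1 ^^ i) x)"
  using L1_pow_linear[of i] by (auto simp: linear_on_def)

lemma L1_pow_0 [simp]: "(L1 ^^ i) 0 = 0"
  using L1_pow_add[of i 0 0] by simp

lemma L1_pow_eventually_0:
  assumes "v \<in> Vwt h"
  obtains K where "\<forall>i\<ge>K. (L1 ^^ i) v = 0"
proof -
  obtain N where N: "\<forall>n<N. \<forall>v\<in>Vwt n. v = 0"
    by (rule Vwt_bounded)
  have "(L1 ^^ i) v = 0" if "nat (h - N + 1) \<le> i" for i
  proof -
    have "h - int i < N"
      using that by linarith
    then show ?thesis
      using N L1_pow_Vwt[OF assms, of i] by blast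
  qed
  then show thesis
    using that by blast
qed

end

section \<open>The opposite vertex operators\<close>

text \<open>Negating the upper index of the second binomial makes it independent of \<open>i\<close>
  and cancels the alternating sign; what remains is the ordinary Vandermonde convolution.\<close>

lemma gbinomial_alternating_Vandermonde:
  fixes A m :: "'a::field_char_0"
  shows "(\<Sum>i\<le>n. (-1) ^ i * (m gchoose i) * (A - of_nat i gchoose (n - i))) = (A - m gchoose n)"
proof -
  have "(-1) ^ i * (m gchoose i) * (A - of_nat i gchoose (n - i))
      = (-1) ^ n * ((m gchoose i) * (of_nat n - A - 1 gchoose (n - i)))" if "i \<le> n" for i
  proof -
    have "(A - of_nat i gchoose (n - i)) = (-1) ^ (n - i) * (of_nat (n - i) - (A - of_nat i) - 1 gchoose (n - i))"
      by (rule gbinomial_negated_upper)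
    moreover have "of_nat (n - i) - (A - of_nat i) - 1 = of_nat n - A - (1 :: 'a)"
      using that by (simp add: of_nat_diff)
    moreover have "(-1) ^ n = (-1) ^ i * ((-1) ^ (n - i) :: 'a)"
      using that by (simp add: power_add[symmetric])
    ultimately show ?thesis by simp
  qed
  then have "(\<Sum>i\<le>n. (-1) ^ i * (m gchoose i) * (A - of_nat i gchoose (n - i)))
      = (-1) ^ n * (\<Sum>i\<le>n. (m gchoose i) * (of_nat n - A - 1 gchoose (n - i)))"
    unfolding sum_distrib_left by (intro sum.cong refl) simp
  also have "\<dots> = (-1) ^ n * (of_nat n - (A - m) - 1 gchoose n)"
    unfolding atMost_atLeast0 gbinomial_Vandermonde by (simp add: algebra_simps)
  also have "\<dots> = (A - m gchoose n)"
    by (rule gbinomial_negated_upper[symmetric])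
  finally show ?thesis .
qed

section \<open>Commuting powers of L(1) past a mode\<close>

definition triples :: "nat \<Rightarrow> (nat \<times> nat \<times> nat) set" where
  "triples p = {(s, t, r). s + t + r = p}"

lemma finite_triples [simp]: "finite (triples p)"
  by (rule finite_subset[of _ "{..p} \<times> {..p} \<times> {..p}"]) (auto simp: triples_def)

lemma sum_triples_shift:
  fixes f :: "nat \<Rightarrow> nat \<Rightarrow> nat \<Rightarrow> 'a::comm_monoid_add"
  shows "(\<Sum>(s, t, r)\<in>triples p. f (Suc s) t r) = (\<Sum>(s, t, r)\<in>triples (Suc p). if s = 0 then 0 else f s t r)"
    and "(\<Sum>(s, t, r)\<in>triples p. f s (Suc t) r) = (\<Sum>(s, t, r)\<in>triples (Suc p). if t = 0 then 0 else f s t r)"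
    and "(\<Sum>(s, t, r)\<in>triples p. f s t (Suc r)) = (\<Sum>(s, t, r)\<in>triples (Suc p). if r = 0 then 0 else f s t r)"
proof -
  have fin: "finite {x \<in> triples (Suc p). P x}" for P
    by simp
  show "(\<Sum>(s, t, r)\<in>triples p. f (Suc s) t r) = (\<Sum>(s, t, r)\<in>triples (Suc p). if s = 0 then 0 else f s t r)"
    by (rule sum.reindex_bij_witness_not_neutral[where S' = "{}" and T' = "{x \<in> triples (Suc p). fst x = 0}"
          and i = "\<lambda>(s, t, r). (s - 1, t, r)" and j = "\<lambda>(s, t, r). (Suc s, t, r)"])
      (use fin in \<open>auto simp: triples_def\<close>)
  show "(\<Sum>(s, t, r)\<in>triples p. f s (Suc t) r) = (\<Sum>(s, t, r)\<in>triples (Suc p). if t = 0 then 0 else f s t r)"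
    by (rule sum.reindex_bij_witness_not_neutral[where S' = "{}" and T' = "{x \<in> triples (Suc p). fst (snd x) = 0}"
          and i = "\<lambda>(s, t, r). (s, t - 1, r)" and j = "\<lambda>(s, t, r). (s, Suc t, r)"])
      (use fin in \<open>auto simp: triples_def\<close>)
  show "(\<Sum>(s, t, r)\<in>triples p. f s t (Suc r)) = (\<Sum>(s, t, r)\<in>triples (Suc p). if r = 0 then 0 else f s t r)"
    by (rule sum.reindex_bij_witness_not_neutral[where S' = "{}" and T' = "{x \<in> triples (Suc p). snd (snd x) = 0}"
          and i = "\<lambda>(s, t, r). (s, t, r - 1)" and j = "\<lambda>(s, t, r). (s, t, Suc r)"])
      (use fin in \<open>auto simp: triples_def\<close>)
qed

context voa
begin

text \<open>In the conjugation formula the term L(1)^s u in the mode k - t carries the power s - 2h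
  - (k - t) of 1 - x x_0. Its coefficient at (x x_0)^t, after negation of the upper index, is the
  binomial here; the factorials come from the two exponentials.\<close>

definition L1_coeff :: "int \<Rightarrow> int \<Rightarrow> nat \<Rightarrow> nat \<Rightarrow> nat \<Rightarrow> complex" where
  "L1_coeff h k s t r = (of_int (2 * h + k - int s - 1) gchoose t) / (fact s * fact r)"

text \<open>The three terms on the left come from one more L(1) acting on u, on the mode and on v.
  Lowering \<open>s\<close> raises the upper index by one, which calls for Pascal's rule; the term
  for the mode is then handled by absorption, N binom(N,t) = t binom(N,t) + (t+1)
  binom(N,t+1).\<close>

lemma L1_coeff_rec:
  "(if s = 0 then 0 else L1_coeff h k (s - 1) t r)
   + (if t = 0 then 0 else of_int (2 * (h - int s) + k - int (t - 1) - 1) * L1_coeff h k s (t - 1) r)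
   + (if r = 0 then 0 else L1_coeff h k s t (r - 1))
   = of_nat (s + t + r) * L1_coeff h k s t r"
proof -
  define N :: complex where "N = of_int (2 * h + k - int s - 1)"
  have 1: "(if s = 0 then 0 else L1_coeff h k (s - 1) t r) = of_nat s * (N + 1 gchoose t) / (fact s * fact r)"
  proof (cases s)
    case (Suc m)
    have "N + 1 = of_int (2 * h + k - int m - 1)"
      by (simp add: N_def Suc)
    then have c: "L1_coeff h k m t r = (N + 1 gchoose t) / (fact m * fact r)"
      by (simp only: L1_coeff_def)
    show ?thesis
      unfolding Suc fact_Suc by (simp add: c del: of_nat_Suc)
  qed simp
  have 2: "(if t = 0 then 0 else of_int (2 * (h - int s) + k - int (t - 1) - 1) * L1_coeff h k s (t - 1) r)
      = (if t = 0 then 0 else (N + 1 - of_nat s - of_nat t) * (N gchoose (t - 1))) / (fact s * fact r)"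
    by (cases t) (auto simp: L1_coeff_def N_def field_simps)
  have 3: "(if r = 0 then 0 else L1_coeff h k s t (r - 1)) = of_nat r * (N gchoose t) / (fact s * fact r)"
  proof (cases r)
    case (Suc m)
    then show ?thesis
      unfolding Suc fact_Suc by (simp add: L1_coeff_def N_def del: of_nat_Suc)
  qed simp
  have 4: "of_nat (s + t + r) * L1_coeff h k s t r = of_nat (s + t + r) * (N gchoose t) / (fact s * fact r)"
    by (simp add: L1_coeff_def N_def)
  have "of_nat s * (N + 1 gchoose t) + (if t = 0 then 0 else (N + 1 - of_nat s - of_nat t) * (N gchoose (t - 1)))
      + of_nat r * (N gchoose t) = of_nat (s + t + r) * (N gchoose t)"
  proof (cases t)
    case (Suc t')
    have "N * (N gchoose t') = of_nat t' * (N gchoose t') + of_nat (Suc t') * (N gchoose Suc t')"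
      by (rule gbinomial_mult_1)
    moreover have "(N + 1 gchoose Suc t') = (N gchoose t') + (N gchoose Suc t')"
      by (rule gbinomial_Suc_Suc)
    ultimately show ?thesis
      unfolding Suc by (simp add: algebra_simps)
  qed (simp add: algebra_simps)
  then show ?thesis
    unfolding 1 2 3 4 add_divide_distrib[symmetric] by simp
qed

text \<open>Commuting L(1) past a mode produces an L(0) term and a derivative term in the same lower
  mode. On a vector of weight h - s they merge into one scalar.\<close>

lemma L1_vop_pow:
  assumes "u \<in> Vwt h"
  shows "L1 (YV ((L1 ^^ s) u) (k - int t) ((L1 ^^ r) v)) = YV ((L1 ^^ Suc s) u) (k - int t) ((L1 ^^ r) v)
    + sV (of_int (2 * (h - int s) + k - int t - 1)) (YV ((L1 ^^ s) u) (k - int (Suc t)) ((L1 ^^ r) v))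
    + YV ((L1 ^^ s) u) (k - int t) ((L1 ^^ Suc r) v)"
proof -
  have L0: "YV (conf V) (- 2) ((L1 ^^ s) u) = sV (of_int (h - int s)) ((L1 ^^ s) u)"
    using L1_pow_Vwt[OF assms, of s] by (simp only: Vwt_iff)
  have k: "k - int t - 1 = k - int (Suc t)"
    by simp
  have dist: "sV (2 * of_int (h - int s)) x + sV (of_int (k - int (Suc t))) x
      = sV (of_int (2 * (h - int s) + k - int t - 1)) x" for x
    unfolding reg.vs.scale_left_distrib[symmetric] by (rule arg_cong[where f = "\<lambda>c. sV c x"]) simp
  have "L1 (YV ((L1 ^^ s) u) (k - int t) ((L1 ^^ r) v))
      = YV ((L1 ^^ s) u) (k - int t) (L1 ((L1 ^^ r) v)) + YV (L1 ((L1 ^^ s) u)) (k - int t) ((L1 ^^ r) v)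
      + (sV (2 * of_int (h - int s)) (YV ((L1 ^^ s) u) (k - int (Suc t)) ((L1 ^^ r) v))
         + sV (of_int (k - int (Suc t))) (YV ((L1 ^^ s) u) (k - int (Suc t)) ((L1 ^^ r) v)))"
    by (simp only: reg.L1_vop[of "(L1 ^^ s) u" "k - int t" "(L1 ^^ r) v"] L0 k reg.vop_scale_left
        reg.vs.scale_scale add.assoc)
  then show ?thesis
    unfolding dist by (simp only: funpow.simps o_apply add_ac)
qed

text \<open>The coefficient form of
  \<open>e\<^bsup>xL(1)\<^esup> Y(u,x\<^sub>0) = Y(e\<^bsup>x(1-xx\<^sub>0)L(1)\<^esup> (1-xx\<^sub>0)\<^bsup>-2L(0)\<^esup> u, x\<^sub>0/(1-xx\<^sub>0)) e\<^bsup>xL(1)\<^esup>\<close>.\<close>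

lemma L1_pow_vop:
  assumes "u \<in> Vwt h"
  shows "(L1 ^^ p) (YV u k v) = sV (fact p)
    (\<Sum>(s, t, r)\<in>triples p. sV (L1_coeff h k s t r) (YV ((L1 ^^ s) u) (k - int t) ((L1 ^^ r) v)))"
proof (induction p)
  case 0
  have "triples 0 = {(0, 0, 0)}"
    by (auto simp: triples_def)
  then show ?case
    by (simp add: L1_coeff_def)
next
  case (Suc p)
  let ?Z = "\<lambda>s t r. YV ((L1 ^^ s) u) (k - int t) ((L1 ^^ r) v)"
  let ?c = "L1_coeff h k"
  let ?m = "\<lambda>s t. of_int (2 * (h - int s) + k - int t - 1) :: complex"
  have "L1 (\<Sum>(s, t, r)\<in>triples p. sV (?c s t r) (?Z s t r))
      = (\<Sum>(s, t, r)\<in>triples p. sV (?c s t r) (?Z (Suc s) t r))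
      + (\<Sum>(s, t, r)\<in>triples p. sV (?m s t * ?c s t r) (?Z s (Suc t) r))
      + (\<Sum>(s, t, r)\<in>triples p. sV (?c s t r) (?Z s t (Suc r)))"
    unfolding reg.vop_sum sum.distrib[symmetric] split_def
    by (intro sum.cong refl)
      (simp only: reg.vop_scale L1_vop_pow[OF assms] reg.vs.scale_right_distrib reg.vs.scale_scale mult.commute)
  also have "(\<Sum>(s, t, r)\<in>triples p. sV (?c s t r) (?Z (Suc s) t r))
      = (\<Sum>(s, t, r)\<in>triples (Suc p). if s = 0 then 0 else sV (?c (s - 1) t r) (?Z s t r))"
    using sum_triples_shift(1)[of "\<lambda>s t r. sV (?c (s - 1) t r) (?Z s t r)" p] by simp
  also have "(\<Sum>(s, t, r)\<in>triples p. sV (?m s t * ?c s t r) (?Z s (Suc t) r))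
      = (\<Sum>(s, t, r)\<in>triples (Suc p). if t = 0 then 0 else sV (?m s (t - 1) * ?c s (t - 1) r) (?Z s t r))"
    using sum_triples_shift(2)[of "\<lambda>s t r. sV (?m s (t - 1) * ?c s (t - 1) r) (?Z s t r)" p] by simp
  also have "(\<Sum>(s, t, r)\<in>triples p. sV (?c s t r) (?Z s t (Suc r)))
      = (\<Sum>(s, t, r)\<in>triples (Suc p). if r = 0 then 0 else sV (?c s t (r - 1)) (?Z s t r))"
    using sum_triples_shift(3)[of "\<lambda>s t r. sV (?c s t (r - 1)) (?Z s t r)" p] by simp
  also have "(\<Sum>(s, t, r)\<in>triples (Suc p). if s = 0 then 0 else sV (?c (s - 1) t r) (?Z s t r))
      + (\<Sum>(s, t, r)\<in>triples (Suc p). if t = 0 then 0 else sV (?m s (t - 1) * ?c s (t - 1) r) (?Z s t r))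
      + (\<Sum>(s, t, r)\<in>triples (Suc p). if r = 0 then 0 else sV (?c s t (r - 1)) (?Z s t r))
      = (\<Sum>(s, t, r)\<in>triples (Suc p). sV (of_nat (Suc p) * ?c s t r) (?Z s t r))"
    unfolding sum.distrib[symmetric]
  proof (rule sum.cong, rule refl, clarify)
    fix s t r assume "(s, t, r) \<in> triples (Suc p)"
    then have p: "Suc p = s + t + r"
      by (simp add: triples_def)
    have "(if s = 0 then 0 else sV (?c (s - 1) t r) (?Z s t r))
        + (if t = 0 then 0 else sV (?m s (t - 1) * ?c s (t - 1) r) (?Z s t r))
        + (if r = 0 then 0 else sV (?c s t (r - 1)) (?Z s t r))
      = sV ((if s = 0 then 0 else ?c (s - 1) t r)
        + (if t = 0 then 0 else ?m s (t - 1) * ?c s (t - 1) r)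
        + (if r = 0 then 0 else ?c s t (r - 1))) (?Z s t r)"
      by (simp add: reg.vs.scale_left_distrib)
    also have "\<dots> = sV (of_nat (Suc p) * ?c s t r) (?Z s t r)"
      unfolding L1_coeff_rec p ..
    finally show "(if s = 0 then 0 else sV (?c (s - 1) t r) (?Z s t r))
        + (if t = 0 then 0 else sV (?m s (t - 1) * ?c s (t - 1) r) (?Z s t r))
        + (if r = 0 then 0 else sV (?c s t (r - 1)) (?Z s t r))
      = sV (of_nat (Suc p) * ?c s t r) (?Z s t r)" .
  qed
  also have "\<dots> = sV (of_nat (Suc p)) (\<Sum>(s, t, r)\<in>triples (Suc p). sV (?c s t r) (?Z s t r))"
    unfolding reg.vs.scale_sum_right by (rule sum.cong) auto
  finally have "L1 (\<Sum>(s, t, r)\<in>triples p. sV (?c s t r) (?Z s t r))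
      = sV (of_nat (Suc p)) (\<Sum>(s, t, r)\<in>triples (Suc p). sV (?c s t r) (?Z s t r))" .
  then show ?case
    by (simp add: Suc.IH reg.vop_scale mult.commute)
qed

section \<open>The coefficients of e^{xL(1)} (-x^{-2})^{L(0)} v\<close>

lemma Lmode_1: "Lmode V (reg V) 1 = L1"
  by (simp add: Lmode_def)

lemma theta_homogeneous:
  assumes "v \<in> Vwt h"
  shows "theta V v j = (if 0 \<le> j + 2 * h
    then sV ((-1) powi h / fact (nat (j + 2 * h))) ((L1 ^^ nat (j + 2 * h)) v) else 0)"
proof -
  let ?g = "\<lambda>(i::nat, m::int). if int i - 2 * m = j
      then sV ((-1) powi m / fact i) ((L1 ^^ i) (component Vwt m v)) else 0"
  have "theta V v j = Sum_any ?g"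
    by (simp only: theta_def Lmode_1)
  also have "\<dots> = ?g (nat (j + 2 * h), h)"
    by (rule Sum_any_single) (auto simp: grading.comp_summand[OF assms] split: if_splits)
  finally show ?thesis
    by (auto simp: grading.comp_summand[OF assms])
qed

lemma finite_theta_summands:
  "finite {p. (case p of (i::nat, m::int) \<Rightarrow> if int i - 2 * m = j
      then sV ((-1) powi m / fact i) ((Lmode V (reg V) 1 ^^ i) (component Vwt m v)) else 0) \<noteq> 0}"
proof (rule finite_subset)
  \<comment> \<open>The exponent \<open>j\<close> and the weight \<open>m\<close> determine
    \<open>i\<close>, and \<open>v\<close> has finitely many components.\<close>
  show "finite ((\<lambda>m. (nat (j + 2 * m), m)) ` {m. component Vwt m v \<noteq> 0})"
    by (intro finite_imageI grading.comp_finite)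
  have "component Wt m v \<noteq> 0" if "(L1 ^^ i) (component Wt m v) \<noteq> 0" for Wt :: "int \<Rightarrow> 'v set" and i m
    using that by auto
  then show "{p. (case p of (i::nat, m::int) \<Rightarrow> if int i - 2 * m = j
      then sV ((-1) powi m / fact i) ((Lmode V (reg V) 1 ^^ i) (component Vwt m v)) else 0) \<noteq> 0}
    \<subseteq> (\<lambda>m. (nat (j + 2 * m), m)) ` {m. component Vwt m v \<noteq> 0}"
    by (auto simp: Lmode_1 image_iff split: if_splits)
qed

lemma theta_add: "theta V (u + v) j = theta V u j + theta V v j"
  unfolding theta_def Sum_any.distrib[OF finite_theta_summands finite_theta_summands, symmetric]
  by (rule Sum_any.cong)
    (auto simp: grading.comp_add Lmode_1 L1_pow_add reg.vs.scale_right_distrib)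

lemma theta_scale: "theta V (sV c v) j = sV c (theta V v j)"
  unfolding theta_def reg.vs.scale_Sum_any_right[OF finite_theta_summands]
  by (rule Sum_any.cong)
    (auto simp: grading.comp_scale Lmode_1 L1_pow_scale reg.vs.scale_left_commute)

lemma theta_finite: "finite {j. theta V v j \<noteq> 0}"
proof (induction v rule: voa_induct)
  case (add u v)
  have "{j. theta V (u + v) j \<noteq> 0} \<subseteq> {j. theta V u j \<noteq> 0} \<union> {j. theta V v j \<noteq> 0}"
    by (auto simp: theta_add)
  then show ?case
    using add finite_subset by blast
next
  case (homogeneous h v)
  obtain K where K: "\<forall>i\<ge>K. (L1 ^^ i) v = 0"
    using L1_pow_eventually_0[OF homogeneous] .
  have "{j. theta V v j \<noteq> 0} \<subseteq> {- 2 * h..<int K - 2 * h}"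
  proof
    fix j assume "j \<in> {j. theta V v j \<noteq> 0}"
    then have "0 \<le> j + 2 * h" "(L1 ^^ nat (j + 2 * h)) v \<noteq> 0"
      by (auto simp: theta_homogeneous[OF homogeneous] split: if_splits)
    then show "j \<in> {- 2 * h..<int K - 2 * h}"
      using K[rule_format, of "nat (j + 2 * h)"] by fastforce
  qed
  then show ?case
    using finite_subset by blast
qed

end

lemma (in vector_space) sum_scale_swap:
  "(\<Sum>i\<in>I. scale (d i) (\<Sum>r\<in>R. \<Sum>s\<in>S. scale (\<kappa> s r) (X i r s)))
    = (\<Sum>r\<in>R. \<Sum>s\<in>S. scale (\<kappa> s r) (\<Sum>i\<in>I. scale (d i) (X i r s)))"
proof -
  have "(\<Sum>i\<in>I. scale (d i) (\<Sum>r\<in>R. \<Sum>s\<in>S. scale (\<kappa> s r) (X i r s)))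
      = (\<Sum>i\<in>I. \<Sum>r\<in>R. \<Sum>s\<in>S. scale (\<kappa> s r) (scale (d i) (X i r s)))"
    by (simp only: scale_sum_right scale_left_commute)
  also have "\<dots> = (\<Sum>r\<in>R. \<Sum>i\<in>I. \<Sum>s\<in>S. scale (\<kappa> s r) (scale (d i) (X i r s)))"
    by (rule sum.swap)
  also have "\<dots> = (\<Sum>r\<in>R. \<Sum>s\<in>S. \<Sum>i\<in>I. scale (\<kappa> s r) (scale (d i) (X i r s)))"
    by (intro sum.cong refl sum.swap)
  finally show ?thesis
    by (simp only: scale_sum_right)
qed

lemma sum_triples_eq_box:
  fixes f :: "nat \<Rightarrow> nat \<Rightarrow> nat \<Rightarrow> 'a::comm_monoid_add"
  assumes "\<And>s t r. P \<le> s + t + r \<Longrightarrow> f s t r = 0"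
  shows "(\<Sum>p<P. \<Sum>(s, t, r)\<in>triples p. f s t r) = (\<Sum>s<P. \<Sum>t<P. \<Sum>r<P. f s t r)"
proof -
  have "(\<Sum>p<P. \<Sum>(s, t, r)\<in>triples p. f s t r) = (\<Sum>(s, t, r)\<in>(\<Union>p<P. triples p). f s t r)"
    by (rule sum.UNION_disjoint[symmetric]) (simp_all, auto simp: triples_def)
  also have "\<dots> = (\<Sum>(s, t, r)\<in>{..<P} \<times> {..<P} \<times> {..<P}. f s t r)"
    by (rule sum.mono_neutral_left) (use assms in \<open>force simp: triples_def\<close>)+
  also have "\<dots> = (\<Sum>s<P. \<Sum>t<P. \<Sum>r<P. f s t r)"
    by (simp only: sum.cartesian_product split_def)
  finally show ?thesis .
qed

lemma sum_square_eq_triangle: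
  fixes f :: "nat \<Rightarrow> nat \<Rightarrow> 'a::comm_monoid_add"
  assumes "\<And>i t. P \<le> i + t \<Longrightarrow> f i t = 0"
  shows "(\<Sum>i<P. \<Sum>t<P. f i t) = (\<Sum>n<P. \<Sum>i\<le>n. f i (n - i))"
proof -
  have "(\<Sum>i<P. \<Sum>t<P. f i t) = (\<Sum>(i, t)\<in>{..<P} \<times> {..<P}. f i t)"
    by (rule sum.cartesian_product)
  also have "\<dots> = (\<Sum>(i, t)\<in>{(i, t). i + t < P}. f i t)"
    by (rule sum.mono_neutral_right) (use assms in force)+
  also have "\<dots> = (\<Sum>n<P. \<Sum>i\<le>n. f i (n - i))"
    by (rule sum.triangle_reindex)
  finally show ?thesis .
qed

section \<open>The opposite operators and their Jacobi identity\<close>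

context vaction
begin

abbreviation star :: "'v \<Rightarrow> int \<Rightarrow> 'w \<Rightarrow> 'w" where
  "star \<equiv> vop_star V M"

lemma finite_star_summands: "finite {j. vop M (theta V v j) (j - k) w \<noteq> 0}"
  by (rule finite_subset[OF _ theta_finite[of v]]) auto

lemma star_add_left: "star (u + v) k w = star u k w + star v k w"
  unfolding vop_star_def theta_add vop_add_left by (intro Sum_any.distrib finite_star_summands)

lemma star_scale_left: "star (sV t v) k w = scl M t (star v k w)"
  unfolding vop_star_def theta_scale vop_scale_left
  by (rule vs.scale_Sum_any_right[OF finite_star_summands, symmetric])

lemma star_add: "star v k (x + y) = star v k x + star v k y"
  unfolding vop_star_def vop_add by (intro Sum_any.distrib finite_star_summands)

lemma star_scale: "star v k (scl M t x) = scl M t (star v k x)"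
  unfolding vop_star_def vop_scale
  by (rule vs.scale_Sum_any_right[OF finite_star_summands, symmetric])

lemma star_0 [simp]: "star v k 0 = 0"
  using star_add[of v k 0 0] by simp

lemma star_0_left [simp]: "star 0 k w = 0"
  using star_add_left[of 0 0 k w] by simp

text \<open>The bound \<open>P\<close> is a parameter so that one bound can serve several vectors at
  once.\<close>

lemma star_homogeneous:
  assumes v: "v \<in> Vwt h" and P: "\<forall>i\<ge>P. (L1 ^^ i) v = 0"
  shows "star v k w = (\<Sum>i<P. scl M ((-1) powi h / fact i) (vop M ((L1 ^^ i) v) (int i - 2 * h - k) w))"
proof -
  have "star v k w = (Sum_any (\<lambda>i. vop M (theta V v (int i - 2 * h)) (int i - 2 * h - k) w))"
    unfolding vop_star_def
  proof (rule Sum_any_reindex_inj)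
    show "inj (\<lambda>i. int i - 2 * h)"
      by (simp add: inj_def)
    show "vop M (theta V v j) (j - k) w = 0" if "j \<notin> range (\<lambda>i. int i - 2 * h)" for j
    proof -
      have "\<not> 0 \<le> j + 2 * h"
      proof
        assume "0 \<le> j + 2 * h"
        then have "j = int (nat (j + 2 * h)) - 2 * h"
          by simp
        with that show False by blast
      qed
      then show ?thesis
        by (simp add: theta_homogeneous[OF v])
    qed
  qed
  also have "\<dots> = (\<Sum>i<P. vop M (theta V v (int i - 2 * h)) (int i - 2 * h - k) w)"
    by (rule Sum_any_eq_sum_lessThan) (simp add: theta_homogeneous[OF v] P)
  finally show ?thesis
    by (simp add: theta_homogeneous[OF v] vop_scale_left)
qed

lemma star_weight:
  assumes "v \<in> Vwt h" "w \<in> weight_space V M UNIV n"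
  shows "star v k w \<in> weight_space V M UNIV (n - of_int (h + k))"
proof -
  obtain P where P: "\<forall>i\<ge>P. (L1 ^^ i) v = 0"
    using L1_pow_eventually_0[OF assms(1)] .
  have "vop M ((L1 ^^ i) v) (int i - 2 * h - k) w \<in> weight_space V M UNIV (n - of_int (h + k))" for i
    using vop_weight[OF L1_pow_Vwt[OF assms(1), of i] assms(2), of "int i - 2 * h - k"]
    by (simp add: algebra_simps)
  then show ?thesis
    using P by (subst star_homogeneous[OF assms(1)])
      (auto intro!: vs.subspace_sum vs.subspace_scale subspace_weight_space)
qed

lemma vop_trunc_finite:
  assumes "finite I"
  shows "\<exists>Q. \<forall>i\<ge>Q. \<forall>x\<in>I. vop M (f x) (A x - int i) w = 0"
  using assms
proof (induction I rule: finite_induct)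
  case (insert x I)
  then obtain Q where Q: "\<forall>i\<ge>Q. \<forall>y\<in>I. vop M (f y) (A y - int i) w = 0"
    by blast
  obtain N where N: "\<forall>k<N. vop M (f x) k w = 0"
    by (rule vop_trunc)
  have "\<forall>i\<ge>max Q (nat (A x - N + 1)). \<forall>y\<in>insert x I. vop M (f y) (A y - int i) w = 0"
    using Q N by auto
  then show ?case by blast
qed simp

text \<open>Inverting x turns lower truncation into vanishing for large exponents; the finitely many
  nonzero coefficients of \<open>theta\<close> share a bound.\<close>

lemma star_trunc: "\<exists>K. \<forall>i\<ge>K. star u (a + int i) w = 0"
proof -
  obtain Q where Q: "\<forall>i\<ge>Q. \<forall>j\<in>{j. theta V u j \<noteq> 0}. vop M (theta V u j) (j - a - int i) w = 0"
    using vop_trunc_finite[OF theta_finite[of u], of "theta V u" "\<lambda>j. j - a" w] by blast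
  have "star u (a + int i) w = 0" if "i \<ge> Q" for i
  proof -
    have "vop M (theta V u j) (j - (a + int i)) w = 0" for j
    proof (cases "theta V u j = 0")
      case False
      then have "vop M (theta V u j) (j - a - int i) w = 0"
        using Q that by blast
      then show ?thesis
        by (simp add: algebra_simps)
    qed simp
    then show ?thesis
      by (simp add: vop_star_def)
  qed
  then show ?thesis by blast
qed

text \<open>The star products are expanded into powers of L(1) on u and on v, and for each pair of
  powers the ordinary identity is used with its two products exchanged. The iterate is expanded from
  the other side by \<open>L1_pow_vop\<close>, and the two expansions agree coefficient by
  coefficient.\<close>

lemma star_jacobi_homogeneous:
  assumes u: "u \<in> Vwt h" and v: "v \<in> Vwt g"
  shows "(Sum_any (\<lambda>i. scl M (jacobi_coeff c i) (star v (b - int i) (star u (a + 1 + c + int i) w))))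
    - (Sum_any (\<lambda>i. scl M ((-1) powi (c + 1) * jacobi_coeff c i) (star u (a - int i) (star v (b + 1 + c + int i) w))))
    = (Sum_any (\<lambda>i. scl M (of_int (- a - 1) gchoose i) (star (YV u (c - int i) v) (b + a + 1 + int i) w)))"
    (is "?F1 - ?F2 = ?F3")
proof -
  define U where "U s = (L1 ^^ s) u" for s
  define X where "X r = (L1 ^^ r) v" for r
  \<comment> \<open>\<open>A s\<close> and \<open>B r\<close> are the exponents at which the
    ordinary identity for \<open>U s\<close> and \<open>X r\<close> produces exactly the modes that
    occur in the star products.\<close>
  define A where "A s = int s - 2 * h - a - 1 - c" for s
  define B where "B r = int r - 2 * g - b - 1 - c" for r
  define \<kappa> :: "nat \<Rightarrow> nat \<Rightarrow> complex" where "\<kappa> s r = ((-1) powi h / fact s) * ((-1) powi g / fact r)" for s r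
  \<comment> \<open>This sign belongs to the second product of the Jacobi identity. As
    \<open>e * e = 1\<close>, multiplying by \<open>- e\<close> hands it over to the other product,
    as the exchange requires.\<close>
  define e :: complex where "e = (-1) powi (c + 1)"
  have ee: "e * e = 1"
    by (simp add: e_def power_int_add[symmetric] flip: power_int_mult_distrib)
  obtain N where N: "\<forall>n<N. \<forall>x\<in>Vwt n. x = 0"
    by (rule Vwt_bounded)
  \<comment> \<open>\<open>h + g + c\<close> is the weight of \<open>YV u c v\<close>, and every
    power of L(1) and every lowering of the mode costs one unit. After \<open>P\<close> units each
    of the three weights is below \<open>N\<close>, where V vanishes.\<close>
  define P where "P = nat (max h (max g (h + g + c)) - N + 1)"
  have vanish: "x = 0" if "x \<in> Vwt (m - int n)" "m \<in> {h, g, h + g + c}" "P \<le> n" for x m n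
  proof -
    have "m - int n < N"
      using that(2,3) by (auto simp: P_def)
    then show ?thesis
      using N that(1) by blast
  qed
  have U0: "\<forall>s\<ge>P. (L1 ^^ s) u = 0"
    using vanish[OF L1_pow_Vwt[OF u]] by simp
  have X0: "\<forall>r\<ge>P. (L1 ^^ r) v = 0"
    using vanish[OF L1_pow_Vwt[OF v]] by simp
  have UX0: "YV (U s) (c - int n) (X r) = 0" if "P \<le> s + n + r" for s n r
  proof -
    have "YV (U s) (c - int n) (X r) \<in> Vwt (h + g + c - int (s + n + r))"
      using vop_Vwt[OF L1_pow_Vwt[OF u, of s] L1_pow_Vwt[OF v, of r], of "c - int n"]
      unfolding U_def X_def by (simp add: algebra_simps)
    then show ?thesis
      using vanish that by blast
  qed
  obtain Q1 where Q1: "\<forall>i\<ge>Q1. \<forall>s\<in>{..<P}. vop M (U s) (A s - int i) w = 0"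
    using vop_trunc_finite[of "{..<P}" U A w] by blast
  obtain Q2 where Q2: "\<forall>i\<ge>Q2. \<forall>r\<in>{..<P}. vop M (X r) (B r - int i) w = 0"
    using vop_trunc_finite[of "{..<P}" X B w] by blast
  define Q where "Q = max Q1 Q2"
  have Q: "vop M (U s) (A s - int i) w = 0" "vop M (X s) (B s - int i) w = 0" if "Q \<le> i" "s < P" for i s
    using Q1 Q2 that by (auto simp: Q_def)
  have star_u: "star u k y = (\<Sum>s<P. scl M ((-1) powi h / fact s) (vop M (U s) (A s + a + 1 + c - k) y))" for k y
    using star_homogeneous[OF u U0, of k y] unfolding U_def A_def by (simp add: algebra_simps)
  have star_v: "star v k y = (\<Sum>r<P. scl M ((-1) powi g / fact r) (vop M (X r) (B r + b + 1 + c - k) y))" for k y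
    using star_homogeneous[OF v X0, of k y] unfolding X_def B_def by (simp add: algebra_simps)
  have vu: "star v (b - int i) (star u (a + 1 + c + int i) w)
      = (\<Sum>r<P. \<Sum>s<P. scl M (\<kappa> s r) (vop M (X r) (B r + 1 + c + int i) (vop M (U s) (A s - int i) w)))" for i
    unfolding star_u star_v
    by (simp add: vop_sum vop_scale vs.scale_sum_right \<kappa>_def algebra_simps)
  have uv: "star u (a - int i) (star v (b + 1 + c + int i) w)
      = (\<Sum>r<P. \<Sum>s<P. scl M (\<kappa> s r) (vop M (U s) (A s + 1 + c + int i) (vop M (X r) (B r - int i) w)))" for i
    unfolding star_u star_v
    by (subst sum.swap) (simp add: vop_sum vop_scale vs.scale_sum_right \<kappa>_def algebra_simps)
  have F1: "?F1 = (\<Sum>r<P. \<Sum>s<P. scl M (\<kappa> s r) (\<Sum>i<Q. scl M (jacobi_coeff c i)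
      (vop M (X r) (B r + 1 + c + int i) (vop M (U s) (A s - int i) w))))"
    unfolding vu by (subst Sum_any_eq_sum_lessThan[of Q]) (auto simp: Q vs.sum_scale_swap)
  have F2: "?F2 = (\<Sum>r<P. \<Sum>s<P. scl M (\<kappa> s r) (\<Sum>i<Q. scl M (e * jacobi_coeff c i)
      (vop M (U s) (A s + 1 + c + int i) (vop M (X r) (B r - int i) w))))"
    unfolding uv e_def[symmetric] by (subst Sum_any_eq_sum_lessThan[of Q]) (auto simp: Q vs.sum_scale_swap)
  define Y where "Y s r n = vop M (YV (U s) (c - int n) (X r)) (B r + A s + 1 + int n) w" for s r n
  have Y0: "Y s r n = 0" if "P \<le> s + n + r" for s r n
    using UX0[OF that] by (simp add: Y_def)
  have sr: "(\<Sum>i<Q. scl M (jacobi_coeff c i) (vop M (X r) (B r + 1 + c + int i) (vop M (U s) (A s - int i) w)))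
      - (\<Sum>i<Q. scl M (e * jacobi_coeff c i) (vop M (U s) (A s + 1 + c + int i) (vop M (X r) (B r - int i) w)))
      = scl M (- e) (\<Sum>n<P. scl M (of_int (- A s - 1) gchoose n) (Y s r n))"
    if "r < P" "s < P" for r s
  proof -
    have "(Sum_any (\<lambda>i. scl M (jacobi_coeff c i) (vop M (U s) (A s + 1 + c + int i) (vop M (X r) (B r - int i) w))))
        = (\<Sum>i<Q. scl M (jacobi_coeff c i) (vop M (U s) (A s + 1 + c + int i) (vop M (X r) (B r - int i) w)))"
      using that by (intro Sum_any_eq_sum_lessThan) (simp add: Q)
    moreover have "(Sum_any (\<lambda>i. scl M ((-1) powi (c + 1) * jacobi_coeff c i) (vop M (X r) (B r + 1 + c + int i) (vop M (U s) (A s - int i) w))))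
        = (\<Sum>i<Q. scl M (e * jacobi_coeff c i) (vop M (X r) (B r + 1 + c + int i) (vop M (U s) (A s - int i) w)))"
      unfolding e_def using that by (intro Sum_any_eq_sum_lessThan) (simp add: Q)
    moreover have "(Sum_any (\<lambda>n. scl M (of_int (- A s - 1) gchoose n) (vop M (YV (U s) (c - int n) (X r)) (B r + A s + 1 + int n) w)))
        = (\<Sum>n<P. scl M (of_int (- A s - 1) gchoose n) (Y s r n))"
      unfolding Y_def[symmetric] by (intro Sum_any_eq_sum_lessThan) (simp add: Y0)
    ultimately have "scl M (- e) (\<Sum>n<P. scl M (of_int (- A s - 1) gchoose n) (Y s r n))
        = scl M (- e) ((\<Sum>i<Q. scl M (jacobi_coeff c i) (vop M (U s) (A s + 1 + c + int i) (vop M (X r) (B r - int i) w)))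
           - (\<Sum>i<Q. scl M (e * jacobi_coeff c i) (vop M (X r) (B r + 1 + c + int i) (vop M (U s) (A s - int i) w))))"
      using borcherds[of "U s" "X r" w "A s" "B r" c] by (simp only: borcherds_identity_def)
    also have "\<dots> = (\<Sum>i<Q. scl M ((e * e) * jacobi_coeff c i) (vop M (X r) (B r + 1 + c + int i) (vop M (U s) (A s - int i) w)))
        - (\<Sum>i<Q. scl M (e * jacobi_coeff c i) (vop M (U s) (A s + 1 + c + int i) (vop M (X r) (B r - int i) w)))"
      by (simp add: vs.scale_right_diff_distrib vs.scale_sum_right mult.assoc sum_negf)
    finally show ?thesis
      by (simp add: ee)
  qed
  have "?F1 - ?F2 = (\<Sum>r<P. \<Sum>s<P. scl M (\<kappa> s r) (scl M (- e) (\<Sum>n<P. scl M (of_int (- A s - 1) gchoose n) (Y s r n))))"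
  proof -
    have "(\<Sum>r<P. \<Sum>s<P. scl M (\<kappa> s r) (f r s)) - (\<Sum>r<P. \<Sum>s<P. scl M (\<kappa> s r) (f' r s))
        = (\<Sum>r<P. \<Sum>s<P. scl M (\<kappa> s r) (f'' r s))"
      if "\<And>r s. r < P \<Longrightarrow> s < P \<Longrightarrow> f r s - f' r s = f'' r s" for f f' f''
      unfolding sum_subtractf[symmetric] vs.scale_right_diff_distrib[symmetric]
      using that by (intro sum.cong refl) auto
    from this[OF sr] show ?thesis
      unfolding F1 F2 .
  qed
  moreover have "?F3 = \<dots>"
  proof -
    have YV0: "YV u (c - int i) v = 0" if "P \<le> i" for i
      using UX0[of 0 i 0] that by (simp add: U_def X_def)
    have star_term: "star (YV u (c - int i) v) (b + a + 1 + int i) w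
      = (\<Sum>r<P. \<Sum>s<P. scl M (\<kappa> s r) (\<Sum>t<P.
           scl M (- e * (-1) ^ i * (of_int (2 * h + c - int s - 1) - of_nat i gchoose t)) (Y s r (i + t))))" for i
    proof -
      have wt: "YV u (c - int i) v \<in> Vwt (h + g + (c - int i))"
        by (rule vop_Vwt[OF u v])
      have L0: "\<forall>p\<ge>P. (L1 ^^ p) (YV u (c - int i) v) = 0"
      proof (intro allI impI)
        fix p assume "P \<le> p"
        moreover have "(L1 ^^ p) (YV u (c - int i) v) \<in> Vwt (h + g + c - int (i + p))"
          using L1_pow_Vwt[OF wt, of p] by (simp add: algebra_simps)
        ultimately show "(L1 ^^ p) (YV u (c - int i) v) = 0"
          by (intro vanish[of _ "h + g + c" "i + p"]) auto
      qed
      have "star (YV u (c - int i) v) (b + a + 1 + int i) w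
        = (\<Sum>p<P. scl M ((-1) powi (h + g + (c - int i)) / fact p) (vop M ((L1 ^^ p) (YV u (c - int i) v))
             (int p - 2 * (h + g + (c - int i)) - (b + a + 1 + int i)) w))"
        by (rule star_homogeneous[OF wt L0])
      also have "\<dots> = (\<Sum>p<P. \<Sum>(s, t, r)\<in>triples p.
          scl M ((-1) powi (h + g + (c - int i)) * L1_coeff h (c - int i) s t r) (Y s r (i + t)))"
      proof (rule sum.cong, rule refl)
        fix p
        define K where "K = int p - 2 * (h + g + (c - int i)) - (b + a + 1 + int i)"
        have ind: "vop M (YV ((L1 ^^ s) u) (c - int i - int t) ((L1 ^^ r) v)) K w = Y s r (i + t)"
          if "(s, t, r) \<in> triples p" for s t r
        proof -
          have "K = B r + A s + 1 + int (i + t)" "c - int i - int t = c - int (i + t)"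
            using that by (auto simp: triples_def A_def B_def K_def)
          then show ?thesis
            by (simp only: Y_def U_def X_def)
        qed
        show "scl M ((-1) powi (h + g + (c - int i)) / fact p) (vop M ((L1 ^^ p) (YV u (c - int i) v))
             (int p - 2 * (h + g + (c - int i)) - (b + a + 1 + int i)) w)
          = (\<Sum>(s, t, r)\<in>triples p.
          scl M ((-1) powi (h + g + (c - int i)) * L1_coeff h (c - int i) s t r) (Y s r (i + t)))"
          unfolding K_def[symmetric] L1_pow_vop[OF u] vop_scale_left vop_sum_left vs.scale_scale vs.scale_sum_right
          by (intro sum.cong refl) (auto simp: vop_scale_left ind)
      qed
      also have "\<dots> = (\<Sum>s<P. \<Sum>t<P. \<Sum>r<P.
          scl M ((-1) powi (h + g + (c - int i)) * L1_coeff h (c - int i) s t r) (Y s r (i + t)))"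
        by (rule sum_triples_eq_box) (simp add: Y0)
      also have "\<dots> = (\<Sum>r<P. \<Sum>s<P. \<Sum>t<P.
          scl M ((-1) powi (h + g + (c - int i)) * L1_coeff h (c - int i) s t r) (Y s r (i + t)))"
        by (subst (2) sum.swap, subst sum.swap) simp
      also have "\<dots> = (\<Sum>r<P. \<Sum>s<P. scl M (\<kappa> s r) (\<Sum>t<P.
           scl M (- e * (-1) ^ i * (of_int (2 * h + c - int s - 1) - of_nat i gchoose t)) (Y s r (i + t))))"
      proof -
        \<comment> \<open>Since \<open>e\<close> is (-1)^{c+1}, the contribution (-1)^c of the
          weight of the iterate is \<open>- e\<close>.\<close>
        have sign: "(-1) powi (h + g + (c - int i)) = (-1) powi h * (-1) powi g * (- e * (-1) ^ i :: complex)"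
          by (cases "even i") (simp_all add: e_def power_int_add power_int_diff)
        have "(-1) powi (h + g + (c - int i)) * L1_coeff h (c - int i) s t r
          = \<kappa> s r * (- e * (-1) ^ i * (of_int (2 * h + c - int s - 1) - of_nat i gchoose t))" for s t r
          unfolding sign L1_coeff_def \<kappa>_def by (simp add: algebra_simps)
        then show ?thesis
          by (simp only: vs.scale_sum_right vs.scale_scale)
      qed
      finally show ?thesis .
    qed
    have "?F3 = (\<Sum>i<P. scl M (of_int (- a - 1) gchoose i) (star (YV u (c - int i) v) (b + a + 1 + int i) w))"
      by (rule Sum_any_eq_sum_lessThan) (simp add: YV0)
    also have "\<dots> = (\<Sum>r<P. \<Sum>s<P. scl M (\<kappa> s r) (\<Sum>i<P. scl M (of_int (- a - 1) gchoose i) (\<Sum>t<P.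
           scl M (- e * (-1) ^ i * (of_int (2 * h + c - int s - 1) - of_nat i gchoose t)) (Y s r (i + t)))))"
      unfolding star_term by (rule vs.sum_scale_swap)
    also have "\<dots> = (\<Sum>r<P. \<Sum>s<P. scl M (\<kappa> s r) (scl M (- e) (\<Sum>n<P. scl M (of_int (- A s - 1) gchoose n) (Y s r n))))"
    proof (intro sum.cong refl arg_cong2[where f = "scl M"])
      fix r s
      \<comment> \<open>The index i of the iterate and the index t coming from L(1) lower the same
        mode of u, so \<open>Y\<close> depends only on n = i + t. The sum over i at fixed n is the
        alternating Vandermonde sum, and \<open>?T\<close> minus the upper index
        \<open>- a - 1\<close> is \<open>- A s - 1\<close>.\<close>
      let ?T = "of_int (2 * h + c - int s - 1) :: complex"
      let ?f = "\<lambda>i t. (-1) ^ i * (of_int (- a - 1) gchoose i) * (?T - of_nat i gchoose t) :: complex"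
      have "(\<Sum>i<P. scl M (of_int (- a - 1) gchoose i) (\<Sum>t<P.
           scl M (- e * (-1) ^ i * (?T - of_nat i gchoose t)) (Y s r (i + t))))
         = scl M (- e) (\<Sum>i<P. \<Sum>t<P. scl M (?f i t) (Y s r (i + t)))"
        by (simp add: vs.scale_sum_right algebra_simps)
      also have "(\<Sum>i<P. \<Sum>t<P. scl M (?f i t) (Y s r (i + t)))
          = (\<Sum>n<P. \<Sum>i\<le>n. scl M (?f i (n - i)) (Y s r (i + (n - i))))"
        by (rule sum_square_eq_triangle) (simp add: Y0)
      also have "\<dots> = (\<Sum>n<P. scl M (\<Sum>i\<le>n. ?f i (n - i)) (Y s r n))"
        by (simp add: vs.scale_sum_left)
      also have "\<dots> = (\<Sum>n<P. scl M (of_int (- A s - 1) gchoose n) (Y s r n))"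
      proof -
        have "?T - of_int (- a - 1) = of_int (- A s - 1)"
          by (simp add: A_def)
        then show ?thesis
          unfolding gbinomial_alternating_Vandermonde by simp
      qed
      finally show "(\<Sum>i<P. scl M (of_int (- a - 1) gchoose i) (\<Sum>t<P.
           scl M (- e * (-1) ^ i * (?T - of_nat i gchoose t)) (Y s r (i + t))))
         = scl M (- e) (\<Sum>n<P. scl M (of_int (- A s - 1) gchoose n) (Y s r n))" .
    qed
    finally show ?thesis .
  qed
  ultimately show ?thesis by simp
qed

end

context vaction
begin

lemma star_jacobi:
  "(Sum_any (\<lambda>i. scl M (jacobi_coeff c i) (star v (b - int i) (star u (a + 1 + c + int i) w))))
    - (Sum_any (\<lambda>i. scl M ((-1) powi (c + 1) * jacobi_coeff c i) (star u (a - int i) (star v (b + 1 + c + int i) w))))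
    = (Sum_any (\<lambda>i. scl M (of_int (- a - 1) gchoose i) (star (YV u (c - int i) v) (b + a + 1 + int i) w)))"
    (is "(Sum_any (\<lambda>i. ?F1 u v i)) - (Sum_any (\<lambda>i. ?F2 u v i)) = (Sum_any (\<lambda>i. ?F3 u v i))")
proof -
  have fin1: "finite {i. ?F1 u v i \<noteq> 0}" for u v
  proof -
    obtain K where "\<forall>i\<ge>K. star u (a + 1 + c + int i) w = 0"
      using star_trunc[of u "a + 1 + c" w] by blast
    then show ?thesis
      by (intro finite_support_natI[of K]) simp
  qed
  have fin2: "finite {i. ?F2 u v i \<noteq> 0}" for u v
  proof -
    obtain K where "\<forall>i\<ge>K. star v (b + 1 + c + int i) w = 0"
      using star_trunc[of v "b + 1 + c" w] by blast
    then show ?thesis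
      by (intro finite_support_natI[of K]) simp
  qed
  have fin3: "finite {i. ?F3 u v i \<noteq> 0}" for u v
  proof -
    obtain N where "\<forall>k<N. YV u k v = 0"
      by (rule reg.vop_trunc)
    then show ?thesis
      by (intro finite_support_natI[of "nat (c - N + 1)"]) simp
  qed
  show ?thesis
  proof (induction u arbitrary: v rule: voa_induct)
    case (add u u')
    have "(Sum_any (\<lambda>i. ?F1 (u + u') v i)) = (Sum_any (\<lambda>i. ?F1 u v i)) + (Sum_any (\<lambda>i. ?F1 u' v i))"
      "(Sum_any (\<lambda>i. ?F2 (u + u') v i)) = (Sum_any (\<lambda>i. ?F2 u v i)) + (Sum_any (\<lambda>i. ?F2 u' v i))"
      "(Sum_any (\<lambda>i. ?F3 (u + u') v i)) = (Sum_any (\<lambda>i. ?F3 u v i)) + (Sum_any (\<lambda>i. ?F3 u' v i))"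
      unfolding Sum_any.distrib[OF fin1 fin1, symmetric] Sum_any.distrib[OF fin2 fin2, symmetric]
        Sum_any.distrib[OF fin3 fin3, symmetric]
      by (simp_all only: star_add_left star_add reg.vop_add_left vs.scale_right_distrib)
    then show ?case
      unfolding add.IH[of v, symmetric] by (simp only: add.IH[of v, symmetric]) simp
  next
    case (homogeneous h u)
    show ?case
    proof (induction v rule: voa_induct)
      case (add v v')
      have "(Sum_any (\<lambda>i. ?F1 u (v + v') i)) = (Sum_any (\<lambda>i. ?F1 u v i)) + (Sum_any (\<lambda>i. ?F1 u v' i))"
        "(Sum_any (\<lambda>i. ?F2 u (v + v') i)) = (Sum_any (\<lambda>i. ?F2 u v i)) + (Sum_any (\<lambda>i. ?F2 u v' i))"
        "(Sum_any (\<lambda>i. ?F3 u (v + v') i)) = (Sum_any (\<lambda>i. ?F3 u v i)) + (Sum_any (\<lambda>i. ?F3 u v' i))"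
        unfolding Sum_any.distrib[OF fin1 fin1, symmetric] Sum_any.distrib[OF fin2 fin2, symmetric]
          Sum_any.distrib[OF fin3 fin3, symmetric]
        by (simp_all only: star_add_left star_add reg.vop_add vs.scale_right_distrib)
      then show ?case
        by (simp only: add[symmetric]) simp
    next
      case (homogeneous g v)
      then show ?case
        by (rule star_jacobi_homogeneous[OF \<open>u \<in> Vwt h\<close>])
    qed
  qed
qed

lemma star_vac: "star (vac V) k w = (if k = 0 then w else 0)"
proof -
  have "\<forall>i\<ge>1. (L1 ^^ i) (vac V) = 0"
  proof (intro allI impI)
    fix i :: nat assume "1 \<le> i"
    then obtain j where "i = Suc j"
      by (cases i) auto
    then show "(L1 ^^ i) (vac V) = 0"
      by (simp only: funpow_Suc_right o_apply) (simp add: vop_vac_neg)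
  qed
  from star_homogeneous[OF vac_weight this] show ?thesis
    by (simp add: vop_vac)
qed

text \<open>By \<open>L1_conf\<close> only the zeroth power of L(1) contributes. Thus L(0) is its
  own adjoint, and weights in W' are those of W.\<close>

lemma star_conf: "star (conf V) (- 2) w = vop M (conf V) (- 2) w"
proof -
  have "\<forall>i\<ge>1. (L1 ^^ i) (conf V) = 0"
  proof (intro allI impI)
    fix i :: nat assume "1 \<le> i"
    then obtain j where "i = Suc j"
      by (cases i) auto
    then show "(L1 ^^ i) (conf V) = 0"
      by (simp only: funpow_Suc_right o_apply) (simp add: L1_conf)
  qed
  from star_homogeneous[OF conf_weight this] show ?thesis
    by simp
qed

end

section \<open>Modules and their contragredients\<close>

locale voa_module = voa V for V :: "'v::ab_group_add voa" +
  fixes M :: "('v, 'w::ab_group_add) vact"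
  assumes vmodule: "vmodule V M UNIV"
begin

sublocale vaction V M
  by unfold_locales (use vmodule in \<open>simp add: vmodule_def generalized_module_def\<close>)

abbreviation "Wt \<equiv> weight_space V M UNIV"

sublocale wt: direct_sum "scl M" Wt
  by unfold_locales (use vmodule subspace_weight_space in \<open>auto simp: vmodule_def generalized_module_def\<close>)

abbreviation "pr \<equiv> component Wt"
abbreviation "dual \<equiv> contragredient V M"
abbreviation "dact \<equiv> contragredient_act V M"

lemma Wt_bounded: obtains r where "\<forall>n. Re n < r \<longrightarrow> Wt n = {0}"
  using vmodule unfolding vmodule_def by metis

lemma pr_idem: "pr m (pr n w) = (if m = n then pr n w else 0)"
  by (rule wt.comp_summand[OF wt.comp_mem])

lemma pr_L0: "pr n (vop M (conf V) (- 2) w) = scl M n (pr n w)"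
proof (rule component_eqI[OF wt.direct_sum UNIV_I])
  have L0: "vop M (conf V) (- 2) (pr i w) = scl M i (pr i w)" for i
    using wt.comp_mem[of i w] by (simp only: weight_space_iff)
  have "vop M (conf V) (- 2) w = vop M (conf V) (- 2) (Sum_any (\<lambda>i. pr i w))"
    by (simp only: wt.comp_sum)
  also have "\<dots> = (Sum_any (\<lambda>i. scl M i (pr i w)))"
    unfolding vop_Sum_any[OF wt.comp_finite] by (simp only: L0)
  finally show "(Sum_any (\<lambda>i. scl M i (pr i w))) = vop M (conf V) (- 2) w" ..
  show "finite {i. scl M i (pr i w) \<noteq> 0}"
    by (rule vs.finite_scale[OF wt.comp_finite])
qed (auto intro: vs.subspace_scale[OF subspace_weight_space] wt.comp_mem)

section \<open>The graded dual space\<close>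

lemma dual_linear: "f \<in> dual \<Longrightarrow> linear_on (scl M) UNIV (*) f"
  by (simp add: contragredient_def)

lemma dual_add: "f \<in> dual \<Longrightarrow> f (x + y) = f x + f y"
  and dual_scale: "f \<in> dual \<Longrightarrow> f (scl M c x) = c * f x"
  using dual_linear[of f] by (auto simp: linear_on_def)

lemma dual_0 [simp]: "f \<in> dual \<Longrightarrow> f 0 = 0"
  using dual_scale[of f 0 0] by simp

lemma dual_diff: "f \<in> dual \<Longrightarrow> f (x - y) = f x - f y"
  using dual_add[of f "x - y" y] by simp

lemma dual_sum: "f \<in> dual \<Longrightarrow> f (sum g I) = (\<Sum>i\<in>I. f (g i))"
  by (induction I rule: infinite_finite_induct) (auto simp: dual_add)

lemma dual_Sum_any: "f \<in> dual \<Longrightarrow> finite {i. g i \<noteq> 0} \<Longrightarrow> f (Sum_any g) = (Sum_any (\<lambda>i. f (g i)))"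
  by (rule linear_on_Sum_any[OF dual_linear]) (auto simp: vs.vector_space_axioms)

lemma dual_expand: "f \<in> dual \<Longrightarrow> f w = (Sum_any (\<lambda>n. f (pr n w)))"
  using dual_Sum_any[OF _ wt.comp_finite[of w], of f] by (simp add: wt.comp_sum)

definition dual_support :: "('w \<Rightarrow> complex) \<Rightarrow> complex set" where
  "dual_support f = {n. \<exists>w\<in>Wt n. f w \<noteq> 0}"

lemma finite_dual_support: "f \<in> dual \<Longrightarrow> finite (dual_support f)"
  by (simp add: contragredient_def dual_support_def)

lemma dual_support_outside: "n \<notin> dual_support f \<Longrightarrow> w \<in> Wt n \<Longrightarrow> f w = 0"
  by (auto simp: dual_support_def)

lemma dualI:
  assumes "\<And>x y. f (x + y) = f x + f y" "\<And>c x. f (scl M c x) = c * f x"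
    and "finite S" "\<And>n w. w \<in> Wt n \<Longrightarrow> n \<notin> S \<Longrightarrow> f w = 0"
  shows "f \<in> dual"
proof -
  have "{n. \<exists>w\<in>Wt n. f w \<noteq> 0} \<subseteq> S"
    using assms(4) by blast
  then show ?thesis
    using assms(1,2,3) finite_subset by (auto simp: contragredient_def linear_on_def)
qed

lemma dual_sum_closed: "f \<in> dual \<Longrightarrow> g \<in> dual \<Longrightarrow> (\<lambda>w. f w + g w) \<in> dual"
  by (rule dualI[of _ "dual_support f \<union> dual_support g"])
    (auto simp: dual_add dual_scale finite_dual_support dual_support_outside algebra_simps)

lemma dual_scale_closed: "f \<in> dual \<Longrightarrow> (\<lambda>w. c * f w) \<in> dual"
  by (rule dualI[of _ "dual_support f"])
    (auto simp: dual_add dual_scale finite_dual_support dual_support_outside algebra_simps)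

lemma dual_compose:
  assumes f: "f \<in> dual" and T: "\<And>x y. T (x + y) = T x + T y" "\<And>c x. T (scl M c x) = scl M c (T x)"
    and shift: "\<And>n w. w \<in> Wt n \<Longrightarrow> T w \<in> Wt (n + d)"
  shows "(\<lambda>w. f (T w)) \<in> dual"
proof (rule dualI)
  show "finite ((\<lambda>n. n - d) ` dual_support f)"
    using finite_dual_support[OF f] by simp
  fix n w assume w: "w \<in> Wt n" "n \<notin> (\<lambda>n. n - d) ` dual_support f"
  then have "n + d \<notin> dual_support f"
    by (metis add_diff_cancel image_eqI)
  then show "f (T w) = 0"
    using shift[OF w(1)] dual_support_outside by blast
qed (simp_all add: dual_add[OF f] dual_scale[OF f] T)

lemma dual_pr:
  assumes f: "f \<in> dual"
  shows "(\<lambda>w. f (pr n w)) \<in> dual"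
proof (rule dualI)
  show "finite {n}" by simp
  fix m w assume "w \<in> Wt m" "m \<notin> {n}"
  then show "f (pr n w) = 0"
    using wt.comp_summand[of w m n] f by simp
qed (simp_all add: wt.comp_add wt.comp_scale dual_add[OF f] dual_scale[OF f])

lemma dual_vop:
  assumes f: "f \<in> dual"
  shows "(\<lambda>w. f (vop M v k w)) \<in> dual"
proof (induction v rule: voa_induct)
  case (add u v)
  then show ?case
    using dual_sum_closed[OF add] by (simp add: vop_add_left dual_add[OF f])
next
  case (homogeneous h v)
  show ?case
    by (rule dual_compose[OF f vop_add vop_scale vop_weight[OF homogeneous]])
qed

lemma dual_star:
  assumes f: "f \<in> dual"
  shows "(\<lambda>w. f (star v k w)) \<in> dual"
proof (induction v rule: voa_induct)
  case (add u v)
  then show ?case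
    using dual_sum_closed[OF add] by (simp add: star_add_left dual_add[OF f])
next
  case (homogeneous h v)
  show ?case
  proof (rule dual_compose[OF f star_add star_scale])
    show "star v k w \<in> Wt (n + - of_int (h + k))" if "w \<in> Wt n" for n w
      using star_weight[OF homogeneous that, of k] by (simp only: diff_conv_add_uminus)
  qed
qed

text \<open>If the weights seen by \<open>f\<close> have real part below \<open>R\<close>, and all
  weights of the module have real part at least \<open>r\<close>, then a homogeneous map of degree d
  with Re d > R - r sends every vector out of sight of \<open>f\<close>. So \<open>D\<close> is
  \<open>R - r\<close>.\<close>

lemma dual_vanish:
  assumes f: "f \<in> dual"
  obtains D where "\<And>d T w. D < Re d \<Longrightarrow> (\<And>n x. x \<in> Wt n \<Longrightarrow> T x \<in> Wt (n + d)) \<Longrightarrow>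
    (\<And>x y. T (x + y) = T x + T y) \<Longrightarrow> f (T w) = 0"
proof -
  obtain r where r: "\<forall>n. Re n < r \<longrightarrow> Wt n = {0}"
    by (rule Wt_bounded)
  obtain R where R: "\<forall>m\<in>dual_support f. Re m < R"
  proof (cases "dual_support f = {}")
    case False
    have "Re m < Max (Re ` dual_support f) + 1" if "m \<in> dual_support f" for m
    proof -
      have "Re m \<le> Max (Re ` dual_support f)"
        using that finite_dual_support[OF f] by (intro Max_ge) auto
      then show ?thesis by simp
    qed
    then show ?thesis
      using that by blast
  qed (use that in simp)
  have "f (T w) = 0" if d: "R - r < Re d" and shift: "\<And>n x. x \<in> Wt n \<Longrightarrow> T x \<in> Wt (n + d)"
    and T: "\<And>x y. T (x + y) = T x + T y" for d T w
  proof (induction w rule: wt.direct_sum_induct)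
    case zero
    have "T 0 = 0"
      using T[of 0 0] by simp
    then show ?case
      using f by simp
  next
    case (summand n x)
    show ?case
    proof (cases "n + d \<in> dual_support f")
      case True
      then have "Re n + Re d < R"
        using R by (metis plus_complex.sel(1))
      then have "x = 0"
        using summand r d by auto
      then show ?thesis
        using T[of 0 0] f by simp
    qed (use dual_support_outside shift summand in blast)
  qed (simp add: T dual_add[OF f])
  then show thesis
    using that by blast
qed

text \<open>The coefficient of x^k in the opposite operator shifts weights by -(h + k), so very
  negative \<open>k\<close> fall under \<open>dual_vanish\<close>. Uniformity in \<open>w\<close>
  makes this a truncation of functionals, that is, the lower truncation of W'.\<close>

lemma dual_star_trunc:
  assumes f: "f \<in> dual"
  shows "\<exists>N. \<forall>k<N. \<forall>w. f (star v k w) = 0"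
proof (induction v rule: voa_induct)
  case (add u v)
  then obtain N N' where "\<forall>k<N. \<forall>w. f (star u k w) = 0" "\<forall>k<N'. \<forall>w. f (star v k w) = 0"
    by blast
  then show ?case
    by (intro exI[of _ "min N N'"]) (simp add: star_add_left dual_add[OF f])
next
  case (homogeneous h v)
  obtain D where D: "\<And>d T w. D < Re d \<Longrightarrow> (\<And>n x. x \<in> Wt n \<Longrightarrow> T x \<in> Wt (n + d)) \<Longrightarrow>
    (\<And>x y. T (x + y) = T x + T y) \<Longrightarrow> f (T w) = 0"
    using dual_vanish[OF f] by blast
  have "f (star v k w) = 0" if "k < - \<lceil>D\<rceil> - h" for k w
  proof (rule D[where d = "- of_int (h + k)" and T = "star v k"])
    have "D \<le> of_int \<lceil>D\<rceil>"
      by simp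
    also have "\<dots> < of_int (- (h + k))"
      using that by linarith
    finally show "D < Re (- of_int (h + k))"
      by simp
    show "star v k x \<in> Wt (n + - of_int (h + k))" if "x \<in> Wt n" for n x
      using star_weight[OF homogeneous that, of k] by (simp only: diff_conv_add_uminus)
  qed (rule star_add)
  then show ?case by blast
qed

text \<open>The same estimate at the other end: for Y itself large \<open>k\<close> raise the
  weight. This is what makes pairings with Y_3 on the completion finite.\<close>

lemma dual_vop_trunc:
  assumes f: "f \<in> dual"
  shows "\<exists>K. \<forall>k\<ge>K. \<forall>w. f (vop M v k w) = 0"
proof (induction v rule: voa_induct)
  case (add u v)
  then obtain N N' where "\<forall>k\<ge>N. \<forall>w. f (vop M u k w) = 0" "\<forall>k\<ge>N'. \<forall>w. f (vop M v k w) = 0"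
    by blast
  then show ?case
    by (intro exI[of _ "max N N'"]) (simp add: vop_add_left dual_add[OF f])
next
  case (homogeneous h v)
  obtain D where D: "\<And>d T w. D < Re d \<Longrightarrow> (\<And>n x. x \<in> Wt n \<Longrightarrow> T x \<in> Wt (n + d)) \<Longrightarrow>
    (\<And>x y. T (x + y) = T x + T y) \<Longrightarrow> f (T w) = 0"
    using dual_vanish[OF f] by blast
  have "f (vop M v k w) = 0" if "k \<ge> \<lceil>D\<rceil> - h + 1" for k w
  proof (rule D[where d = "of_int (h + k)" and T = "vop M v k"])
    have "D \<le> of_int \<lceil>D\<rceil>"
      by simp
    also have "\<dots> < of_int (h + k)"
      using that by linarith
    finally show "D < Re (of_int (h + k))"
      by simp
  qed (use vop_weight[OF homogeneous] vop_add in auto)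
  then show ?case by blast
qed

text \<open>The functionals are coordinates on one weight space, precomposed with the projection so
  that they live on the whole module and belong to W'.\<close>

lemma dual_basis:
  obtains B \<phi> where "finite B" "\<forall>b\<in>B. b \<in> Wt n" "\<forall>b\<in>B. \<phi> b \<in> dual"
    "\<forall>b\<in>B. \<forall>w. \<phi> b (pr n w) = \<phi> b w" "\<forall>w. pr n w = (\<Sum>b\<in>B. scl M (\<phi> b w) b)"
proof -
  obtain B0 where B0: "finite B0" "Wt n = vs.span B0"
    using vmodule unfolding vmodule_def finite_dimensional_def by blast
  obtain B where B: "B \<subseteq> B0" "vs.independent B" "B0 \<subseteq> vs.span B"
    using vs.maximal_independent_subset[of B0] by blast
  have span: "vs.span B = Wt n"
    using B vs.span_minimal[OF B(3)] vs.span_mono[OF B(1)] unfolding B0(2) by auto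
  have finB: "finite B"
    using B(1) B0(1) finite_subset by blast
  define \<phi> where "\<phi> b w = vs.representation B (pr n w) b" for b w
  have mem: "pr n w \<in> vs.span B" for w
    using wt.comp_mem span by simp
  show thesis
  proof (rule that[of B \<phi>])
    show "\<forall>b\<in>B. b \<in> Wt n"
      using vs.span_base[of _ B] span by simp
    show "\<forall>b\<in>B. \<forall>w. \<phi> b (pr n w) = \<phi> b w"
      by (simp add: \<phi>_def pr_idem)
    show "\<forall>b\<in>B. \<phi> b \<in> dual"
    proof (intro ballI dualI[of _ "{n}"])
      fix b
      show "\<phi> b (x + y) = \<phi> b x + \<phi> b y" for x y
        using vs.representation_add[OF B(2) mem mem] by (simp add: \<phi>_def wt.comp_add)
      show "\<phi> b (scl M c x) = c * \<phi> b x" for c x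
        using vs.representation_scale[OF B(2) mem] by (simp add: \<phi>_def wt.comp_scale)
      show "\<phi> b w = 0" if "w \<in> Wt m" "m \<notin> {n}" for m w
        using that wt.comp_summand[OF that(1), of n] by (simp add: \<phi>_def vs.representation_zero)
    qed simp
    show "\<forall>w. pr n w = (\<Sum>b\<in>B. scl M (\<phi> b w) b)"
      unfolding \<phi>_def using vs.sum_representation_eq[OF B(2) mem finB subset_refl] by simp
  qed (rule finB)
qed

lemma dual_separates:
  assumes "\<And>f. f \<in> dual \<Longrightarrow> f w = 0"
  shows "w = 0"
proof -
  have "pr n w = 0" for n
  proof -
    obtain B \<phi> where B: "\<forall>b\<in>B. \<phi> b \<in> dual" "\<forall>w. pr n w = (\<Sum>b\<in>B. scl M (\<phi> b w) b)"
      by (rule dual_basis[of n])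
    have "pr n w = (\<Sum>b\<in>B. scl M (\<phi> b w) b)"
      using B(2) by blast
    also have "\<dots> = 0"
      by (rule sum.neutral) (simp add: assms B(1))
    finally show ?thesis .
  qed
  then show ?thesis
    using wt.comp_sum[of w] by simp
qed

section \<open>The contragredient module\<close>

lemma dact_simps [simp]: "scl dact c f w = c * f w" "vop dact v k f w = f (star v k w)"
  by (simp_all add: contragredient_act_def)

lemma vop_dact: "vop dact v k f = (\<lambda>w. f (star v k w))"
  by (simp add: fun_eq_iff)

lemma vector_space_dact: "vector_space (scl dact)"
  by unfold_locales (auto simp: fun_eq_iff algebra_simps)

sublocale dvs: vector_space "scl dact"
  by (rule vector_space_dact)

lemma subspace_dual: "dvs.subspace dual"
proof (rule dvs.subspaceI)
  show "0 \<in> dual"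
    by (rule dualI[of _ "{}"]) auto
  show "f + g \<in> dual" if "f \<in> dual" "g \<in> dual" for f g
    using dual_sum_closed[OF that] by (simp add: plus_fun_def)
  show "scl dact c f \<in> dual" if "f \<in> dual" for c f
    using dual_scale_closed[OF that, of c] by (simp add: contragredient_act_def)
qed

text \<open>Passing to adjoints reverses compositions, and the reversed order is the one in which
  \<open>star_jacobi\<close> has its operators.\<close>

lemma dual_borcherds:
  assumes f: "f \<in> dual"
  shows "borcherds_identity V dact u v f a b c"
proof -
  obtain Nv where Nv: "\<forall>k<Nv. \<forall>w. f (star v k w) = 0"
    using dual_star_trunc[OF f] by blast
  obtain Nu where Nu: "\<forall>k<Nu. \<forall>w. f (star u k w) = 0"
    using dual_star_trunc[OF f] by blast
  obtain N where N: "\<forall>k<N. YV u k v = 0"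
    by (rule reg.vop_trunc)
  \<comment> \<open>Two kinds of finiteness are involved: here for sums of functionals, uniformly in
    the vector, and below for sums in the module at a fixed \<open>w\<close>.\<close>
  have fin1: "finite {i. scl dact (jacobi_coeff c i) (vop dact u (a + 1 + c + int i) (vop dact v (b - int i) f)) \<noteq> 0}"
    by (rule finite_support_natI[of "nat (b - Nv + 1)"]) (simp add: fun_eq_iff Nv)
  have fin2: "finite {i. scl dact ((-1) powi (c + 1) * jacobi_coeff c i) (vop dact v (b + 1 + c + int i) (vop dact u (a - int i) f)) \<noteq> 0}"
    by (rule finite_support_natI[of "nat (a - Nu + 1)"]) (simp add: fun_eq_iff Nu)
  have fin3: "finite {i. scl dact (of_int (- a - 1) gchoose i) (vop dact (YV u (c - int i) v) (b + a + 1 + int i) f) \<noteq> 0}"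
    by (rule finite_support_natI[of "nat (c - N + 1)"]) (use f in \<open>simp add: fun_eq_iff N\<close>)
  show ?thesis
    unfolding borcherds_identity_def
  proof
    fix w
    obtain Ku where Ku: "\<forall>i\<ge>Ku. star u (a + 1 + c + int i) w = 0"
      using star_trunc[of u "a + 1 + c" w] by blast
    obtain Kv where Kv: "\<forall>i\<ge>Kv. star v (b + 1 + c + int i) w = 0"
      using star_trunc[of v "b + 1 + c" w] by blast
    have fin1': "finite {i. scl M (jacobi_coeff c i) (star v (b - int i) (star u (a + 1 + c + int i) w)) \<noteq> 0}"
      by (rule finite_support_natI[of Ku]) (simp add: Ku)
    have fin2': "finite {i. scl M ((-1) powi (c + 1) * jacobi_coeff c i) (star u (a - int i) (star v (b + 1 + c + int i) w)) \<noteq> 0}"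
      by (rule finite_support_natI[of Kv]) (simp add: Kv)
    have fin3': "finite {i. scl M (of_int (- a - 1) gchoose i) (star (YV u (c - int i) v) (b + a + 1 + int i) w) \<noteq> 0}"
      by (rule finite_support_natI[of "nat (c - N + 1)"]) (simp add: N)
    show "(Sum_any (\<lambda>i. scl dact (jacobi_coeff c i) (vop dact u (a + 1 + c + int i) (vop dact v (b - int i) f)))
       - Sum_any (\<lambda>i. scl dact ((-1) powi (c + 1) * jacobi_coeff c i) (vop dact v (b + 1 + c + int i) (vop dact u (a - int i) f)))) w
       = Sum_any (\<lambda>i. scl dact (of_int (- a - 1) gchoose i) (vop dact (YV u (c - int i) v) (b + a + 1 + int i) f)) w"
      unfolding minus_apply Sum_any_apply[OF fin1] Sum_any_apply[OF fin2] Sum_any_apply[OF fin3]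
      using arg_cong[OF star_jacobi[where c = c and b = b and v = v and a = a and u = u and w = w], of f]
      by (simp only: dual_diff[OF f] dual_Sum_any[OF f fin1'] dual_Sum_any[OF f fin2'] dual_Sum_any[OF f fin3']
          dual_scale[OF f] dact_simps)
  qed
qed

text \<open>The Jacobi identity is applied to v and the vacuum with x_0-exponent 1, where the
  iterate is L(-1)v by \<open>derivative_eq\<close>. The vacuum acts by its constant term only, so
  one term survives: in the first product for k >= 0, in the second for k <= -2. For k = -1 none
  does, matching the factor k + 1 = 0.\<close>

lemma dual_derivative:
  assumes f: "f \<in> dual"
  shows "vop dact (YV (conf V) (- 1) v) k f = scl dact (of_int (k + 1)) (vop dact v (k + 1) f)"
proof -
  have coeff: "jacobi_coeff 1 i = of_nat (i + 1)" for i
  proof -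
    have "(- 2 gchoose i :: complex) = (-1) ^ i * (2 + of_nat i - 1 gchoose i)"
      by (rule gbinomial_minus)
    also have "2 + of_nat i - 1 = (of_nat (i + 1) :: complex)"
      by simp
    also have "(of_nat (i + 1) gchoose i) = (of_nat ((i + 1) choose i) :: complex)"
      by (rule binomial_gbinomial[symmetric])
    finally show ?thesis
      by (simp add: jacobi_coeff_def)
  qed
  have vac: "vop dact (vac V) j g = (if j = 0 then g else 0)" if "g \<in> dual" for j g
    using that by (auto simp: fun_eq_iff star_vac)
  have 1: "Sum_any (\<lambda>i. scl dact (jacobi_coeff 1 i) (vop dact v (- 1 + 1 + 1 + int i) (vop dact (vac V) (k - int i) f)))
      = (if 0 \<le> k then scl dact (of_int (k + 1)) (vop dact v (k + 1) f) else 0)"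
  proof -
    have "scl dact (jacobi_coeff 1 i) (vop dact v (- 1 + 1 + 1 + int i) (vop dact (vac V) (k - int i) f)) = 0"
      if "i \<noteq> nat k \<or> k < 0" for i
      using that by (auto simp: vac[OF f] fun_eq_iff)
    then show ?thesis
      by (subst Sum_any_single[of "nat k"]) (auto simp: vac[OF f] coeff algebra_simps)
  qed
  have 2: "Sum_any (\<lambda>i. scl dact ((-1) powi (1 + 1) * jacobi_coeff 1 i) (vop dact (vac V) (k + 1 + 1 + int i) (vop dact v (- 1 - int i) f)))
      = (if k \<le> - 2 then scl dact (- of_int (k + 1)) (vop dact v (k + 1) f) else 0)"
  proof -
    have g: "vop dact v j f \<in> dual" for j
      using dual_star[OF f] by (simp add: vop_dact)
    have "scl dact ((-1) powi (1 + 1) * jacobi_coeff 1 i) (vop dact (vac V) (k + 1 + 1 + int i) (vop dact v (- 1 - int i) f)) = 0"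
      if "i \<noteq> nat (- k - 2) \<or> - 2 < k" for i
      using that by (auto simp: vac[OF g] fun_eq_iff)
    then show ?thesis
      by (subst Sum_any_single[of "nat (- k - 2)"]) (auto simp: vac[OF g] coeff algebra_simps)
  qed
  have 3: "Sum_any (\<lambda>i. scl dact (of_int (- (- 1) - 1) gchoose i) (vop dact (YV v (1 - int i) (vac V)) (k + - 1 + 1 + int i) f))
      = vop dact (YV (conf V) (- 1) v) k f"
  proof -
    have "(0 gchoose i :: complex) = 0" if "i \<noteq> 0" for i
      using that by (cases i) auto
    then show ?thesis
      by (subst Sum_any_single[of 0]) (auto simp: derivative_eq)
  qed
  consider "0 \<le> k" | "k \<le> - 2" | "k = - 1"
    by linarith
  then show ?thesis
    using dual_borcherds[OF f, of v "vac V" "- 1" k 1]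
    unfolding borcherds_identity_def 1 2 3 dvs.scale_minus_left by cases auto
qed

lemma vertex_action_dual: "vertex_action V dact dual"
  unfolding vertex_action_def
proof (intro conjI allI ballI)
  show "vector_space (scl dact)" "dvs.subspace dual"
    by (rule vector_space_dact subspace_dual)+
  show "jacobi_identity V dact dual"
    unfolding jacobi_identity_iff[OF vector_space_dact] using dual_borcherds by blast
  fix v k
  show "linear_on (scl dact) dual (scl dact) (vop dact v k)"
    by (auto simp: linear_on_def fun_eq_iff)
  fix f assume f: "f \<in> dual"
  show "vop dact v k f \<in> dual"
    using dual_star[OF f] by (simp add: vop_dact)
  show "linear_on sV UNIV (scl dact) (\<lambda>v. vop dact v k f)"
    by (auto simp: linear_on_def fun_eq_iff star_add_left star_scale_left dual_add[OF f] dual_scale[OF f])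
  show "\<exists>N. \<forall>k<N. vop dact v k f = 0"
    using dual_star_trunc[OF f, of v] by (auto simp: fun_eq_iff)
  show "vop dact (vac V) k f = (if k = 0 then f else 0)"
    using f by (auto simp: fun_eq_iff star_vac)
  show "vop dact (Lmode V (reg V) (- 1) v) k f = scl dact (of_int (k + 1)) (vop dact v (k + 1) f)"
    using dual_derivative[OF f] by (simp add: Lmode_def)
qed

text \<open>As L(0) is self-adjoint, a functional of weight \<open>n\<close> vanishes on every
  eigenspace with another eigenvalue.\<close>

lemma dual_weight_iff:
  "f \<in> weight_space V dact dual n \<longleftrightarrow> f \<in> dual \<and> (\<forall>w. f w = f (pr n w))"
proof
  assume "f \<in> weight_space V dact dual n"
  then have f: "f \<in> dual" and eig: "\<And>w. f (vop M (conf V) (- 2) w) = n * f w"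
    by (auto simp: weight_space_def Lmode_def fun_eq_iff star_conf)
  have "f (pr m w) = 0" if "m \<noteq> n" for m w
  proof -
    have "m * f (pr m w) = n * f (pr m w)"
      using eig[of "pr m w"] wt.comp_mem[of m w] by (simp add: weight_space_iff dual_scale[OF f])
    then show ?thesis
      using that by simp
  qed
  then have "f w = f (pr n w)" for w
    by (subst dual_expand[OF f]) (rule Sum_any_single)
  then show "f \<in> dual \<and> (\<forall>w. f w = f (pr n w))"
    using f by blast
next
  assume "f \<in> dual \<and> (\<forall>w. f w = f (pr n w))"
  then have f: "f \<in> dual" and eq: "\<And>w. f (pr n w) = f w"
    by auto
  have "f (vop M (conf V) (- 2) w) = n * f w" for w
    using eq[of "vop M (conf V) (- 2) w"] by (simp add: pr_L0 dual_scale[OF f] eq)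
  then show "f \<in> weight_space V dact dual n"
    using f by (auto simp: weight_space_def Lmode_def fun_eq_iff star_conf)
qed

theorem vmodule_dual: "vmodule V dact dual"
  unfolding vmodule_def generalized_module_def
proof (intro conjI allI)
  show "vertex_action V dact dual"
    by (rule vertex_action_dual)
  show "is_direct_sum (weight_space V dact dual) dual"
    unfolding weight_space_def
  proof (rule is_direct_sum_eigenspacesI[OF vector_space_dact subspace_dual])
    show "linear_on (scl dact) dual (scl dact) (Lmode V dact 0)"
      by (auto simp: linear_on_def fun_eq_iff Lmode_def)
    fix f assume f: "f \<in> dual"
    let ?g = "\<lambda>n w. f (pr n w)"
    have "?g n \<in> weight_space V dact dual n" for n
      using dual_pr[OF f] by (simp add: dual_weight_iff pr_idem)
    then have "?g n \<in> dual \<and> Lmode V dact 0 (?g n) = scl dact n (?g n)" for n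
      by (auto simp: weight_space_def)
    moreover have fin: "finite {n. ?g n \<noteq> 0}"
    proof (rule finite_subset[OF _ finite_dual_support[OF f]], rule subsetI, rule ccontr)
      fix n assume "n \<in> {n. ?g n \<noteq> 0}" "n \<notin> dual_support f"
      then show False
        using dual_support_outside[OF _ wt.comp_mem] by (auto simp: fun_eq_iff)
    qed
    moreover have "Sum_any ?g = f"
    proof
      show "Sum_any ?g w = f w" for w
        unfolding Sum_any_apply[OF fin] by (rule dual_expand[OF f, symmetric])
    qed
    ultimately have "(\<forall>n. ?g n \<in> dual \<and> Lmode V dact 0 (?g n) = scl dact n (?g n)) \<and>
        finite {n. ?g n \<noteq> 0} \<and> Sum_any ?g = f"
      by blast
    then show "\<exists>g. (\<forall>n. g n \<in> dual \<and> Lmode V dact 0 (g n) = scl dact n (g n)) \<and>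
        finite {n. g n \<noteq> 0} \<and> Sum_any g = f"
      by (rule exI[where x = ?g])
  qed
  show "finite_dimensional (scl dact) (weight_space V dact dual n)" for n
  proof -
    obtain B \<phi> where B: "finite B" "\<forall>b\<in>B. \<phi> b \<in> dual"
      "\<forall>b\<in>B. \<forall>w. \<phi> b (pr n w) = \<phi> b w" "\<forall>w. pr n w = (\<Sum>b\<in>B. scl M (\<phi> b w) b)"
      by (rule dual_basis[of n])
    have sub: "dvs.subspace (weight_space V dact dual n)"
      using subspace_dual by (auto simp: dvs.subspace_def dual_weight_iff)
    have "weight_space V dact dual n = dvs.span (\<phi> ` B)"
    proof
      show "dvs.span (\<phi> ` B) \<subseteq> weight_space V dact dual n"
        using B(2,3) by (intro dvs.span_minimal[OF _ sub]) (auto simp: dual_weight_iff)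
      show "weight_space V dact dual n \<subseteq> dvs.span (\<phi> ` B)"
      proof
        fix f assume "f \<in> weight_space V dact dual n"
        then have f: "f \<in> dual" "\<And>w. f w = f (pr n w)"
          by (auto simp: dual_weight_iff)
        have "f w = (\<Sum>b\<in>B. scl dact (f b) (\<phi> b)) w" for w
        proof -
          have "f w = (\<Sum>b\<in>B. \<phi> b w * f b)"
            using f(2)[of w] B(4) by (simp add: dual_sum[OF f(1)] dual_scale[OF f(1)])
          moreover have "(\<Sum>b\<in>A. scl dact (f b) (\<phi> b)) w = (\<Sum>b\<in>A. f b * \<phi> b w)" for A
            by (induction A rule: infinite_finite_induct) auto
          ultimately show ?thesis
            by (simp add: mult.commute)
        qed
        then have "f = (\<Sum>b\<in>B. scl dact (f b) (\<phi> b))" ..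
        also have "\<dots> \<in> dvs.span (\<phi> ` B)"
          by (intro dvs.span_sum dvs.span_scale dvs.span_base) auto
        finally show "f \<in> dvs.span (\<phi> ` B)" .
      qed
    qed
    then show ?thesis
      unfolding finite_dimensional_def using B(1) by blast
  qed
  obtain r where r: "\<forall>n. Re n < r \<longrightarrow> Wt n = {0}"
    by (rule Wt_bounded)
  have "weight_space V dact dual n = {0}" if "Re n < r" for n
  proof -
    have "pr n w = 0" for w
      using r that wt.comp_mem[of n w] by simp
    then show ?thesis
      using dvs.subspace_0[OF subspace_dual] by (auto simp: dual_weight_iff fun_eq_iff)
  qed
  then show "\<exists>r. \<forall>n. Re n < r \<longrightarrow> weight_space V dact dual n = {0}"
    by blast
qed

end

section \<open>The action on the dual of the tensor product\<close>

lemma Sum_any_Suc: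
  fixes f :: "nat \<Rightarrow> 'a::ab_group_add"
  assumes "finite {i. f i \<noteq> 0}"
  shows "Sum_any f = f 0 + Sum_any (\<lambda>i. f (Suc i))"
proof -
  obtain N where N: "\<forall>i\<in>{i. f i \<noteq> 0}. i < N"
    using assms finite_nat_set_iff_bounded by blast
  then have "f i = 0" if "N \<le> i" for i
    using that not_le by blast
  then have "Sum_any f = sum f {..<Suc N}" "Sum_any (\<lambda>i. f (Suc i)) = (\<Sum>i<N. f (Suc i))"
    by (intro Sum_any_eq_sum_lessThan; simp)+
  then show ?thesis
    by (simp only: sum.lessThan_Suc_shift)
qed

lemma finite_support_Suc:
  fixes f :: "nat \<Rightarrow> 'a::zero"
  assumes "finite {i. f i \<noteq> 0}"
  shows "finite {i. f (Suc i) \<noteq> 0}"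
  using finite_vimageI[OF assms, of Suc] by (simp add: vimage_def)

lemma Sum_any_nested_swap:
  fixes g :: "'i \<Rightarrow> 'j \<Rightarrow> 'a::comm_monoid_add"
  assumes "finite A" "finite B" "\<And>i j. g i j \<noteq> 0 \<Longrightarrow> i \<in> A \<and> j \<in> B"
  shows "Sum_any (\<lambda>i. Sum_any (g i)) = Sum_any (\<lambda>j. Sum_any (\<lambda>i. g i j))"
    and "Sum_any (\<lambda>i. Sum_any (g i)) = Sum_any (\<lambda>(i, j). g i j)"
proof -
  have "{i. \<exists>j. g i j \<noteq> 0} \<times> {j. \<exists>i. g i j \<noteq> 0} \<subseteq> A \<times> B"
    using assms(3) by blast
  moreover have "finite (A \<times> B)"
    using assms(1,2) by simp
  ultimately show "Sum_any (\<lambda>i. Sum_any (g i)) = Sum_any (\<lambda>j. Sum_any (\<lambda>i. g i j))"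
    "Sum_any (\<lambda>i. Sum_any (g i)) = Sum_any (\<lambda>(i, j). g i j)"
    using Sum_any.swap[of "A \<times> B" g] Sum_any.cartesian_product[of "A \<times> B" g] by blast+
qed

lemma finite_shift:
  assumes "finite {j. p j \<noteq> 0}"
  shows "finite {j::int. p (j + 1) \<noteq> 0}"
proof -
  have "{j. p (j + 1) \<noteq> 0} = (\<lambda>j. j - 1) ` {j. p j \<noteq> 0}"
    by (force simp: image_iff intro: exI[of _ "_ + 1"])
  then show ?thesis
    using assms by simp
qed

lemma finite_support_add:
  fixes p q :: "'i \<Rightarrow> 'x::monoid_add"
  shows "finite {j. p j \<noteq> 0} \<Longrightarrow> finite {j. q j \<noteq> 0} \<Longrightarrow> finite {j. (p + q) j \<noteq> 0}"
  by (rule finite_subset[of _ "{j. p j \<noteq> 0} \<union> {j. q j \<noteq> 0}"]) auto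

section \<open>Coefficients of the delta functions in z\<close>

locale voa_module_pair = voa V + m1: voa_module V M1 + m2: voa_module V M2
  for V :: "'v::ab_group_add voa" and M1 :: "('v, 'a::ab_group_add) vact" and M2 :: "('v, 'b::ab_group_add) vact" +
  fixes z :: complex
  assumes z_nonzero: "z \<noteq> 0"
begin

text \<open>\<open>e1\<close>, \<open>e2\<close> and \<open>e3\<close> are the values of the three
  delta functions along the rays that support them. The fixed exponent is that of x_0 in
  \<open>e1\<close> and \<open>e3\<close>, and that of y in \<open>e2\<close>.\<close>

definition e1 :: "int \<Rightarrow> nat \<Rightarrow> complex" where
  "e1 c i = jacobi_coeff c i * z ^ i"

definition e2 :: "int \<Rightarrow> nat \<Rightarrow> complex" where
  "e2 a i = (of_int (- a - 1) gchoose i) * z powi (- 1 - a - int i)"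

definition e3 :: "int \<Rightarrow> nat \<Rightarrow> complex" where
  "e3 c i = (-1) powi (c + 1) * jacobi_coeff c i * z powi (- 1 - c - int i)"

lemma delta_y_z_x0_eq: "delta_y_z_x0 z (- 1 - c - int i) c = e1 c i"
proof -
  have "- 1 - (- 1 - c - int i) - c = int i"
    by simp
  then show ?thesis
    unfolding delta_y_z_x0_def e1_def by (simp only: delta3_eq_jacobi_coeff power_int_of_nat)
qed

lemma delta_y_z_x0_outside:
  assumes "a \<notin> range (\<lambda>i. - 1 - c - int i)"
  shows "delta_y_z_x0 z a c = 0"
proof -
  have "delta3 a (- 1 - a - c) c = 0"
    by (rule delta3_eq_0) (use assms in \<open>fastforce simp: image_iff\<close>)
  then show ?thesis
    by (simp add: delta_y_z_x0_def)
qed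

lemma delta_y_x0_z_eq: "delta_y_x0_z z a (int i) = e2 a i"
proof -
  have "delta3 a (int i) (- 1 - a - int i) = (of_int (- a - 1) gchoose i)"
    using delta3_eq_gbinomial[of a i] by (simp only: minus_diff_commute)
  then show ?thesis
    by (simp only: delta_y_x0_z_def e2_def)
qed

lemma delta_y_x0_z_outside: "c \<notin> range int \<Longrightarrow> delta_y_x0_z z a c = 0"
  unfolding delta_y_x0_z_def by (subst delta3_eq_0) auto

lemma delta_z_y_x0_eq: "delta_z_y_x0 z (int i) c = e3 c i"
proof -
  have "- 1 - int i - c = - 1 - c - int i"
    by simp
  then show ?thesis
    by (simp only: delta_z_y_x0_def e3_def delta3_eq_jacobi_coeff)
qed

lemma delta_z_y_x0_outside: "a \<notin> range int \<Longrightarrow> delta_z_y_x0 z a c = 0"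
  unfolding delta_z_y_x0_def by (subst delta3_eq_0) auto

lemma jacobi_coeff_0 [simp]: "jacobi_coeff c 0 = 1"
  by (simp add: jacobi_coeff_def)

lemma jacobi_coeff_rec: "jacobi_coeff (c - 1) (Suc i) = jacobi_coeff c (Suc i) - jacobi_coeff c i"
proof -
  have "of_int (- 1 - (c - 1)) = of_int (- 1 - c) + (1 :: complex)"
    by simp
  then have "(of_int (- 1 - (c - 1)) gchoose Suc i :: complex)
      = (of_int (- 1 - c) gchoose i) + (of_int (- 1 - c) gchoose Suc i)"
    by (simp only: gbinomial_Suc_Suc)
  then show ?thesis
    unfolding jacobi_coeff_def by (simp only: power_Suc) (simp add: algebra_simps)
qed

lemma e1_minus_1: "e1 (- 1) i = (if i = 0 then 1 else 0)"
  by (cases i) (auto simp: e1_def jacobi_coeff_def)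

text \<open>Multiplying the second delta function by y is the same as multiplying it by z + x_0.
  Likewise \<open>e3_rec\<close> expresses x_0 = y - z on the third one; both rest on Pascal's
  rule.\<close>

lemma e2_rec: "e2 (a - 1) 0 = z * e2 a 0" "e2 (a - 1) (Suc i) = z * e2 a (Suc i) + e2 a i"
proof -
  have z1: "z * z powi k = z powi (k + 1)" for k
    using z_nonzero by (simp add: power_int_add)
  show "e2 (a - 1) 0 = z * e2 a 0"
    using z1[of "- 1 - a"] by (simp add: e2_def)
  have "(of_int (- (a - 1) - 1) gchoose Suc i) = ((of_int (- a - 1) + 1) gchoose Suc i :: complex)"
    by simp
  also have "\<dots> = (of_int (- a - 1) gchoose i) + (of_int (- a - 1) gchoose Suc i)"
    by (rule gbinomial_Suc_Suc)
  finally have g: "(of_int (- (a - 1) - 1) gchoose Suc i)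
      = (of_int (- a - 1) gchoose i) + (of_int (- a - 1) gchoose Suc i :: complex)" .
  have "z * e2 a (Suc i) = (of_int (- a - 1) gchoose Suc i) * (z * z powi (- 1 - a - int (Suc i)))"
    by (simp add: e2_def)
  also have "\<dots> = (of_int (- a - 1) gchoose Suc i) * z powi (- 1 - a - int i)"
  proof -
    have "- 1 - a - int (Suc i) + 1 = - 1 - a - int i"
      by simp
    then show ?thesis
      by (simp only: z1)
  qed
  finally have eq: "z * e2 a (Suc i) = (of_int (- a - 1) gchoose Suc i) * z powi (- 1 - a - int i)" .
  have "- 1 - (a - 1) - int (Suc i) = - 1 - a - int i"
    by simp
  then show "e2 (a - 1) (Suc i) = z * e2 a (Suc i) + e2 a i"
    unfolding eq unfolding e2_def g by (simp only: distrib_right add.commute)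
qed

lemma e3_rec: "e3 (c - 1) 0 = - (z * e3 c 0)" "e3 (c - 1) (Suc i) = e3 c i - z * e3 c (Suc i)"
proof -
  have z1: "z * z powi k = z powi (k + 1)" for k
    using z_nonzero by (simp add: power_int_add)
  have s: "(-1) powi (c + 1) = - ((-1) powi c :: complex)"
    by (simp add: power_int_add)
  show "e3 (c - 1) 0 = - (z * e3 c 0)"
    using z1[of "- 1 - c"] by (simp add: e3_def s)
  have "z * e3 c (Suc i) = (-1) powi (c + 1) * jacobi_coeff c (Suc i) * (z * z powi (- 1 - c - int (Suc i)))"
    by (simp add: e3_def)
  also have "\<dots> = (-1) powi (c + 1) * jacobi_coeff c (Suc i) * z powi (- 1 - c - int i)"
  proof -
    have "- 1 - c - int (Suc i) + 1 = - 1 - c - int i"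
      by simp
    then show ?thesis
      by (simp only: z1)
  qed
  finally have eq: "z * e3 c (Suc i) = - ((-1) powi c) * jacobi_coeff c (Suc i) * z powi (- 1 - c - int i)"
    by (simp only: s)
  have "- 1 - (c - 1) - int (Suc i) = - 1 - c - int i"
    by simp
  then have "e3 (c - 1) (Suc i) = (-1) powi c * (jacobi_coeff c (Suc i) - jacobi_coeff c i) * z powi (- 1 - c - int i)"
    by (simp only: e3_def jacobi_coeff_rec diff_add_cancel)
  also have "\<dots> = e3 c i - z * e3 c (Suc i)"
    unfolding eq unfolding e3_def s by (simp only: left_diff_distrib right_diff_distrib) simp
  finally show "e3 (c - 1) (Suc i) = e3 c i - z * e3 c (Suc i)" .
qed

section \<open>Forms on the tensor product and the prescribed values of \<open>tau\<close>\<close>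

abbreviation "TD \<equiv> tensor_dual M1 M2"

lemma TD_linear:
  assumes "l \<in> TD"
  shows TD_add_left: "l (x + x') y = l x y + l x' y"
    and TD_add_right: "l x (y + y') = l x y + l x y'"
    and TD_scale_left: "l (scl M1 c x) y = c * l x y"
    and TD_scale_right: "l x (scl M2 c y) = c * l x y"
  using assms by (auto simp: tensor_dual_def bilinear_map_def linear_on_def)

lemma TD_0 [simp]: "l \<in> TD \<Longrightarrow> l 0 y = 0" "l \<in> TD \<Longrightarrow> l x 0 = 0"
  using TD_scale_left[of l 0 0 y] TD_scale_right[of l x 0 0] by auto

lemma TD_Sum_any_right:
  assumes "l \<in> TD" "finite {i. g i \<noteq> 0}"
  shows "l x (Sum_any g) = Sum_any (\<lambda>i. l x (g i))"
proof -
  have "linear_on (scl M2) UNIV (*) (l x)"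
    using assms(1) by (simp add: tensor_dual_def bilinear_map_def)
  from linear_on_Sum_any[OF this _ m2.vs.vector_space_axioms _ assms(2)] show ?thesis
    by simp
qed

lemma vector_space_tensor_dual: "vector_space tensor_dual_scl"
  by unfold_locales (auto simp: fun_eq_iff tensor_dual_scl_def algebra_simps)

sublocale td: vector_space tensor_dual_scl
  by (rule vector_space_tensor_dual)

lemma subspace_TD: "td.subspace TD"
proof (rule td.subspaceI)
  show "0 \<in> TD"
    by (simp add: tensor_dual_def bilinear_map_def linear_on_def)
  show "l + l' \<in> TD" if "l \<in> TD" "l' \<in> TD" for l l'
    using TD_linear[OF that(1)] TD_linear[OF that(2)]
    by (simp add: tensor_dual_def bilinear_map_def linear_on_def algebra_simps)
  show "tensor_dual_scl c l \<in> TD" if "l \<in> TD" for c l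
    using TD_linear[OF that]
    by (simp add: tensor_dual_def bilinear_map_def linear_on_def algebra_simps tensor_dual_scl_def)
qed

text \<open>The right-hand side of the defining identity of an intertwining map, evaluated at \<open>l\<close>: the
  coefficient of \<open>x\<^sub>1\<^sup>a x\<^sub>0\<^sup>c\<close> in
  \<open>z\<^sup>-\<^sup>1 \<delta>((x\<^sub>1 - x\<^sub>0)/z) l(Y(u,x\<^sub>0)w\<^sub>1, w\<^sub>2) + x\<^sub>0\<^sup>-\<^sup>1 \<delta>((z - x\<^sub>1)/(-x\<^sub>0)) l(w\<^sub>1, Y(u,x\<^sub>1)w\<^sub>2)\<close>.\<close>

definition inner :: "('a \<Rightarrow> 'b \<Rightarrow> complex) \<Rightarrow> 'v \<Rightarrow> int \<Rightarrow> int \<Rightarrow> 'a \<Rightarrow> 'b \<Rightarrow> complex" where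
  "inner l u a c w1 w2 = Sum_any (\<lambda>i. e2 a i * l (vop M1 u (c - int i) w1) w2)
     + Sum_any (\<lambda>i. e3 c i * l w1 (vop M2 u (a - int i) w2))"

lemma finite_inner:
  assumes "l \<in> TD"
  shows finite_inner1: "finite {i. t i * l (vop M1 u (c - int i) w1) w2 \<noteq> 0}"
    and finite_inner2: "finite {i. t i * l w1 (vop M2 u (a - int i) w2) \<noteq> 0}"
proof -
  obtain N where N: "\<forall>k<N. vop M1 u k w1 = 0"
    by (rule m1.vop_trunc)
  show "finite {i. t i * l (vop M1 u (c - int i) w1) w2 \<noteq> 0}"
    by (rule finite_support_natI[of "nat (c - N + 1)"]) (use N assms in auto)
  obtain N where N: "\<forall>k<N. vop M2 u k w2 = 0"
    by (rule m2.vop_trunc)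
  show "finite {i. t i * l w1 (vop M2 u (a - int i) w2) \<noteq> 0}"
    by (rule finite_support_natI[of "nat (a - N + 1)"]) (use N assms in auto)
qed

lemma inner_add_vector:
  assumes "l \<in> TD"
  shows "inner l (u + v) a c w1 w2 = inner l u a c w1 w2 + inner l v a c w1 w2"
  unfolding inner_def
  by (simp only: m1.vop_add_left m2.vop_add_left TD_add_left[OF assms] TD_add_right[OF assms] distrib_left
      Sum_any.distrib[OF finite_inner1[OF assms] finite_inner1[OF assms]]
      Sum_any.distrib[OF finite_inner2[OF assms] finite_inner2[OF assms]] add_ac)

lemma inner_scale_vector:
  assumes "l \<in> TD"
  shows "inner l (sV t u) a c w1 w2 = t * inner l u a c w1 w2"
  unfolding inner_def distrib_left Sum_any_right_distrib[OF finite_inner1[OF assms]]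
    Sum_any_right_distrib[OF finite_inner2[OF assms]]
  by (simp add: m1.vop_scale_left m2.vop_scale_left TD_scale_left[OF assms] TD_scale_right[OF assms] mult.left_commute)

lemma inner_0_vector [simp]: "l \<in> TD \<Longrightarrow> inner l 0 a c w1 w2 = 0"
  by (simp add: inner_def)

lemma inner_add:
  assumes "l \<in> TD" "l' \<in> TD"
  shows "inner (l + l') u a c w1 w2 = inner l u a c w1 w2 + inner l' u a c w1 w2"
  unfolding inner_def
  by (simp only: plus_fun_apply distrib_left Sum_any.distrib[OF finite_inner1[OF assms(1)] finite_inner1[OF assms(2)]]
      Sum_any.distrib[OF finite_inner2[OF assms(1)] finite_inner2[OF assms(2)]] add_ac)

lemma inner_scale:
  assumes "l \<in> TD"
  shows "inner (tensor_dual_scl t l) u a c w1 w2 = t * inner l u a c w1 w2"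
  unfolding inner_def distrib_left Sum_any_right_distrib[OF finite_inner1[OF assms]]
    Sum_any_right_distrib[OF finite_inner2[OF assms]]
  by (simp add: tensor_dual_scl_def mult.left_commute)

text \<open>Multiplication of both sides by \<open>x\<^sub>0 = x\<^sub>1 - z\<close>.\<close>

lemma inner_rec:
  assumes l: "l \<in> TD"
  shows "inner l u a (c - 1) w1 w2 = inner l u (a - 1) c w1 w2 - z * inner l u a c w1 w2"
proof -
  note fin1 = finite_inner1[OF l] and fin2 = finite_inner2[OF l]
  define X where "X i = l (vop M1 u (c - int i) w1) w2" for i
  define Y where "Y i = l w1 (vop M2 u (a - int i) w2)" for i
  have finX: "finite {i. t i * X i \<noteq> 0}" and finY: "finite {i. t i * Y i \<noteq> 0}" for t
    unfolding X_def Y_def by (rule fin1 fin2)+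
  have XS: "l (vop M1 u (c - 1 - int i) w1) w2 = X (Suc i)" and YS: "l w1 (vop M2 u (a - 1 - int i) w2) = Y (Suc i)" for i
    by (simp_all add: X_def Y_def algebra_simps)
  have finXS: "finite {i. t i * X (Suc i) \<noteq> 0}" and finYS: "finite {i. t i * Y (Suc i) \<noteq> 0}" for t
    using finite_support_Suc[OF finX[of "\<lambda>i. t (i - 1)"]] finite_support_Suc[OF finY[of "\<lambda>i. t (i - 1)"]] by simp_all
  have 1: "Sum_any (\<lambda>i. e2 a i * X (Suc i)) = Sum_any (\<lambda>i. e2 (a - 1) i * X i) - z * Sum_any (\<lambda>i. e2 a i * X i)"
  proof -
    have "Sum_any (\<lambda>i. e2 (a - 1) (Suc i) * X (Suc i))
        = Sum_any (\<lambda>i. z * e2 a (Suc i) * X (Suc i)) + Sum_any (\<lambda>i. e2 a i * X (Suc i))"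
      by (simp only: e2_rec distrib_right Sum_any.distrib[OF finXS finXS])
    then show ?thesis
      unfolding Sum_any_right_distrib[OF finX] mult.assoc[symmetric]
      by (simp add: Sum_any_Suc[OF finX[of "e2 (a - 1)"]] Sum_any_Suc[OF finX[of "\<lambda>i. z * e2 a i"]] e2_rec(1))
  qed
  have 2: "Sum_any (\<lambda>i. e3 (c - 1) i * Y i) = Sum_any (\<lambda>i. e3 c i * Y (Suc i)) - z * Sum_any (\<lambda>i. e3 c i * Y i)"
  proof -
    have "Sum_any (\<lambda>i. e3 (c - 1) (Suc i) * Y (Suc i))
        = Sum_any (\<lambda>i. e3 c i * Y (Suc i)) - Sum_any (\<lambda>i. z * e3 c (Suc i) * Y (Suc i))"
      by (simp only: e3_rec left_diff_distrib Sum_any_diff[OF finYS finYS])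
    then show ?thesis
      unfolding Sum_any_right_distrib[OF finY] mult.assoc[symmetric]
      by (simp add: Sum_any_Suc[OF finY[of "e3 (c - 1)"]] Sum_any_Suc[OF finY[of "\<lambda>i. z * e3 c i"]] e3_rec(1))
  qed
  show ?thesis
    unfolding inner_def XS YS X_def[symmetric] Y_def[symmetric] 1 2 by (simp add: algebra_simps)
qed

text \<open>The delta functions in \<open>tau\<close> contain y = x_1^{-1}. The coefficient of x_1^j
  in \<open>theta\<close> therefore leaves the exponent j - a for y, and both sides of the
  correspondence can be phrased through the same \<open>inner\<close>.\<close>

lemma tau_rhs_eq_inner:
  assumes l: "l \<in> TD"
  shows "tau_rhs V z M1 M2 v a c l w1 w2 = Sum_any (\<lambda>j. inner l (theta V v j) (j - a) c w1 w2)"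
proof -
  let ?J = "{j. theta V v j \<noteq> 0}"
  obtain Q1 where Q1: "\<forall>i\<ge>Q1. \<forall>j\<in>?J. vop M1 (theta V v j) (c - int i) w1 = 0"
    using m1.vop_trunc_finite[OF theta_finite[of v], of "theta V v" "\<lambda>j. c" w1] by blast
  obtain Q2 where Q2: "\<forall>i\<ge>Q2. \<forall>j\<in>?J. vop M2 (theta V v j) (j - a - int i) w2 = 0"
    using m2.vop_trunc_finite[OF theta_finite[of v], of "theta V v" "\<lambda>j. j - a" w2] by blast
  let ?f = "\<lambda>j i. e2 (j - a) i * l (vop M1 (theta V v j) (c - int i) w1) w2"
  let ?g = "\<lambda>j i. e3 c i * l w1 (vop M2 (theta V v j) (j - a - int i) w2)"
  have f: "j \<in> ?J \<and> i \<in> {..<Q1}" if "?f j i \<noteq> 0" for j i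
    using that Q1 l by (cases "theta V v j = 0"; cases "Q1 \<le> i") auto
  have g: "j \<in> ?J \<and> i \<in> {..<Q2}" if "?g j i \<noteq> 0" for j i
    using that Q2 l by (cases "theta V v j = 0"; cases "Q2 \<le> i") auto
  have "Sum_any (\<lambda>(a', c'). delta_y_x0_z z (- a') c' * l (vop M1 (theta V v (a - a')) (c - c') w1) w2)
      = Sum_any (\<lambda>p. case (case p of (j, i) \<Rightarrow> (a - j, int i)) of (a', c') \<Rightarrow>
          delta_y_x0_z z (- a') c' * l (vop M1 (theta V v (a - a')) (c - c') w1) w2)"
  proof (rule Sum_any_reindex_inj)
    fix p assume nin: "p \<notin> range (\<lambda>p. case p of (j, i) \<Rightarrow> (a - j, int i))"
    obtain a' c' where p: "p = (a', c')"
      by (cases p)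
    have "c' \<noteq> int i" for i
      using nin rangeI[of "\<lambda>p. case p of (j, i) \<Rightarrow> (a - j, int i)" "(a - a', i)"] by (auto simp: p)
    then show "(case p of (a', c') \<Rightarrow> delta_y_x0_z z (- a') c' * l (vop M1 (theta V v (a - a')) (c - c') w1) w2) = 0"
      by (simp add: p delta_y_x0_z_outside image_iff)
  qed (auto simp: inj_def)
  also have "\<dots> = Sum_any (\<lambda>(j, i). ?f j i)"
    by (rule arg_cong[where f = Sum_any]) (auto simp: fun_eq_iff delta_y_x0_z_eq)
  also have "\<dots> = Sum_any (\<lambda>j. Sum_any (?f j))"
    by (rule Sum_any_nested_swap(2)[OF theta_finite[of v] finite_lessThan[of Q1] f, symmetric])
  finally have 1: "Sum_any (\<lambda>(a', c'). delta_y_x0_z z (- a') c' * l (vop M1 (theta V v (a - a')) (c - c') w1) w2)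
      = Sum_any (\<lambda>j. Sum_any (?f j))" .
  have "Sum_any (\<lambda>a'. delta_z_y_x0 z (- a') c * l w1 (vop_star V M2 v (a - a') w2))
      = Sum_any (\<lambda>i. delta_z_y_x0 z (- (- int i)) c * l w1 (vop_star V M2 v (a - - int i) w2))"
  proof (rule Sum_any_reindex_inj)
    fix a' assume "a' \<notin> range (\<lambda>i. - int i)"
    then have "- a' \<notin> range int"
      by (auto simp: image_iff minus_equation_iff[of a'])
    then show "delta_z_y_x0 z (- a') c * l w1 (vop_star V M2 v (a - a') w2) = 0"
      by (simp add: delta_z_y_x0_outside)
  qed (simp add: inj_def)
  also have "\<dots> = Sum_any (\<lambda>i. Sum_any (\<lambda>j. ?g j i))"
  proof (rule Sum_any.cong)
    fix i
    have "l w1 (vop_star V M2 v (a + int i) w2) = Sum_any (\<lambda>j. l w1 (vop M2 (theta V v j) (j - (a + int i)) w2))"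
      unfolding vop_star_def by (rule TD_Sum_any_right[OF l m2.finite_star_summands])
    moreover have "finite {j. l w1 (vop M2 (theta V v j) (j - (a + int i)) w2) \<noteq> 0}"
      by (rule finite_subset[OF _ theta_finite[of v]]) (use l in auto)
    ultimately show "delta_z_y_x0 z (- (- int i)) c * l w1 (vop_star V M2 v (a - - int i) w2) = Sum_any (\<lambda>j. ?g j i)"
      by (simp add: delta_z_y_x0_eq Sum_any_right_distrib algebra_simps)
  qed
  also have "\<dots> = Sum_any (\<lambda>j. Sum_any (?g j))"
    by (rule Sum_any_nested_swap(1)[OF theta_finite[of v] finite_lessThan[of Q2] g, symmetric])
  finally have 2: "Sum_any (\<lambda>a'. delta_z_y_x0 z (- a') c * l w1 (vop_star V M2 v (a - a') w2))
      = Sum_any (\<lambda>j. Sum_any (?g j))" .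
  have fin: "finite {j. Sum_any (?f j) \<noteq> 0}" "finite {j. Sum_any (?g j) \<noteq> 0}"
    by (rule finite_subset[OF _ theta_finite[of v]], use l in auto)+
  show ?thesis
    unfolding tau_rhs_def 1 2 inner_def Sum_any.distrib[OF fin, symmetric] ..
qed

lemma finite_inner_theta: "l \<in> TD \<Longrightarrow> finite {j. inner l (theta V v j) (f j) c w1 w2 \<noteq> 0}"
  by (rule finite_subset[OF _ theta_finite[of v]]) auto

lemma tau_rhs_add_vector: "l \<in> TD \<Longrightarrow> tau_rhs V z M1 M2 (u + v) a c l = tau_rhs V z M1 M2 u a c l + tau_rhs V z M1 M2 v a c l"
  by (intro ext) (simp add: tau_rhs_eq_inner theta_add inner_add_vector Sum_any.distrib finite_inner_theta)

lemma tau_rhs_scale_vector: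
  "l \<in> TD \<Longrightarrow> tau_rhs V z M1 M2 (sV t v) a c l = tensor_dual_scl t (tau_rhs V z M1 M2 v a c l)"
  by (intro ext) (simp add: tau_rhs_eq_inner theta_scale inner_scale_vector Sum_any_right_distrib finite_inner_theta
      tensor_dual_scl_def)

lemma tau_rhs_add:
  assumes "l \<in> TD" "l' \<in> TD"
  shows "tau_rhs V z M1 M2 v a c (l + l') = tau_rhs V z M1 M2 v a c l + tau_rhs V z M1 M2 v a c l'"
  using td.subspace_add[OF subspace_TD assms] assms
  by (intro ext) (simp add: tau_rhs_eq_inner inner_add Sum_any.distrib finite_inner_theta)

lemma tau_rhs_scale:
  assumes "l \<in> TD"
  shows "tau_rhs V z M1 M2 v a c (tensor_dual_scl t l) = tensor_dual_scl t (tau_rhs V z M1 M2 v a c l)"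
  using td.subspace_scale[OF subspace_TD assms, of t] assms
  by (intro ext) (simp add: tau_rhs_eq_inner inner_scale Sum_any_right_distrib finite_inner_theta tensor_dual_scl_def)

text \<open>Since y is the inverse of x_1, the shift in \<open>a\<close> is opposite to that in
  \<open>inner_rec\<close>.\<close>

lemma tau_rhs_rec:
  assumes "l \<in> TD"
  shows "tau_rhs V z M1 M2 v a (c - 1) l
    = tau_rhs V z M1 M2 v (a + 1) c l - tensor_dual_scl z (tau_rhs V z M1 M2 v a c l)"
proof (intro ext)
  fix w1 w2
  have "finite {j. z * inner l (theta V v j) (j - a) c w1 w2 \<noteq> 0}"
    using finite_inner_theta[OF assms] by (rule rev_finite_subset) auto
  then show "tau_rhs V z M1 M2 v a (c - 1) l w1 w2
    = (tau_rhs V z M1 M2 v (a + 1) c l - tensor_dual_scl z (tau_rhs V z M1 M2 v a c l)) w1 w2"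
    using assms by (simp add: tau_rhs_eq_inner tensor_dual_scl_def inner_rec Sum_any_right_distrib
        finite_inner_theta Sum_any_diff diff_diff_eq)
qed

section \<open>Existence of \<open>tau\<close>\<close>

abbreviation "TR \<equiv> tau_rhs V z M1 M2"
abbreviation "tact \<equiv> tensor_dual_act V z M1 M2"

text \<open>Multiplication by \<open>t\<^sup>-\<^sup>1 - z\<close>. Every element of the domain of \<open>\<tau>\<close> becomes a Laurent polynomial
  after finitely many of these multiplications.\<close>

definition mult_pole :: "(int \<Rightarrow> 'v) \<Rightarrow> int \<Rightarrow> 'v" where
  "mult_pole \<xi> = (\<lambda>j. \<xi> (j + 1) - sV z (\<xi> j))"

text \<open>The coefficient of t^j corresponds to x_1-exponent -j - 1, so this is the value
  prescribed at the product of the Laurent polynomial \<open>p\<close> with (t^{-1} - z)^{-c-1}. For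
  \<open>c = -1\<close> it is the value at \<open>p\<close> itself.\<close>

definition tau_poly :: "(int \<Rightarrow> 'v) \<Rightarrow> int \<Rightarrow> ('a \<Rightarrow> 'b \<Rightarrow> complex) \<Rightarrow> 'a \<Rightarrow> 'b \<Rightarrow> complex" where
  "tau_poly p c l = Sum_any (\<lambda>j. TR (p j) (- j - 1) c l)"

lemma TR_0 [simp]: "l \<in> TD \<Longrightarrow> TR 0 a c l = 0"
  using tau_rhs_scale_vector[of l 0 0 a c] by simp

lemma TR_diff_scale: "l \<in> TD \<Longrightarrow> TR (u - sV t v) a c l = TR u a c l - tensor_dual_scl t (TR v a c l)"
  using tau_rhs_add_vector[of l u "sV (- t) v" a c] tau_rhs_scale_vector[of l "- t" v a c] by simp

lemma finite_mult_pole: "finite {j. p j \<noteq> 0} \<Longrightarrow> finite {j. mult_pole p j \<noteq> 0}"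
  by (rule finite_subset[of _ "{j. p (j + 1) \<noteq> 0} \<union> {j. p j \<noteq> 0}"])
    (auto simp: mult_pole_def finite_shift)

lemma finite_mult_pole_pow: "finite {j. p j \<noteq> 0} \<Longrightarrow> finite {j. (mult_pole ^^ k) p j \<noteq> 0}"
  by (induction k) (auto simp: finite_mult_pole)

text \<open>A factor t^{-1} - z may be moved from the polynomial into the exponent. This is what
  makes \<open>tau_witness\<close> independent of the number of multiplications.\<close>

lemma tau_poly_mult_pole:
  assumes p: "finite {j. p j \<noteq> 0}" and l: "l \<in> TD"
  shows "tau_poly (mult_pole p) c l = tau_poly p (c - 1) l"
proof -
  have fin1: "finite {j. TR (p (j + 1)) (- j - 1) c l \<noteq> 0}"
    by (rule finite_subset[OF _ finite_shift[OF p]]) (use l in auto)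
  have fin1': "finite {j. TR (p j) (- j - 1 + 1) c l \<noteq> 0}"
    by (rule finite_subset[OF _ p]) (use l in auto)
  have fin2: "finite {j. tensor_dual_scl z (TR (p j) (- j - 1) c l) \<noteq> 0}"
    by (rule finite_subset[OF _ p]) (use l in auto)
  have "tau_poly (mult_pole p) c l
      = Sum_any (\<lambda>j. TR (p (j + 1)) (- j - 1) c l - tensor_dual_scl z (TR (p j) (- j - 1) c l))"
    unfolding tau_poly_def mult_pole_def using TR_diff_scale[OF l] by simp
  also have "\<dots> = Sum_any (\<lambda>j. TR (p (j + 1)) (- j - 1) c l) - Sum_any (\<lambda>j. tensor_dual_scl z (TR (p j) (- j - 1) c l))"
    by (rule Sum_any_diff[OF fin1 fin2])
  also have "Sum_any (\<lambda>j. TR (p (j + 1)) (- j - 1) c l) = Sum_any (\<lambda>j. TR (p (j - 1 + 1)) (- (j - 1) - 1) c l)"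
  proof (rule Sum_any_reindex_inj)
    show "TR (p (j + 1)) (- j - 1) c l = 0" if "j \<notin> range (\<lambda>j. j - 1)" for j
      using that rangeI[of "\<lambda>j. j - 1" "j + 1"] by simp
  qed (simp add: inj_def)
  also have "\<dots> = Sum_any (\<lambda>j. TR (p j) (- j - 1 + 1) c l)"
    by simp
  also have "\<dots> - Sum_any (\<lambda>j. tensor_dual_scl z (TR (p j) (- j - 1) c l)) = tau_poly p (c - 1) l"
    unfolding tau_poly_def tau_rhs_rec[OF l] by (rule Sum_any_diff[OF fin1' fin2, symmetric])
  finally show ?thesis .
qed

lemma tau_poly_mult_pole_pow:
  assumes p: "finite {j. p j \<noteq> 0}" and l: "l \<in> TD"
  shows "tau_poly ((mult_pole ^^ k) p) (c + int k) l = tau_poly p c l"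
proof (induction k)
  case (Suc k)
  have "tau_poly (mult_pole ((mult_pole ^^ k) p)) (c + int (Suc k)) l = tau_poly ((mult_pole ^^ k) p) (c + int (Suc k) - 1) l"
    by (rule tau_poly_mult_pole[OF finite_mult_pole_pow[OF p] l])
  also have "c + int (Suc k) - 1 = c + int k"
    by simp
  finally show ?case
    by (simp add: Suc.IH)
qed simp

lemma tau_poly_Yt:
  assumes "l \<in> TD"
  shows "tau_poly (Yt v a) c l = TR v a c l"
  unfolding tau_poly_def by (subst Sum_any_single[of "- a - 1"]) (auto simp: Yt_def assms)

lemma finite_Yt: "finite {j. Yt v a j \<noteq> 0}"
  by (rule finite_subset[of _ "{- a - 1}"]) (auto simp: Yt_def)

lemma tau_gen_eq: "tau_gen V z v a c j = sV (delta_y_z_x0 z (- (j + a + 1)) c) v"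
  unfolding tau_gen_def by (subst Sum_any_single[of "j + a + 1"]) (auto simp: Yt_def)

text \<open>Multiplication of the first delta function by x_0 = y - z. At the boundary exponent
  \<open>m = - c\<close> only the shifted term lies on the supporting ray.\<close>

lemma delta_y_z_x0_rec: "delta_y_z_x0 z (m - 1) c - z * delta_y_z_x0 z m c = delta_y_z_x0 z m (c - 1)"
proof -
  consider i where "m = - 1 - c - int i" | "m = - c" | "m > - c"
  proof -
    assume *: "\<And>i. m = - 1 - c - int i \<Longrightarrow> thesis" "m = - c \<Longrightarrow> thesis" "m > - c \<Longrightarrow> thesis"
    show thesis
    proof (cases "m < - c")
      case True
      then have "m = - 1 - c - int (nat (- 1 - c - m))"
        by simp
      then show ?thesis
        by (rule *(1))
    qed (use * in force)
  qed
  then show ?thesis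
  proof cases
    case 1
    have "m - 1 = - 1 - c - int (Suc i)" "m = - 1 - (c - 1) - int (Suc i)"
      using 1 by simp_all
    then have "delta_y_z_x0 z (m - 1) c = e1 c (Suc i)" "delta_y_z_x0 z m (c - 1) = e1 (c - 1) (Suc i)"
      using delta_y_z_x0_eq by metis+
    moreover have "delta_y_z_x0 z m c = e1 c i"
      unfolding 1 by (rule delta_y_z_x0_eq)
    ultimately show ?thesis
      by (simp add: e1_def jacobi_coeff_rec algebra_simps)
  next
    case 2
    have "m - 1 = - 1 - c - int 0" "m = - 1 - (c - 1) - int 0"
      using 2 by simp_all
    then have "delta_y_z_x0 z (m - 1) c = e1 c 0" "delta_y_z_x0 z m (c - 1) = e1 (c - 1) 0"
      using delta_y_z_x0_eq by metis+
    moreover have "delta_y_z_x0 z m c = 0"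
      by (rule delta_y_z_x0_outside) (use 2 in auto)
    ultimately show ?thesis
      by (simp add: e1_def)
  next
    case 3
    then have "delta_y_z_x0 z (m - 1) c = 0" "delta_y_z_x0 z m c = 0" "delta_y_z_x0 z m (c - 1) = 0"
      by (intro delta_y_z_x0_outside; auto)+
    then show ?thesis by simp
  qed
qed

lemma mult_pole_tau_gen: "mult_pole (tau_gen V z v a c) = tau_gen V z v a (c - 1)"
proof
  fix j
  have *: "- (j + 1 + a + 1) = - (j + a + 1) - 1"
    by simp
  show "mult_pole (tau_gen V z v a c) j = tau_gen V z v a (c - 1) j"
    unfolding mult_pole_def tau_gen_eq * delta_y_z_x0_rec[symmetric]
    by (simp add: reg.vs.scale_left_diff_distrib)
qed

lemma mult_pole_pow_tau_gen: "(mult_pole ^^ k) (tau_gen V z v a c) = tau_gen V z v a (c - int k)"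
  by (induction k) (auto simp: mult_pole_tau_gen algebra_simps)

lemma tau_gen_Yt: "tau_gen V z v a (- 1) = Yt v a"
proof
  fix j
  show "tau_gen V z v a (- 1) j = Yt v a j"
  proof (cases "j = - a - 1")
    case True
    then show ?thesis
      using delta_y_z_x0_eq[of "- 1" 0] by (simp add: tau_gen_eq Yt_def e1_minus_1)
  next
    case False
    have "delta_y_z_x0 z (- (j + a + 1)) (- 1) = 0"
    proof (cases "- (j + a + 1) \<in> range (\<lambda>i. - 1 - (- 1) - int i)")
      case True
      then obtain i where i: "- (j + a + 1) = - 1 - (- 1) - int i"
        by blast
      then have "i \<noteq> 0"
        using False by auto
      then show ?thesis
        unfolding i delta_y_z_x0_eq by (simp add: e1_minus_1)
    qed (rule delta_y_z_x0_outside)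
    then show ?thesis
      using False by (simp add: tau_gen_eq Yt_def)
  qed
qed

text \<open>The poles are cleared by \<open>N\<close> multiplications, and the factors are divided
  out again through the exponent: -1 means no factor, and each multiplication adds one, hence
  \<open>int N - 1\<close>.\<close>

definition tau_witness :: "(int \<Rightarrow> 'v) \<Rightarrow> ('a \<Rightarrow> 'b \<Rightarrow> complex) \<Rightarrow> 'a \<Rightarrow> 'b \<Rightarrow> complex" where
  "tau_witness \<xi> l = (let N = SOME N. finite {j. (mult_pole ^^ N) \<xi> j \<noteq> 0}
     in tau_poly ((mult_pole ^^ N) \<xi>) (int N - 1) l)"

lemma finite_mult_pole_mono:
  assumes "finite {j. (mult_pole ^^ N) \<xi> j \<noteq> 0}" "N \<le> N'"
  shows "finite {j. (mult_pole ^^ N') \<xi> j \<noteq> 0}"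
    and "l \<in> TD \<Longrightarrow> tau_poly ((mult_pole ^^ N') \<xi>) (int N' - 1) l = tau_poly ((mult_pole ^^ N) \<xi>) (int N - 1) l"
proof -
  have eq: "(mult_pole ^^ N') \<xi> = (mult_pole ^^ (N' - N)) ((mult_pole ^^ N) \<xi>)"
    using assms(2) by (simp add: funpow_add[of "N' - N" N, simplified, symmetric] flip: o_apply[of "mult_pole ^^ (N' - N)"])
  show "finite {j. (mult_pole ^^ N') \<xi> j \<noteq> 0}"
    unfolding eq by (rule finite_mult_pole_pow[OF assms(1)])
  have "int N' - 1 = int N - 1 + int (N' - N)"
    using assms(2) by simp
  then show "tau_poly ((mult_pole ^^ N') \<xi>) (int N' - 1) l = tau_poly ((mult_pole ^^ N) \<xi>) (int N - 1) l" if "l \<in> TD"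
    unfolding eq by (simp only: tau_poly_mult_pole_pow[OF assms(1) that])
qed

lemma tau_witness_eq:
  assumes "finite {j. (mult_pole ^^ N) \<xi> j \<noteq> 0}" "l \<in> TD"
  shows "tau_witness \<xi> l = tau_poly ((mult_pole ^^ N) \<xi>) (int N - 1) l"
proof -
  define N0 where "N0 = (SOME N. finite {j. (mult_pole ^^ N) \<xi> j \<noteq> 0})"
  have "finite {j. (mult_pole ^^ N0) \<xi> j \<noteq> 0}"
    unfolding N0_def by (rule someI[of _ N]) (rule assms(1))
  then have "tau_poly ((mult_pole ^^ N0) \<xi>) (int N0 - 1) l = tau_poly ((mult_pole ^^ N) \<xi>) (int N - 1) l"
    using finite_mult_pole_mono(2)[OF _ _ assms(2)] assms(1) by (metis nle_le)
  then show ?thesis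
    by (simp add: tau_witness_def N0_def[symmetric])
qed

lemma mult_pole_pow_add: "(mult_pole ^^ N) (\<xi> + \<eta>) = (mult_pole ^^ N) \<xi> + (mult_pole ^^ N) \<eta>"
  by (induction N) (auto simp: mult_pole_def fun_eq_iff reg.vs.scale_right_distrib)

lemma mult_pole_pow_scale: "(mult_pole ^^ N) (laurent_scl V c \<xi>) = laurent_scl V c ((mult_pole ^^ N) \<xi>)"
  by (induction N)
    (auto simp: mult_pole_def fun_eq_iff laurent_scl_def reg.vs.scale_right_diff_distrib reg.vs.scale_left_commute)

lemma vector_space_laurent: "vector_space (laurent_scl V)"
  by unfold_locales (auto simp: fun_eq_iff laurent_scl_def algebra_simps)

sublocale laurent: vector_space "laurent_scl V"
  by (rule vector_space_laurent)

lemma tau_gen_finite: "\<exists>N. finite {j. (mult_pole ^^ N) (tau_gen V z v a c) j \<noteq> 0}"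
  and tau_witness_gen: "l \<in> TD \<Longrightarrow> tau_witness (tau_gen V z v a c) l = TR v a c l"
proof -
  have "(\<exists>N. finite {j. (mult_pole ^^ N) (tau_gen V z v a c) j \<noteq> 0}) \<and>
    (l \<in> TD \<longrightarrow> tau_witness (tau_gen V z v a c) l = TR v a c l)"
  proof (cases "- 1 \<le> c")
    \<comment> \<open>Here \<open>c + 1\<close> multiplications remove the pole exactly and leave v
      times t^{-a-1}.\<close>
    case True
    define N where "N = nat (c + 1)"
    have eq: "(mult_pole ^^ N) (tau_gen V z v a c) = Yt v a"
      using True by (simp add: mult_pole_pow_tau_gen N_def tau_gen_Yt[symmetric])
    have fin: "finite {j. (mult_pole ^^ N) (tau_gen V z v a c) j \<noteq> 0}"
      unfolding eq by (rule finite_Yt)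
    have "int N - 1 = c"
      using True by (simp add: N_def)
    then have "tau_witness (tau_gen V z v a c) l = TR v a c l" if "l \<in> TD"
      using tau_witness_eq[OF fin that] by (simp add: eq tau_poly_Yt[OF that])
    then show ?thesis
      using fin by blast
  next
    case False
    \<comment> \<open>For \<open>c < -1\<close> the generator is already a Laurent polynomial,
      containing t^{-1} - z as a factor \<open>k\<close> times.\<close>
    define k where "k = nat (- 1 - c)"
    have eq: "(mult_pole ^^ k) (Yt v a) = tau_gen V z v a c"
      using False by (simp add: mult_pole_pow_tau_gen k_def tau_gen_Yt[symmetric])
    have fin: "finite {j. (mult_pole ^^ 0) (tau_gen V z v a c) j \<noteq> 0}"
      using finite_mult_pole_pow[OF finite_Yt, of k v a] by (simp add: eq)
    have "tau_witness (tau_gen V z v a c) l = TR v a c l" if "l \<in> TD"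
    proof -
      have "tau_witness (tau_gen V z v a c) l = tau_poly ((mult_pole ^^ k) (Yt v a)) (- 1) l"
        using tau_witness_eq[OF fin that] by (simp add: eq)
      also have "- 1 = c + int k"
        using False by (simp add: k_def)
      finally show ?thesis
        by (simp add: tau_poly_mult_pole_pow[OF finite_Yt that] tau_poly_Yt[OF that])
    qed
    then show ?thesis
      using fin by blast
  qed
  then show "\<exists>N. finite {j. (mult_pole ^^ N) (tau_gen V z v a c) j \<noteq> 0}"
    "l \<in> TD \<Longrightarrow> tau_witness (tau_gen V z v a c) l = TR v a c l"
    by blast+
qed

lemma finite_support_laurent_scl: "finite {j. p j \<noteq> 0} \<Longrightarrow> finite {j. laurent_scl V t p j \<noteq> 0}"
  by (rule finite_subset[of _ "{j. p j \<noteq> 0}"]) (auto simp: laurent_scl_def)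

lemma tau_domain_finite:
  assumes "\<xi> \<in> tau_domain V z"
  shows "\<exists>N. finite {j. (mult_pole ^^ N) \<xi> j \<noteq> 0}"
  using assms unfolding tau_domain_def
proof (induction \<xi> rule: laurent.span_induct_alt)
  case base
  show ?case
    by (rule exI[of _ 0]) simp
next
  case (step t \<xi> \<eta>)
  then obtain N N' where N: "finite {j. (mult_pole ^^ N) \<xi> j \<noteq> 0}" "finite {j. (mult_pole ^^ N') \<eta> j \<noteq> 0}"
    using tau_gen_finite by blast
  then have "finite {j. (mult_pole ^^ max N N') \<xi> j \<noteq> 0}" "finite {j. (mult_pole ^^ max N N') \<eta> j \<noteq> 0}"
    using finite_mult_pole_mono(1) max.cobounded1 max.cobounded2 by blast+
  then have "finite {j. (mult_pole ^^ max N N') (laurent_scl V t \<xi> + \<eta>) j \<noteq> 0}"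
    unfolding mult_pole_pow_add mult_pole_pow_scale by (intro finite_support_add finite_support_laurent_scl)
  then show ?case by blast
qed

lemma tau_witness_linear:
  assumes l: "l \<in> TD"
  shows "linear_on (laurent_scl V) (tau_domain V z) tensor_dual_scl (\<lambda>\<xi>. tau_witness \<xi> l)"
proof (rule linear_onI)
  fix \<xi> \<eta> assume "\<xi> \<in> tau_domain V z" "\<eta> \<in> tau_domain V z"
  then obtain N N' where "finite {j. (mult_pole ^^ N) \<xi> j \<noteq> 0}" "finite {j. (mult_pole ^^ N') \<eta> j \<noteq> 0}"
    using tau_domain_finite by blast
  then have fin: "finite {j. (mult_pole ^^ max N N') \<xi> j \<noteq> 0}" "finite {j. (mult_pole ^^ max N N') \<eta> j \<noteq> 0}"
    using finite_mult_pole_mono(1) max.cobounded1 max.cobounded2 by blast+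
  have fin': "finite {j. (mult_pole ^^ max N N') (\<xi> + \<eta>) j \<noteq> 0}"
    unfolding mult_pole_pow_add by (rule finite_support_add[OF fin])
  have "tau_poly (p + q) c l = tau_poly p c l + tau_poly q c l" if "finite {j. p j \<noteq> 0}" "finite {j. q j \<noteq> 0}" for p q c
  proof -
    have "finite {j. TR (p j) (- j - 1) c l \<noteq> 0}" "finite {j. TR (q j) (- j - 1) c l \<noteq> 0}"
      by (rule finite_subset[OF _ that(1)], use l in auto, rule finite_subset[OF _ that(2)], use l in auto)
    then show ?thesis
      by (simp add: tau_poly_def tau_rhs_add_vector[OF l] Sum_any.distrib)
  qed
  then show "tau_witness (\<xi> + \<eta>) l = tau_witness \<xi> l + tau_witness \<eta> l"
    unfolding tau_witness_eq[OF fin(1) l] tau_witness_eq[OF fin(2) l] tau_witness_eq[OF fin' l] mult_pole_pow_add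
    using fin by blast
next
  fix t \<xi> assume "\<xi> \<in> tau_domain V z"
  then obtain N where fin: "finite {j. (mult_pole ^^ N) \<xi> j \<noteq> 0}"
    using tau_domain_finite by blast
  have fin': "finite {j. (mult_pole ^^ N) (laurent_scl V t \<xi>) j \<noteq> 0}"
    unfolding mult_pole_pow_scale by (rule finite_support_laurent_scl[OF fin])
  have "finite {j. TR ((mult_pole ^^ N) \<xi> j) (- j - 1) (int N - 1) l \<noteq> 0}"
    by (rule finite_subset[OF _ fin]) (use l in auto)
  then show "tau_witness (laurent_scl V t \<xi>) l = tensor_dual_scl t (tau_witness \<xi> l)"
    unfolding tau_witness_eq[OF fin l] tau_witness_eq[OF fin' l] mult_pole_pow_scale tau_poly_def
    by (simp add: laurent_scl_def tau_rhs_scale_vector[OF l] td.scale_Sum_any_right)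
qed

text \<open>The choice in \<open>tau\<close> is resolved here: \<open>tau_witness\<close> shows that
  it is not void, and later arguments only evaluate \<open>tau\<close> on generators.\<close>

lemma tau_gen_value:
  assumes "l \<in> TD"
  shows "tau V z M1 M2 (tau_gen V z v a c) l = TR v a c l"
proof -
  let ?P = "\<lambda>T. (\<forall>l\<in>TD. linear_on (laurent_scl V) (tau_domain V z) tensor_dual_scl (\<lambda>\<xi>. T \<xi> l)) \<and>
        (\<forall>v a c. \<forall>l\<in>TD. T (tau_gen V z v a c) l = TR v a c l)"
  have "?P tau_witness"
    using tau_witness_linear tau_witness_gen by blast
  then have "?P (tau V z M1 M2)"
    unfolding tau_def by (rule someI[where P = ?P])
  then show ?thesis
    using assms by blast
qed

lemma tact_scl [simp]: "scl tact = tensor_dual_scl"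
  by (simp add: tensor_dual_act_def)

lemma tact_vop: "l \<in> TD \<Longrightarrow> vop tact v k l = TR v k (- 1) l"
  using tau_gen_value[of l v k "- 1"] by (simp add: tensor_dual_act_def tau_gen_Yt)

lemma P_compatible_iff:
  assumes l: "l \<in> TD"
  shows "P_compatible V z M1 M2 l \<longleftrightarrow> (\<forall>v. (\<exists>N. \<forall>k<N. vop tact v k l = 0) \<and>
    (\<forall>a c. TR v a c l = Sum_any (\<lambda>i. tensor_dual_scl (e1 c i) (vop tact v (a - 1 - c - int i) l))))"
proof -
  have "Sum_any (\<lambda>a'. tensor_dual_scl (delta_y_z_x0 z (- a') c) (vop tact v (a - a') l))
      = Sum_any (\<lambda>i. tensor_dual_scl (e1 c i) (vop tact v (a - 1 - c - int i) l))" for v a c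
  proof -
    have "Sum_any (\<lambda>a'. tensor_dual_scl (delta_y_z_x0 z (- a') c) (vop tact v (a - a') l))
      = Sum_any (\<lambda>i. tensor_dual_scl (delta_y_z_x0 z (- (1 + c + int i)) c) (vop tact v (a - (1 + c + int i)) l))"
    proof (rule Sum_any_reindex_inj)
      fix a' assume "a' \<notin> range (\<lambda>i. 1 + c + int i)"
      then have "- a' \<notin> range (\<lambda>i. - 1 - c - int i)"
        by (auto simp: image_iff algebra_simps)
      then show "tensor_dual_scl (delta_y_z_x0 z (- a') c) (vop tact v (a - a') l) = 0"
        by (simp add: delta_y_z_x0_outside)
    qed (simp add: inj_def)
    also have "\<dots> = Sum_any (\<lambda>i. tensor_dual_scl (e1 c i) (vop tact v (a - 1 - c - int i) l))"
    proof (rule Sum_any.cong)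
      fix i
      have "- (1 + c + int i) = - 1 - c - int i" "a - (1 + c + int i) = a - 1 - c - int i"
        by simp_all
      then show "tensor_dual_scl (delta_y_z_x0 z (- (1 + c + int i)) c) (vop tact v (a - (1 + c + int i)) l)
          = tensor_dual_scl (e1 c i) (vop tact v (a - 1 - c - int i) l)"
        by (simp only: delta_y_z_x0_eq)
    qed
    finally show ?thesis .
  qed
  then show ?thesis
    unfolding P_compatible_def tau_gen_value[OF l] by (simp only:)
qed

end

section \<open>Images and sums of modules\<close>

lemma vertex_actionD:
  assumes "vertex_action V M W"
  shows "vector_space (scl M)" "module.subspace (scl M) W" "w \<in> W \<Longrightarrow> vop M v k w \<in> W"
    "linear_on (scl M) W (scl M) (vop M v k)"
    "w \<in> W \<Longrightarrow> linear_on (scl (reg V)) UNIV (scl M) (\<lambda>v. vop M v k w)"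
    "w \<in> W \<Longrightarrow> \<exists>N. \<forall>k<N. vop M v k w = 0"
    "w \<in> W \<Longrightarrow> vop M (vac V) k w = (if k = 0 then w else 0)"
    "jacobi_identity V M W"
    "w \<in> W \<Longrightarrow> vop M (Lmode V (reg V) (-1) v) k w = scl M (of_int (k + 1)) (vop M v (k + 1) w)"
  using assms by (auto simp: vertex_action_def)

lemma (in voa) borcherds_supports:
  assumes "vector_space (scl M)"
    and trunc: "\<And>v. \<exists>N. \<forall>k<N. vop M v k w = 0" and zero: "\<And>v k. vop M v k 0 = 0"
    and left: "\<And>k. vop M 0 k w = 0"
  shows "finite {i. scl M (s i) (vop M u (a + 1 + c + int i) (vop M v (b - int i) w)) \<noteq> 0}"
    and "finite {i. scl M (s i) (vop M v (b + 1 + c + int i) (vop M u (a - int i) w)) \<noteq> 0}"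
    and "finite {i. scl M (s i) (vop M (YV u (c - int i) v) (b + a + 1 + int i) w) \<noteq> 0}"
proof -
  interpret vector_space "scl M" by fact
  obtain Nv where Nv: "\<forall>k<Nv. vop M v k w = 0"
    using trunc by blast
  obtain Nu where Nu: "\<forall>k<Nu. vop M u k w = 0"
    using trunc by blast
  obtain N where N: "\<forall>k<N. YV u k v = 0"
    by (rule reg.vop_trunc)
  show "finite {i. scl M (s i) (vop M u (a + 1 + c + int i) (vop M v (b - int i) w)) \<noteq> 0}"
    by (rule finite_support_natI[of "nat (b - Nv + 1)"]) (simp add: Nv zero)
  show "finite {i. scl M (s i) (vop M v (b + 1 + c + int i) (vop M u (a - int i) w)) \<noteq> 0}"
    by (rule finite_support_natI[of "nat (a - Nu + 1)"]) (simp add: Nu zero)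
  show "finite {i. scl M (s i) (vop M (YV u (c - int i) v) (b + a + 1 + int i) w) \<noteq> 0}"
    by (rule finite_support_natI[of "nat (c - N + 1)"]) (simp add: N left)
qed

lemma (in voa) vertex_action_supports:
  assumes "vertex_action V M W" "w \<in> W"
  shows "finite {i. scl M (s i) (vop M u (a + 1 + c + int i) (vop M v (b - int i) w)) \<noteq> 0}"
    and "finite {i. scl M (s i) (vop M v (b + 1 + c + int i) (vop M u (a - int i) w)) \<noteq> 0}"
    and "finite {i. scl M (s i) (vop M (YV u (c - int i) v) (b + a + 1 + int i) w) \<noteq> 0}"
proof -
  note D = vertex_actionD[OF assms(1)]
  interpret vector_space "scl M" by (rule D(1))
  have zero: "vop M v k 0 = 0" for v k
    using linear_on_0[OF D(4)] subspace_0[OF D(2)] by blast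
  have left: "vop M 0 k w = 0" for k
    using linear_on_0[OF D(5)[OF assms(2)]] by simp
  note * = borcherds_supports[OF D(1) D(6)[OF assms(2)] zero left]
  show "finite {i. scl M (s i) (vop M u (a + 1 + c + int i) (vop M v (b - int i) w)) \<noteq> 0}"
    "finite {i. scl M (s i) (vop M v (b + 1 + c + int i) (vop M u (a - int i) w)) \<noteq> 0}"
    "finite {i. scl M (s i) (vop M (YV u (c - int i) v) (b + a + 1 + int i) w) \<noteq> 0}"
    by (rule *)+
qed

lemma finite_dimensional_image:
  assumes s: "vector_space s" and t: "vector_space t" and A: "module.subspace s A"
    and g: "linear_on s A t g" and E: "E \<subseteq> A" "finite_dimensional s E"
  shows "finite_dimensional t (g ` E)"
proof -
  interpret s: vector_space s by fact
  interpret t: vector_space t by fact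
  obtain B where B: "finite B" "E = s.span B"
    using E(2) unfolding finite_dimensional_def by blast
  have BA: "B \<subseteq> A"
    using E(1) B(2) s.span_superset by blast
  have "g ` E = t.span (g ` B)"
  proof
    show "g ` E \<subseteq> t.span (g ` B)"
    proof clarify
      fix x assume "x \<in> E"
      then obtain r where x: "x = (\<Sum>b\<in>B. s (r b) b)"
        using s.span_finite[OF B(1)] B(2) by auto
      have "g x = (\<Sum>b\<in>B. g (s (r b) b))"
        unfolding x by (rule linear_on_sum[OF g A s]) (use BA s.subspace_scale[OF A] in auto)
      also have "\<dots> = (\<Sum>b\<in>B. t (r b) (g b))"
        using linear_on_scale[OF g] BA by (intro sum.cong) auto
      also have "\<dots> \<in> t.span (g ` B)"
        by (intro t.span_sum t.span_scale t.span_base) auto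
      finally show "g x \<in> t.span (g ` B)" .
    qed
    show "t.span (g ` B) \<subseteq> g ` E"
    proof (rule t.span_minimal)
      show "g ` B \<subseteq> g ` E"
        using B(2) s.span_superset by blast
      have sub: "s.subspace E"
        unfolding B(2) by (rule s.subspace_span)
      show "t.subspace (g ` E)"
      proof (rule t.subspaceI)
        show "0 \<in> g ` E"
          using linear_on_0[OF g s.subspace_0[OF A]] s.subspace_0[OF sub] by force
        show "x + y \<in> g ` E" if "x \<in> g ` E" "y \<in> g ` E" for x y
          using that linear_on_add[OF g] s.subspace_add[OF sub] E(1) by (smt (verit) imageE image_eqI subsetD)
        show "t c x \<in> g ` E" if "x \<in> g ` E" for c x
          using that linear_on_scale[OF g] s.subspace_scale[OF sub] E(1) by (smt (verit) imageE image_eqI subsetD)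
      qed
    qed
  qed
  then show ?thesis
    unfolding finite_dimensional_def using B(1) by blast
qed

text \<open>The target \<open>N\<close> is only known to be a vector space, so even the linearity of
  its modes on the image is carried over from \<open>M\<close> through \<open>g\<close>.\<close>

lemma (in voa) vmodule_image:
  fixes M :: "('v, 'x::ab_group_add) vact" and N :: "('v, 'y::ab_group_add) vact"
  assumes M: "vmodule V M A" and N: "vector_space (scl N)"
    and g: "linear_on (scl M) A (scl N) g"
    and hom: "\<And>v k x. x \<in> A \<Longrightarrow> g (vop M v k x) = vop N v k (g x)"
  shows "vmodule V N (g ` A)"
proof -
  have act: "vertex_action V M A" and ds: "is_direct_sum (weight_space V M A) A"
    and fd: "\<And>n. finite_dimensional (scl M) (weight_space V M A n)"
    and low: "\<exists>r. \<forall>n. Re n < r \<longrightarrow> weight_space V M A n = {0}"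
    using M by (auto simp: vmodule_def generalized_module_def)
  note D = vertex_actionD[OF act]
  interpret m: vector_space "scl M" by (rule D(1))
  interpret n: vector_space "scl N" by (rule N)
  have g0: "g 0 = 0"
    by (rule linear_on_0[OF g m.subspace_0[OF D(2)]])
  have sub: "n.subspace (g ` A)"
  proof (rule n.subspaceI)
    show "0 \<in> g ` A"
      using g0 m.subspace_0[OF D(2)] by force
    show "x + y \<in> g ` A" if "x \<in> g ` A" "y \<in> g ` A" for x y
      using that linear_on_add[OF g] m.subspace_add[OF D(2)] by (smt (verit) imageE image_eqI)
    show "scl N c x \<in> g ` A" if "x \<in> g ` A" for c x
      using that linear_on_scale[OF g] m.subspace_scale[OF D(2)] by (smt (verit) imageE image_eqI)
  qed
  have lin: "linear_on (scl N) (g ` A) (scl N) (vop N v k)" for v k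
  proof (rule linear_onI)
    fix x y assume "x \<in> g ` A" "y \<in> g ` A"
    then obtain x' y' where xy: "x = g x'" "y = g y'" "x' \<in> A" "y' \<in> A"
      by blast
    then have "vop N v k (x + y) = g (vop M v k (x' + y'))"
      using hom m.subspace_add[OF D(2)] linear_on_add[OF g] by simp
    also have "\<dots> = vop N v k x + vop N v k y"
      using xy D(3) linear_on_add[OF D(4)] linear_on_add[OF g] hom by simp
    finally show "vop N v k (x + y) = vop N v k x + vop N v k y" .
  next
    fix c x assume "x \<in> g ` A"
    then obtain x' where x: "x = g x'" "x' \<in> A"
      by blast
    then have "vop N v k (scl N c x) = g (vop M v k (scl M c x'))"
      using hom m.subspace_scale[OF D(2)] linear_on_scale[OF g] by simp
    also have "\<dots> = scl N c (vop N v k x)"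
      using x D(3) linear_on_scale[OF D(4)] linear_on_scale[OF g] hom by simp
    finally show "vop N v k (scl N c x) = scl N c (vop N v k x)" .
  qed
  have g_Sum_any: "g (Sum_any f) = Sum_any (\<lambda>i. g (f i))" if "\<And>i. f i \<in> A" "finite {i. f i \<noteq> 0}" for f :: "nat \<Rightarrow> 'x"
    by (rule linear_on_Sum_any[OF g D(2) D(1) that])
  have bor: "borcherds_identity V N u v (g x) a b c" if x: "x \<in> A" for u v x a b c
  proof -
    let ?f1 = "\<lambda>i. scl M (jacobi_coeff c i) (vop M u (a + 1 + c + int i) (vop M v (b - int i) x))"
    let ?f2 = "\<lambda>i. scl M ((-1) powi (c + 1) * jacobi_coeff c i) (vop M v (b + 1 + c + int i) (vop M u (a - int i) x))"
    let ?f3 = "\<lambda>i. scl M (of_int (- a - 1) gchoose i) (vop M (YV u (c - int i) v) (b + a + 1 + int i) x)"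
    note fin = vertex_action_supports[OF act x]
    have mem: "?f1 i \<in> A" "?f2 i \<in> A" "?f3 i \<in> A" for i
      using x by (auto intro!: m.subspace_scale[OF D(2)] D(3))
    have b: "Sum_any ?f1 - Sum_any ?f2 = Sum_any ?f3"
      using D(8) x by (auto simp: jacobi_identity_iff[OF D(1)] borcherds_identity_def)
    have diff: "g (p - q) = g p - g q" if "p \<in> A" "q \<in> A" for p q
      using linear_on_add[OF g m.subspace_diff[OF D(2) that] that(2)] by simp
    have "g (Sum_any ?f1) - g (Sum_any ?f2) = g (Sum_any ?f1 - Sum_any ?f2)"
      by (rule diff[symmetric]; rule subspace_Sum_any[OF D(2) D(1)]; rule mem)
    also have "\<dots> = g (Sum_any ?f3)"
      unfolding b ..
    finally have "g (Sum_any ?f1) - g (Sum_any ?f2) = g (Sum_any ?f3)" .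
    moreover have "g (?f1 i) = scl N (jacobi_coeff c i) (vop N u (a + 1 + c + int i) (vop N v (b - int i) (g x)))"
      "g (?f2 i) = scl N ((-1) powi (c + 1) * jacobi_coeff c i) (vop N v (b + 1 + c + int i) (vop N u (a - int i) (g x)))"
      "g (?f3 i) = scl N (of_int (- a - 1) gchoose i) (vop N (YV u (c - int i) v) (b + a + 1 + int i) (g x))" for i
      using x by (auto simp: linear_on_scale[OF g] D(3) hom)
    ultimately show ?thesis
      unfolding borcherds_identity_def g_Sum_any[OF mem(1) fin(1)] g_Sum_any[OF mem(2) fin(2)] g_Sum_any[OF mem(3) fin(3)]
      by simp
  qed
  have act': "vertex_action V N (g ` A)"
    unfolding vertex_action_def
  proof (intro conjI allI ballI)
    show "vector_space (scl N)" "n.subspace (g ` A)" "\<And>v k. linear_on (scl N) (g ` A) (scl N) (vop N v k)"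
      by (rule N sub lin)+
    show "jacobi_identity V N (g ` A)"
      unfolding jacobi_identity_iff[OF N] using bor by auto
    fix v k y assume "y \<in> g ` A"
    then obtain x where x: "x \<in> A" "y = g x"
      by blast
    show "vop N v k y \<in> g ` A"
      using imageI[OF D(3)[OF x(1), of v k], of g] by (simp add: hom[OF x(1)] x(2))
    show "linear_on sV UNIV (scl N) (\<lambda>v. vop N v k y)"
    proof (rule linear_onI)
      show "vop N (u + v) k y = vop N u k y + vop N v k y" for u v
        using x linear_on_add[OF D(5)[OF x(1)] UNIV_I UNIV_I] linear_on_add[OF g] D(3) by (simp add: hom[symmetric])
      show "vop N (sV c v) k y = scl N c (vop N v k y)" for c v
        using x linear_on_scale[OF D(5)[OF x(1)] UNIV_I] linear_on_scale[OF g] D(3) by (simp add: hom[symmetric])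
    qed
    show "\<exists>N'. \<forall>k<N'. vop N v k y = 0"
      using D(6)[OF x(1), of v] x g0 by (metis hom)
    show "vop N (vac V) k y = (if k = 0 then y else 0)"
      using D(7)[OF x(1), of k] hom[OF x(1), of "vac V" k] x(2) g0 by (auto split: if_splits)
    show "vop N (Lmode V (reg V) (- 1) v) k y = scl N (of_int (k + 1)) (vop N v (k + 1) y)"
      using D(9)[OF x(1), of v k] hom[OF x(1)] x(2) linear_on_scale[OF g] D(3)[OF x(1)] by metis
  qed
  have Lg: "Lmode V N 0 (g x) = g (Lmode V M 0 x)" if "x \<in> A" for x
    using hom that by (simp add: Lmode_def)
  have ds': "is_direct_sum (weight_space V N (g ` A)) (g ` A)"
    unfolding weight_space_def
  proof (rule is_direct_sum_eigenspacesI[OF N sub])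
    show "linear_on (scl N) (g ` A) (scl N) (Lmode V N 0)"
      unfolding Lmode_def by (rule lin)
    fix y assume "y \<in> g ` A"
    then obtain x where x: "x \<in> A" "y = g x" by blast
    obtain f where f: "\<And>n. f n \<in> weight_space V M A n" "finite {n. f n \<noteq> 0}" "Sum_any f = x"
      using is_direct_sumE[OF ds x(1)] by blast
    have fA: "f n \<in> A" for n
      using f(1)[of n] by (simp add: weight_space_def)
    have "Sum_any (\<lambda>n. g (f n)) = y"
      using linear_on_Sum_any[OF g D(2) D(1) fA f(2)] f(3) x(2) by simp
    moreover have "g (f n) \<in> g ` A \<and> Lmode V N 0 (g (f n)) = scl N n (g (f n))" for n
      using f(1)[of n] linear_on_scale[OF g fA, of n n] by (auto simp: weight_space_def Lg)
    moreover have "finite {n. g (f n) \<noteq> 0}"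
      by (rule finite_subset[OF _ f(2)]) (use g0 in auto)
    ultimately show "\<exists>f. (\<forall>n. f n \<in> g ` A \<and> Lmode V N 0 (f n) = scl N n (f n)) \<and> finite {n. f n \<noteq> 0} \<and> Sum_any f = y"
      by (intro exI[where x = "\<lambda>n. g (f n)"]) blast
  qed
  have ws: "weight_space V N (g ` A) n = g ` weight_space V M A n" for n
  proof
    show "g ` weight_space V M A n \<subseteq> weight_space V N (g ` A) n"
      using Lg linear_on_scale[OF g] by (auto simp: weight_space_def)
    show "weight_space V N (g ` A) n \<subseteq> g ` weight_space V M A n"
    proof
      fix y assume y: "y \<in> weight_space V N (g ` A) n"
      then obtain x where x: "x \<in> A" "y = g x"
        by (auto simp: weight_space_def)
      obtain f where f: "\<And>n. f n \<in> weight_space V M A n" "finite {n. f n \<noteq> 0}" "Sum_any f = x"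
        using is_direct_sumE[OF ds x(1)] by blast
      have fA: "f n \<in> A" for n
        using f(1)[of n] by (simp add: weight_space_def)
      have yA: "y \<in> g ` A"
        using x by blast
      have "component (weight_space V N (g ` A)) n y = g (f n)"
      proof (rule component_eqI[OF ds' yA])
        show "g (f n) \<in> weight_space V N (g ` A) n" for n
          using f(1)[of n] Lg linear_on_scale[OF g] by (auto simp: weight_space_def)
        show "finite {n. g (f n) \<noteq> 0}"
          by (rule finite_subset[OF _ f(2)]) (use g0 in auto)
        show "Sum_any (\<lambda>n. g (f n)) = y"
          using linear_on_Sum_any[OF g D(2) D(1) fA f(2)] f(3) x(2) by simp
      qed
      moreover have "component (weight_space V N (g ` A)) n y = (if n = n then y else 0)"
      proof (rule component_eqI[OF ds' yA, where f = "\<lambda>i. if i = n then y else 0"])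
        have "0 \<in> weight_space V N (g ` A) i" for i
          using n.subspace_0[OF sub] linear_on_0[OF lin n.subspace_0[OF sub]] by (simp add: weight_space_def Lmode_def)
        then show "(if i = n then y else 0) \<in> weight_space V N (g ` A) i" for i
          using y by simp
        show "finite {i. (if i = n then y else 0) \<noteq> 0}"
          by (rule finite_subset[of _ "{n}"]) auto
      qed simp
      ultimately show "y \<in> g ` weight_space V M A n"
        using f(1)[of n] by auto
    qed
  qed
  have "finite_dimensional (scl N) (weight_space V N (g ` A) n)" for n
    unfolding ws by (rule finite_dimensional_image[OF D(1) N D(2) g _ fd]) (auto simp: weight_space_def)
  moreover have "\<exists>r. \<forall>n. Re n < r \<longrightarrow> weight_space V N (g ` A) n = {0}"
    using low unfolding ws by (metis g0 image_empty image_insert)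
  ultimately show ?thesis
    using act' ds' by (simp add: vmodule_def generalized_module_def)
qed

text \<open>Each axiom is linear in the vector or, like truncation, survives finite sums. Finite
  dimension and the lower bound on weights can be lost when infinitely many modules are added, so
  the conclusion is about generalized modules.\<close>

lemma (in voa) generalized_module_span:
  fixes N :: "('v, 'y::ab_group_add) vact"
  assumes N: "vector_space (scl N)" and T: "module.subspace (scl N) T"
    and lin: "\<And>v k. linear_on (scl N) T (scl N) (vop N v k)"
    and mods: "\<And>W. W \<in> F \<Longrightarrow> W \<subseteq> T \<and> generalized_module V N W"
  shows "generalized_module V N (module.span (scl N) (\<Union> F))"
proof -
  interpret n: vector_space "scl N" by (rule N)
  define S where "S = n.span (\<Union> F)"
  have ST: "S \<subseteq> T"
    unfolding S_def by (rule n.span_minimal[OF _ T]) (use mods in blast)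
  have subS: "n.subspace S"
    unfolding S_def by (rule n.subspace_span)
  \<comment> \<open>\<open>x\<close> stays attached to one module \<open>W\<close>, where the axioms
    are known, while membership of \<open>x\<close> and \<open>y\<close> in the span gives access to
    linearity of the modes.\<close>
  have ind: "P w" if w: "w \<in> S" and zero: "P 0"
    and step: "\<And>c x y W. W \<in> F \<Longrightarrow> x \<in> W \<Longrightarrow> x \<in> S \<Longrightarrow> y \<in> S \<Longrightarrow> P y \<Longrightarrow> P (scl N c x + y)" for P w
  proof -
    have "w \<in> S \<and> P w"
      using w unfolding S_def
    proof (induction rule: n.span_induct_alt)
      case (step c x y)
      then show ?case
        using that(3) n.span_base[of x "\<Union> F"] by (auto simp: S_def intro: n.span_add n.span_scale)
    qed (use zero n.span_zero in auto)
    then show ?thesis ..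
  qed
  have mact: "vertex_action V N W" if "W \<in> F" for W
    using mods[OF that] by (simp add: generalized_module_def)
  have comb: "vop N v k (scl N c x + y) = scl N c (vop N v k x) + vop N v k y" if "x \<in> S" "y \<in> S" for v k c x y
  proof -
    have "x \<in> T" "y \<in> T" "scl N c x \<in> T"
      using that ST n.subspace_scale[OF T] by auto
    then show ?thesis
      using linear_on_add[OF lin, of "scl N c x" y v k] linear_on_scale[OF lin, of x v k c] by simp
  qed
  have zero: "vop N v k 0 = 0" for v k
    using linear_on_0[OF lin n.subspace_0[OF T]] .
  have closed: "vop N v k w \<in> S" if "w \<in> S" for v k w
    using that
  proof (rule ind)
    fix c x y W assume *: "W \<in> F" "x \<in> W" "x \<in> S" "y \<in> S" "vop N v k y \<in> S"
    have "vop N v k x \<in> \<Union> F"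
      using vertex_actionD(3)[OF mact[OF *(1)] *(2)] *(1) by blast
    then have "vop N v k x \<in> S"
      unfolding S_def by (rule n.span_base)
    then show "vop N v k (scl N c x + y) \<in> S"
      unfolding comb[OF *(3,4)] using * by (intro n.subspace_add[OF subS] n.subspace_scale[OF subS])
  qed (simp add: zero n.subspace_0[OF subS])
  have trunc: "\<exists>N'. \<forall>k<N'. vop N v k w = 0" if "w \<in> S" for v w
    using that
  proof (rule ind)
    fix c x y W assume *: "W \<in> F" "x \<in> W" "x \<in> S" "y \<in> S" "\<exists>N'. \<forall>k<N'. vop N v k y = 0"
    obtain N1 where "\<forall>k<N1. vop N v k x = 0"
      using vertex_actionD(6)[OF mact[OF *(1)] *(2)] by blast
    moreover obtain N2 where "\<forall>k<N2. vop N v k y = 0"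
      using *(5) by blast
    ultimately show "\<exists>N'. \<forall>k<N'. vop N v k (scl N c x + y) = 0"
      unfolding comb[OF *(3,4)] by (intro exI[of _ "min N1 N2"]) simp
  qed (simp add: zero)
  have left: "linear_on sV UNIV (scl N) (\<lambda>v. vop N v k w)" if "w \<in> S" for k w
    using that
  proof (rule ind)
    fix c x y W assume *: "W \<in> F" "x \<in> W" "x \<in> S" "y \<in> S" "linear_on sV UNIV (scl N) (\<lambda>v. vop N v k y)"
    then show "linear_on sV UNIV (scl N) (\<lambda>v. vop N v k (scl N c x + y))"
      using vertex_actionD(5)[OF mact[OF *(1)] *(2), of k] unfolding comb[OF *(3,4)]
      by (auto simp: linear_on_def n.scale_right_distrib n.scale_left_commute)
  qed (auto simp: zero linear_on_def)
  have left0: "vop N 0 k w = 0" if "w \<in> S" for k w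
    using linear_on_0[OF left[OF that]] by simp
  have bor: "borcherds_identity V N u v w a b c" if "w \<in> S" for u v w a b c
    using that
  proof (rule ind)
    show "borcherds_identity V N u v 0 a b c"
      by (simp add: borcherds_identity_def zero)
    fix t x y W assume *: "W \<in> F" "x \<in> W" "x \<in> S" "y \<in> S" "borcherds_identity V N u v y a b c"
    have bx: "borcherds_identity V N u v x a b c"
      using vertex_actionD(8)[OF mact[OF *(1)]] *(2) by (auto simp: jacobi_identity_iff[OF N])
    note finx = borcherds_supports[OF N trunc[OF *(3)] zero left0[OF *(3)]]
    note finy = borcherds_supports[OF N trunc[OF *(4)] zero left0[OF *(4)]]
    have lincomb: "Sum_any (\<lambda>i. scl N (s i) (scl N t (f i) + f' i))
        = scl N t (Sum_any (\<lambda>i. scl N (s i) (f i))) + Sum_any (\<lambda>i. scl N (s i) (f' i))"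
      if "finite {i. scl N (s i) (f i) \<noteq> 0}" "finite {i. scl N (s i) (f' i) \<noteq> 0}" for s and f f' :: "nat \<Rightarrow> 'y"
      unfolding n.scale_Sum_any_right[OF that(1)] Sum_any.distrib[OF n.finite_scale[OF that(1)] that(2), symmetric]
      by (simp only: n.scale_right_distrib n.scale_left_commute)
    show "borcherds_identity V N u v (scl N t x + y) a b c"
      using bx *(5)
      unfolding borcherds_identity_def comb[OF *(3,4)] comb[OF closed[OF *(3)] closed[OF *(4)]]
        lincomb[OF finx(1) finy(1)] lincomb[OF finx(2) finy(2)] lincomb[OF finx(3) finy(3)]
      by (simp only: add_diff_add n.scale_right_diff_distrib[symmetric])
  qed
  have linS: "linear_on (scl N) S (scl N) (vop N v k)" for v k
    by (rule linear_onI) (use linear_on_add[OF lin] linear_on_scale[OF lin] ST in blast)+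
  have "vertex_action V N S"
    unfolding vertex_action_def
  proof (intro conjI allI ballI)
    show "vector_space (scl N)" "n.subspace S" "\<And>v k. linear_on (scl N) S (scl N) (vop N v k)"
      by (rule N subS linS)+
    show "jacobi_identity V N S"
      unfolding jacobi_identity_iff[OF N] using bor by auto
    fix v k w assume w: "w \<in> S"
    show "vop N v k w \<in> S" "linear_on sV UNIV (scl N) (\<lambda>v. vop N v k w)" "\<exists>N'. \<forall>k<N'. vop N v k w = 0"
      by (rule closed[OF w] left[OF w] trunc[OF w])+
    show "vop N (vac V) k w = (if k = 0 then w else 0)"
      using w
    proof (rule ind)
      fix c x y W assume *: "W \<in> F" "x \<in> W" "x \<in> S" "y \<in> S" "vop N (vac V) k y = (if k = 0 then y else 0)"
      then show "vop N (vac V) k (scl N c x + y) = (if k = 0 then scl N c x + y else 0)"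
        unfolding comb[OF *(3,4)] using vertex_actionD(7)[OF mact[OF *(1)] *(2), of k] by simp
    qed (simp add: zero)
    show "vop N (Lmode V (reg V) (- 1) v) k w = scl N (of_int (k + 1)) (vop N v (k + 1) w)"
      using w
    proof (rule ind)
      fix c x y W assume *: "W \<in> F" "x \<in> W" "x \<in> S" "y \<in> S"
        "vop N (Lmode V (reg V) (- 1) v) k y = scl N (of_int (k + 1)) (vop N v (k + 1) y)"
      then show "vop N (Lmode V (reg V) (- 1) v) k (scl N c x + y) = scl N (of_int (k + 1)) (vop N v (k + 1) (scl N c x + y))"
        unfolding comb[OF *(3,4)] using vertex_actionD(9)[OF mact[OF *(1)] *(2), of v k]
        by (simp only: n.scale_right_distrib n.scale_left_commute)
    qed (simp add: zero)
  qed
  moreover have "is_direct_sum (weight_space V N S) S"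
    unfolding weight_space_def
  proof (rule is_direct_sum_eigenspacesI[OF N subS])
    show "linear_on (scl N) S (scl N) (Lmode V N 0)"
      unfolding Lmode_def by (rule linS)
    fix w assume "w \<in> S"
    then show "\<exists>f. (\<forall>n. f n \<in> S \<and> Lmode V N 0 (f n) = scl N n (f n)) \<and> finite {n. f n \<noteq> 0} \<and> Sum_any f = w"
    proof (rule ind)
      show "\<exists>f. (\<forall>n. f n \<in> S \<and> Lmode V N 0 (f n) = scl N n (f n)) \<and> finite {n. f n \<noteq> 0} \<and> Sum_any f = 0"
        by (intro exI[of _ "\<lambda>n. 0"]) (simp add: n.subspace_0[OF subS] Lmode_def zero)
      fix c x y W assume *: "W \<in> F" "x \<in> W" "x \<in> S" "y \<in> S"
        "\<exists>f. (\<forall>n. f n \<in> S \<and> Lmode V N 0 (f n) = scl N n (f n)) \<and> finite {n. f n \<noteq> 0} \<and> Sum_any f = y"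
      obtain f where f: "\<And>n. f n \<in> weight_space V N W n" "finite {n. f n \<noteq> 0}" "Sum_any f = x"
        using mods[OF *(1)] *(2) is_direct_sumE[of "weight_space V N W" W x] by (auto simp: generalized_module_def)
      have fS: "f n \<in> S" "Lmode V N 0 (f n) = scl N n (f n)" for n
        using f(1)[of n] *(1) n.span_base[of "f n" "\<Union> F"] by (auto simp: weight_space_def S_def)
      obtain f' where f': "\<And>n. f' n \<in> S" "\<And>n. Lmode V N 0 (f' n) = scl N n (f' n)" "finite {n. f' n \<noteq> 0}" "Sum_any f' = y"
        using *(5) by blast
      have "scl N c (f n) + f' n \<in> S \<and> Lmode V N 0 (scl N c (f n) + f' n) = scl N n (scl N c (f n) + f' n)" for n
        using fS[of n] f'(1,2)[of n] n.subspace_add[OF subS] n.subspace_scale[OF subS] comb[OF fS(1) f'(1), of "conf V" "- 0 - 2" c n n]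
        by (simp add: Lmode_def n.scale_right_distrib n.scale_left_commute)
      moreover have "finite {n. scl N c (f n) + f' n \<noteq> 0}"
        by (rule finite_subset[OF _ finite_UnI[OF f(2) f'(3)]]) auto
      moreover have "Sum_any (\<lambda>n. scl N c (f n) + f' n) = scl N c x + y"
        unfolding Sum_any.distrib[OF n.finite_scale[OF f(2)] f'(3)] n.scale_Sum_any_right[OF f(2), symmetric] f(3) f'(4) ..
      ultimately show "\<exists>f. (\<forall>n. f n \<in> S \<and> Lmode V N 0 (f n) = scl N n (f n)) \<and> finite {n. f n \<noteq> 0} \<and> Sum_any f = scl N c x + y"
        by (intro exI[where x = "\<lambda>n. scl N c (f n) + f' n"]) blast
    qed
  qed
  ultimately show ?thesis
    by (simp add: generalized_module_def S_def)
qed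

section \<open>The sum of the compatible modules\<close>

context voa_module_pair
begin

abbreviation "dia \<equiv> diamond V z M1 M2"

lemma tact_linear: "linear_on tensor_dual_scl TD tensor_dual_scl (vop tact v k)"
  by (rule linear_onI)
    (simp_all add: tact_vop tau_rhs_add tau_rhs_scale td.subspace_add[OF subspace_TD] td.subspace_scale[OF subspace_TD])

lemma diamond_subset: "dia \<subseteq> TD"
  unfolding diamond_def by (rule td.span_minimal[OF _ subspace_TD]) blast

lemma subspace_diamond: "td.subspace dia"
  unfolding diamond_def by (rule td.subspace_span)

lemma generalized_module_diamond: "generalized_module V tact dia"
  unfolding diamond_def
  by (rule generalized_module_span[of tact TD, unfolded tact_scl, OF vector_space_tensor_dual subspace_TD tact_linear])
    (auto simp: vmodule_def)

lemma subset_diamond: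
  assumes "W \<subseteq> TD" "vmodule V tact W" "\<And>l. l \<in> W \<Longrightarrow> P_compatible V z M1 M2 l"
  shows "W \<subseteq> dia"
proof -
  have "W \<subseteq> \<Union> {W. W \<subseteq> TD \<and> vmodule V tact W \<and> (\<forall>l\<in>W. P_compatible V z M1 M2 l)}"
    by (rule Union_upper) (simp add: assms)
  then show ?thesis
    unfolding diamond_def by (rule order_trans[OF _ td.span_superset])
qed

lemma compatible_support:
  assumes "\<forall>k<N. vop tact v k l = 0"
  shows "finite {i. tensor_dual_scl (t i) (vop tact v (a - int i) l) \<noteq> 0}"
  by (rule finite_support_natI[of "nat (a - N + 1)"]) (use assms in simp)

text \<open>The identity is linear once both expansions are finite; the truncation half of the
  condition supplies that.\<close>

lemma P_compatible_combination:
  assumes l: "l \<in> TD" "P_compatible V z M1 M2 l" and l': "l' \<in> TD" "P_compatible V z M1 M2 l'"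
  shows "P_compatible V z M1 M2 (tensor_dual_scl s l + l')"
proof -
  have sl: "tensor_dual_scl s l \<in> TD"
    using td.subspace_scale[OF subspace_TD l(1)] .
  have mem: "tensor_dual_scl s l + l' \<in> TD"
    using td.subspace_add[OF subspace_TD sl l'(1)] .
  have comb: "vop tact v k (tensor_dual_scl s l + l') = tensor_dual_scl s (vop tact v k l) + vop tact v k l'" for v k
    using linear_on_add[OF tact_linear sl l'(1)] linear_on_scale[OF tact_linear l(1)] by simp
  have "(\<exists>N. \<forall>k<N. vop tact v k (tensor_dual_scl s l + l') = 0) \<and>
    (\<forall>a c. TR v a c (tensor_dual_scl s l + l')
      = Sum_any (\<lambda>i. tensor_dual_scl (e1 c i) (vop tact v (a - 1 - c - int i) (tensor_dual_scl s l + l'))))" for v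
  proof (intro conjI allI)
    obtain N where N: "\<forall>k<N. vop tact v k l = 0"
      using l unfolding P_compatible_iff[OF l(1)] by blast
    obtain N' where N': "\<forall>k<N'. vop tact v k l' = 0"
      using l' unfolding P_compatible_iff[OF l'(1)] by blast
    show "\<exists>N. \<forall>k<N. vop tact v k (tensor_dual_scl s l + l') = 0"
      by (rule exI[of _ "min N N'"]) (simp add: comb N N')
    fix a c
    note fin = compatible_support[OF N, of "e1 c" "a - 1 - c"] and fin' = compatible_support[OF N', of "e1 c" "a - 1 - c"]
    have "TR v a c (tensor_dual_scl s l + l') = tensor_dual_scl s (TR v a c l) + TR v a c l'"
      by (simp add: tau_rhs_add[OF sl l'(1)] tau_rhs_scale[OF l(1)])
    also have "\<dots> = tensor_dual_scl s (Sum_any (\<lambda>i. tensor_dual_scl (e1 c i) (vop tact v (a - 1 - c - int i) l)))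
       + Sum_any (\<lambda>i. tensor_dual_scl (e1 c i) (vop tact v (a - 1 - c - int i) l'))"
      using l l' unfolding P_compatible_iff[OF l(1)] P_compatible_iff[OF l'(1)] by simp
    also have "\<dots> = Sum_any (\<lambda>i. tensor_dual_scl (e1 c i) (vop tact v (a - 1 - c - int i) (tensor_dual_scl s l + l')))"
      unfolding td.scale_Sum_any_right[OF fin] Sum_any.distrib[OF td.finite_scale[OF fin] fin', symmetric] comb
      by (simp only: td.scale_right_distrib td.scale_left_commute)
    finally show "TR v a c (tensor_dual_scl s l + l')
      = Sum_any (\<lambda>i. tensor_dual_scl (e1 c i) (vop tact v (a - 1 - c - int i) (tensor_dual_scl s l + l')))" .
  qed
  then show ?thesis
    unfolding P_compatible_iff[OF mem] by blast
qed

lemma diamond_compatible: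
  assumes "l \<in> dia"
  shows "P_compatible V z M1 M2 l"
proof -
  have "l \<in> TD \<and> P_compatible V z M1 M2 l"
    using assms unfolding diamond_def
  proof (induction l rule: td.span_induct_alt)
    case base
    have "0 \<in> TD"
      by (rule td.subspace_0[OF subspace_TD])
    moreover have "vop tact v k 0 = 0" for v k
      by (rule linear_on_0[OF tact_linear \<open>0 \<in> TD\<close>])
    moreover have "TR v a c 0 = 0" for v a c
      using tau_rhs_scale[OF \<open>0 \<in> TD\<close>, of v a c 0] by simp
    ultimately have "P_compatible V z M1 M2 0"
      unfolding P_compatible_iff[OF \<open>0 \<in> TD\<close>] by simp
    with \<open>0 \<in> TD\<close> show ?case ..
  next
    case (step s x y)
    then have "x \<in> TD" "P_compatible V z M1 M2 x"
      by auto
    then show ?case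
      using step P_compatible_combination td.subspace_add[OF subspace_TD] td.subspace_scale[OF subspace_TD] by blast
  qed
  then show ?thesis ..
qed

end

section \<open>Completions\<close>

context voa_module
begin

abbreviation "compl \<equiv> completion V M"

lemma complD: "f \<in> compl \<Longrightarrow> f n \<in> Wt n"
  by (simp add: completion_def)

lemma finite_pairing: "w' \<in> dual \<Longrightarrow> f \<in> compl \<Longrightarrow> finite {n. w' (f n) \<noteq> 0}"
  by (rule finite_subset[OF _ finite_dual_support]) (use dual_support_outside complD in blast)+

lemma pairing_eq_sum:
  assumes "w' \<in> dual" "f \<in> compl"
  shows "pairing w' f = (\<Sum>n\<in>dual_support w'. w' (f n))"
  unfolding pairing_def
  by (rule Sum_any.expand_superset) (use assms finite_dual_support dual_support_outside complD in blast)+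

lemma pairing_pr:
  assumes "w' \<in> dual" "f \<in> compl"
  shows "pairing (\<lambda>w. w' (pr n w)) f = w' (f n)"
proof -
  have "w' (pr n (f m)) = (if m = n then w' (f n) else 0)" for m
    using wt.comp_summand[OF complD[OF assms(2)], of n m] assms(1) by auto
  then show ?thesis
    by (simp add: pairing_def)
qed

text \<open>Precomposing a functional with a projection isolates one component, where W' separates
  points.\<close>

lemma completion_eqI:
  assumes f: "f \<in> compl" and g: "g \<in> compl" and eq: "\<And>w'. w' \<in> dual \<Longrightarrow> pairing w' f = pairing w' g"
  shows "f = g"
proof
  fix n
  have "w' (f n - g n) = 0" if "w' \<in> dual" for w'
    using eq[OF dual_pr[OF that, of n]] pairing_pr[OF that f] pairing_pr[OF that g] dual_diff[OF that] by simp
  then show "f n = g n"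
    using dual_separates[of "f n - g n"] by simp
qed

lemma pairing_add_left:
  "w' \<in> dual \<Longrightarrow> w'' \<in> dual \<Longrightarrow> f \<in> compl \<Longrightarrow> pairing (\<lambda>w. w' w + w'' w) f = pairing w' f + pairing w'' f"
  unfolding pairing_def by (intro Sum_any.distrib finite_pairing)

lemma pairing_scale_left:
  "w' \<in> dual \<Longrightarrow> f \<in> compl \<Longrightarrow> pairing (\<lambda>w. c * w' w) f = c * pairing w' f"
  unfolding pairing_def by (intro Sum_any_right_distrib[symmetric] finite_pairing)

lemma pairing_add: "w' \<in> dual \<Longrightarrow> f \<in> compl \<Longrightarrow> g \<in> compl \<Longrightarrow> pairing w' (f + g) = pairing w' f + pairing w' g"
  unfolding pairing_def by (simp only: plus_fun_apply dual_add Sum_any.distrib[OF finite_pairing finite_pairing])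

lemma pairing_scale: "w' \<in> dual \<Longrightarrow> f \<in> compl \<Longrightarrow> pairing w' (scl_completion M c f) = c * pairing w' f"
  unfolding pairing_def by (simp only: scl_completion_def dual_scale Sum_any_right_distrib[OF finite_pairing])

lemma compl_add: "f \<in> compl \<Longrightarrow> g \<in> compl \<Longrightarrow> f + g \<in> compl"
  by (auto simp: completion_def vs.subspace_add[OF subspace_weight_space])

lemma compl_scale: "f \<in> compl \<Longrightarrow> scl_completion M c f \<in> compl"
  by (auto simp: completion_def scl_completion_def vs.subspace_scale[OF subspace_weight_space])

lemma compl_Sum_any: "(\<And>i. f i \<in> compl) \<Longrightarrow> (\<lambda>n. Sum_any (\<lambda>i. scl M (t i) (f i n))) \<in> compl"
  unfolding completion_def
  by (auto intro!: subspace_Sum_any[OF subspace_weight_space vs.vector_space_axioms]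
      vs.subspace_scale[OF subspace_weight_space])

text \<open>The family may be infinite as a family in the completion, as for Y_3. Finiteness in each
  component is enough, since \<open>w'\<close> sees only finitely many components.\<close>

lemma pairing_Sum_any:
  assumes w': "w' \<in> dual" and f: "\<And>i. f i \<in> compl" and fin: "\<And>n. finite {i. f i n \<noteq> 0}"
  shows "pairing w' (\<lambda>n. Sum_any (\<lambda>i. scl M (t i) (f i n))) = Sum_any (\<lambda>i. t i * pairing w' (f i))"
proof -
  let ?S = "dual_support w'"
  let ?I = "\<Union>n\<in>?S. {i. f i n \<noteq> 0}"
  have finI: "finite ?I"
    using finite_dual_support[OF w'] fin by blast
  have inner_sum: "w' (Sum_any (\<lambda>i. scl M (t i) (f i n))) = (\<Sum>i\<in>?I. t i * w' (f i n))" if "n \<in> ?S" for n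
  proof -
    have "w' (Sum_any (\<lambda>i. scl M (t i) (f i n))) = Sum_any (\<lambda>i. t i * w' (f i n))"
      by (simp only: dual_Sum_any[OF w' vs.finite_scale[OF fin]] dual_scale[OF w'])
    also have "\<dots> = (\<Sum>i\<in>?I. t i * w' (f i n))"
    proof (rule Sum_any.expand_superset[OF finI])
      have "w' (f i n) = 0" if "f i n = 0" for i
        using w' that by simp
      then show "{i. t i * w' (f i n) \<noteq> 0} \<subseteq> ?I"
        using \<open>n \<in> ?S\<close> by auto
    qed
    finally show ?thesis .
  qed
  have "pairing w' (\<lambda>n. Sum_any (\<lambda>i. scl M (t i) (f i n))) = (\<Sum>n\<in>?S. \<Sum>i\<in>?I. t i * w' (f i n))"
    unfolding pairing_eq_sum[OF w' compl_Sum_any[OF f]] by (rule sum.cong[OF refl inner_sum])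
  also have "\<dots> = (\<Sum>i\<in>?I. t i * pairing w' (f i))"
    unfolding pairing_eq_sum[OF w' f] sum_distrib_left by (rule sum.swap)
  also have "\<dots> = Sum_any (\<lambda>i. t i * pairing w' (f i))"
  proof (rule Sum_any.expand_superset[OF finI, symmetric])
    show "{i. t i * pairing w' (f i) \<noteq> 0} \<subseteq> ?I"
    proof
      fix i assume "i \<in> {i. t i * pairing w' (f i) \<noteq> 0}"
      then have "(\<Sum>n\<in>?S. w' (f i n)) \<noteq> 0"
        by (simp add: pairing_eq_sum[OF w' f])
      then obtain n where "n \<in> ?S" "w' (f i n) \<noteq> 0"
        by (meson sum.not_neutral_contains_not_neutral)
      moreover from this have "f i n \<noteq> 0"
        using w' by (metis dual_0)
      ultimately show "i \<in> ?I" by blast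
    qed
  qed
  finally show ?thesis .
qed

text \<open>The vanishing is tested on finitely many coordinate functionals, each of which kills
  high modes by \<open>dual_vop_trunc\<close>.\<close>

lemma pr_vop_trunc: "\<exists>K. \<forall>k\<ge>K. \<forall>w. pr n (vop M u k w) = 0"
proof -
  obtain B \<phi> where B: "finite B" "\<forall>b\<in>B. \<phi> b \<in> dual" "\<forall>w. pr n w = (\<Sum>b\<in>B. scl M (\<phi> b w) b)"
    by (rule dual_basis[of n])
  have "\<forall>b\<in>B. \<exists>K. \<forall>k\<ge>K. \<forall>w. \<phi> b (vop M u k w) = 0"
    using B(2) dual_vop_trunc by blast
  then obtain K where K: "\<forall>b\<in>B. \<forall>k\<ge>K b. \<forall>w. \<phi> b (vop M u k w) = 0"
    by metis
  have "pr n (vop M u k w) = 0" if "\<forall>b\<in>B. K b \<le> k" for k w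
    using B(3) K that by simp
  moreover obtain K' where "\<forall>b\<in>B. K b \<le> K'"
    using B(1) finite_imageI[OF B(1), of K] by (metis Max_ge imageI)
  ultimately show ?thesis
    by (meson order_trans)
qed

text \<open>A coordinate functional composed with a mode is again in W', so it meets finitely many
  components of \<open>f\<close>. Hence \<open>vop_completion\<close> is a genuine finite sum in
  every weight.\<close>

lemma finite_pr_vop:
  assumes f: "f \<in> compl"
  shows "finite {m. pr n (vop M u k (f m)) \<noteq> 0}"
proof -
  obtain B \<phi> where B: "finite B" "\<forall>b\<in>B. \<phi> b \<in> dual" "\<forall>w. pr n w = (\<Sum>b\<in>B. scl M (\<phi> b w) b)"
    by (rule dual_basis[of n])
  have "{m. pr n (vop M u k (f m)) \<noteq> 0} \<subseteq> (\<Union>b\<in>B. dual_support (\<lambda>w. \<phi> b (vop M u k w)))"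
  proof
    fix m assume "m \<in> {m. pr n (vop M u k (f m)) \<noteq> 0}"
    then have "(\<Sum>b\<in>B. scl M (\<phi> b (vop M u k (f m))) b) \<noteq> 0"
      using B(3) by simp
    then obtain b where "b \<in> B" "\<phi> b (vop M u k (f m)) \<noteq> 0"
      by (metis (mono_tags, lifting) sum.not_neutral_contains_not_neutral vs.scale_zero_left)
    then show "m \<in> (\<Union>b\<in>B. dual_support (\<lambda>w. \<phi> b (vop M u k w)))"
      using complD[OF f, of m] unfolding dual_support_def by blast
  qed
  moreover have "finite (\<Union>b\<in>B. dual_support (\<lambda>w. \<phi> b (vop M u k w)))"
    using B(1,2) finite_dual_support dual_vop by blast
  ultimately show ?thesis
    by (rule finite_subset)
qed

lemma vop_completion_mem: "vop_completion V M u k f \<in> compl"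
  unfolding completion_def vop_completion_def
  by (auto intro: subspace_Sum_any[OF subspace_weight_space vs.vector_space_axioms] wt.comp_mem)

lemma vop_completion_trunc: "\<exists>K. \<forall>k\<ge>K. vop_completion V M u k f n = 0"
proof -
  obtain K where "\<forall>k\<ge>K. \<forall>w. pr n (vop M u k w) = 0"
    using pr_vop_trunc by blast
  then show ?thesis
    by (intro exI[of _ K]) (simp add: vop_completion_def)
qed

lemma pairing_vop_completion:
  assumes w': "w' \<in> dual" and f: "f \<in> compl"
  shows "pairing w' (vop_completion V M u k f) = pairing (\<lambda>w. w' (vop M u k w)) f"
proof -
  let ?g = "\<lambda>n m. w' (pr n (vop M u k (f m)))"
  have "pairing w' (vop_completion V M u k f) = Sum_any (\<lambda>n. Sum_any (\<lambda>m. ?g n m))"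
    unfolding pairing_def vop_completion_def by (simp only: dual_Sum_any[OF w' finite_pr_vop[OF f]])
  also have "\<dots> = Sum_any (\<lambda>m. Sum_any (\<lambda>n. ?g n m))"
  proof (rule Sum_any_nested_swap(1))
    show "finite (dual_support w')"
      by (rule finite_dual_support[OF w'])
    show "finite (\<Union>n\<in>dual_support w'. {m. pr n (vop M u k (f m)) \<noteq> 0})"
      using finite_dual_support[OF w'] finite_pr_vop[OF f] by blast
    fix n m assume nz: "?g n m \<noteq> 0"
    then have "n \<in> dual_support w'"
      using dual_support_outside wt.comp_mem by blast
    moreover have "pr n (vop M u k (f m)) \<noteq> 0"
      using nz w' by (metis dual_0)
    ultimately show "n \<in> dual_support w' \<and> m \<in> (\<Union>n\<in>dual_support w'. {m. pr n (vop M u k (f m)) \<noteq> 0})"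
      by blast
  qed
  also have "\<dots> = pairing (\<lambda>w. w' (vop M u k w)) f"
    unfolding pairing_def by (simp only: dual_expand[OF w', symmetric])
  finally show ?thesis .
qed

end

section \<open>Transposition of intertwining maps\<close>

locale voa_module_triple = voa_module_pair V M1 M2 z + m3: voa_module V M3
  for V :: "'v::ab_group_add voa" and M1 :: "('v, 'a::ab_group_add) vact" and M2 :: "('v, 'b::ab_group_add) vact"
    and z :: complex and M3 :: "('v, 'c::ab_group_add) vact"
begin

abbreviation "TH \<equiv> tensor_hom V M1 M2 M3"
abbreviation "CH \<equiv> hom_space (scl m3.dact) m3.dual tensor_dual_scl TD"
abbreviation "tm \<equiv> transpose_map V M3"

lemma vector_space_tensor_hom: "vector_space (tensor_hom_scl M3)"
  by unfold_locales
    (auto simp: fun_eq_iff tensor_hom_scl_def scl_completion_def m3.vs.scale_right_distrib m3.vs.scale_left_distrib)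

lemma vector_space_contragredient_hom:
  "vector_space (contragredient_hom_scl :: complex \<Rightarrow> (('c \<Rightarrow> complex) \<Rightarrow> 'a \<Rightarrow> 'b \<Rightarrow> complex) \<Rightarrow> _)"
  by unfold_locales
    (auto simp: fun_eq_iff contragredient_hom_scl_def tensor_dual_scl_def algebra_simps)

sublocale th: vector_space "tensor_hom_scl M3"
  by (rule vector_space_tensor_hom)

sublocale ch: vector_space "contragredient_hom_scl :: complex \<Rightarrow> (('c \<Rightarrow> complex) \<Rightarrow> 'a \<Rightarrow> 'b \<Rightarrow> complex) \<Rightarrow> _"
  by (rule vector_space_contragredient_hom)

lemma THD:
  assumes "F \<in> TH"
  shows "F w1 w2 \<in> m3.compl"
    and "F (w1 + w1') w2 = F w1 w2 + F w1' w2" "F (scl M1 t w1) w2 = scl_completion M3 t (F w1 w2)"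
    and "F w1 (w2 + w2') = F w1 w2 + F w1 w2'" "F w1 (scl M2 t w2) = scl_completion M3 t (F w1 w2)"
  using assms by (auto simp: tensor_hom_def bilinear_map_def linear_on_def)

lemma subspace_TH: "th.subspace TH"
proof (rule th.subspaceI)
  have "(0 :: complex \<Rightarrow> 'c) \<in> m3.compl"
    using m3.vs.subspace_0[OF m3.subspace_weight_space] by (simp add: completion_def)
  then show "0 \<in> TH"
    by (auto simp: tensor_hom_def bilinear_map_def linear_on_def scl_completion_def fun_eq_iff)
  show "F + F' \<in> TH" if "F \<in> TH" "F' \<in> TH" for F F'
    using THD[OF that(1)] THD[OF that(2)] m3.compl_add
    by (auto simp: tensor_hom_def bilinear_map_def linear_on_def scl_completion_def fun_eq_iff
        m3.vs.scale_right_distrib)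
  show "tensor_hom_scl M3 t F \<in> TH" if "F \<in> TH" for t F
    using THD[OF that] m3.compl_scale
    by (auto simp: tensor_hom_def bilinear_map_def linear_on_def tensor_hom_scl_def scl_completion_def fun_eq_iff
        m3.vs.scale_right_distrib mult.commute)
qed

lemma tm_apply: "w' \<in> m3.dual \<Longrightarrow> tm F w' w1 w2 = pairing w' (F w1 w2)"
  by (simp add: transpose_map_def)

lemma tm_outside: "w' \<notin> m3.dual \<Longrightarrow> tm F w' = 0"
  by (simp add: transpose_map_def fun_eq_iff)

lemma tm_CH:
  assumes F: "F \<in> TH"
  shows "tm F \<in> CH"
  unfolding hom_space_def
proof (intro CollectI conjI allI impI)
  show "linear_on (scl m3.dact) m3.dual tensor_dual_scl (tm F)"
  proof (rule linear_onI)
    fix f g assume "f \<in> m3.dual" "g \<in> m3.dual"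
    moreover from this have "f + g \<in> m3.dual"
      using m3.dvs.subspace_add[OF m3.subspace_dual] by blast
    ultimately show "tm F (f + g) = tm F f + tm F g"
      using m3.pairing_add_left[of f g] THD(1)[OF F] by (simp add: fun_eq_iff tm_apply plus_fun_def)
  next
    fix c f assume f: "f \<in> m3.dual"
    have eq: "scl m3.dact c f = (\<lambda>w. c * f w)"
      by (simp add: fun_eq_iff)
    show "tm F (scl m3.dact c f) = tensor_dual_scl c (tm F f)"
      unfolding eq using m3.pairing_scale_left[OF f] m3.dual_scale_closed[OF f] f THD(1)[OF F]
      by (intro ext) (simp add: tm_apply tensor_dual_scl_def)
  qed
  show "tm F ` m3.dual \<subseteq> TD"
    using THD[OF F] by (auto simp: tensor_dual_def bilinear_map_def linear_on_def tm_apply m3.pairing_add m3.pairing_scale)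
qed (rule tm_outside)

lemma tm_linear: "linear_on (tensor_hom_scl M3) TH contragredient_hom_scl tm"
proof (rule linear_onI)
  fix F F' assume "F \<in> TH" "F' \<in> TH"
  then show "tm (F + F') = tm F + tm F'"
    by (auto simp: fun_eq_iff transpose_map_def m3.pairing_add THD(1))
next
  fix c F assume "F \<in> TH"
  then show "tm (tensor_hom_scl M3 c F) = contragredient_hom_scl c (tm F)"
    by (auto simp: fun_eq_iff transpose_map_def m3.pairing_scale THD(1) tensor_hom_scl_def contragredient_hom_scl_def
        tensor_dual_scl_def)
qed

lemma tm_inj: "inj_on tm TH"
proof (rule inj_onI)
  fix F F' assume F: "F \<in> TH" and F': "F' \<in> TH" and eq: "tm F = tm F'"
  have "F w1 w2 = F' w1 w2" for w1 w2
  proof (rule m3.completion_eqI[OF THD(1)[OF F] THD(1)[OF F']])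
    fix w' assume "w' \<in> m3.dual"
    then show "pairing w' (F w1 w2) = pairing w' (F' w1 w2)"
      using fun_cong[OF fun_cong[OF fun_cong[OF eq, of w'], of w1], of w2] by (simp add: tm_apply)
  qed
  then show "F = F'"
    by (simp add: fun_eq_iff)
qed

lemma CHD:
  assumes "G \<in> CH"
  shows "linear_on (scl m3.dact) m3.dual tensor_dual_scl G" "f \<in> m3.dual \<Longrightarrow> G f \<in> TD" "f \<notin> m3.dual \<Longrightarrow> G f = 0"
  using assms by (auto simp: hom_space_def)

text \<open>Finite-dimensional weight spaces are their own double duals; this is carried out with a
  dual basis in each weight.\<close>

lemma tm_surj:
  assumes G: "G \<in> CH"
  shows "\<exists>F\<in>TH. tm F = G"
proof -
  have "\<forall>n. \<exists>p. finite (fst p) \<and> (\<forall>b\<in>fst p. b \<in> m3.Wt n) \<and> (\<forall>b\<in>fst p. snd p b \<in> m3.dual) \<and>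
      (\<forall>w. m3.pr n w = (\<Sum>b\<in>fst p. scl M3 (snd p b w) b))"
  proof
    fix n
    obtain B \<phi> where "finite B" "\<forall>b\<in>B. b \<in> m3.Wt n" "\<forall>b\<in>B. \<phi> b \<in> m3.dual"
      "\<forall>w. m3.pr n w = (\<Sum>b\<in>B. scl M3 (\<phi> b w) b)"
      by (rule m3.dual_basis[of n])
    then show "\<exists>p. finite (fst p) \<and> (\<forall>b\<in>fst p. b \<in> m3.Wt n) \<and> (\<forall>b\<in>fst p. snd p b \<in> m3.dual) \<and>
      (\<forall>w. m3.pr n w = (\<Sum>b\<in>fst p. scl M3 (snd p b w) b))"
      by (intro exI[of _ "(B, \<phi>)"]) simp
  qed
  then obtain p where p: "\<forall>n. finite (fst (p n)) \<and> (\<forall>b\<in>fst (p n). b \<in> m3.Wt n) \<and>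
      (\<forall>b\<in>fst (p n). snd (p n) b \<in> m3.dual) \<and> (\<forall>w. m3.pr n w = (\<Sum>b\<in>fst (p n). scl M3 (snd (p n) b w) b))"
    by (rule choice[THEN exE])
  define B where "B n = fst (p n)" for n
  define \<phi> where "\<phi> n = snd (p n)" for n
  have B: "finite (B n)" "b \<in> B n \<Longrightarrow> b \<in> m3.Wt n" "b \<in> B n \<Longrightarrow> \<phi> n b \<in> m3.dual"
    "m3.pr n w = (\<Sum>b\<in>B n. scl M3 (\<phi> n b w) b)" for n b w
    using p by (simp_all add: B_def \<phi>_def)
  \<comment> \<open>The only candidate: the coordinate of \<open>F w1 w2 n\<close> along
    \<open>b\<close> has to be its pairing with the dual functional
    \<open>\<phi> n b\<close>.\<close>
  define F where "F w1 w2 n = (\<Sum>b\<in>B n. scl M3 (G (\<phi> n b) w1 w2) b)" for w1 w2 n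
  have GTD: "G (\<phi> n b) \<in> TD" if "b \<in> B n" for n b
    using CHD(2)[OF G] B(3)[OF that] by blast
  have FTH: "F \<in> TH"
    unfolding tensor_hom_def bilinear_map_def
  proof (intro CollectI conjI allI)
    show "linear_on (scl M2) UNIV (scl_completion M3) (F w1)" for w1
      by (rule linear_onI)
        (auto simp: F_def scl_completion_def fun_eq_iff TD_add_right[OF GTD] TD_scale_right[OF GTD]
          m3.vs.scale_left_distrib sum.distrib m3.vs.scale_sum_right)
    show "linear_on (scl M1) UNIV (scl_completion M3) (\<lambda>w1. F w1 w2)" for w2
      by (rule linear_onI)
        (auto simp: F_def scl_completion_def fun_eq_iff TD_add_left[OF GTD] TD_scale_left[OF GTD]
          m3.vs.scale_left_distrib sum.distrib m3.vs.scale_sum_right)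
    show "F w1 w2 \<in> m3.compl" for w1 w2
      unfolding completion_def F_def
    proof (intro CollectI allI m3.vs.subspace_sum[OF m3.subspace_weight_space])
      show "scl M3 (G (\<phi> n b) w1 w2) b \<in> m3.Wt n" if "b \<in> B n" for n b
        by (rule m3.vs.subspace_scale[OF m3.subspace_weight_space B(2)[OF that]])
    qed
  qed
  have "tm F w' = G w'" for w'
  proof (cases "w' \<in> m3.dual")
    case w': True
    let ?S = "m3.dual_support w'"
    \<comment> \<open>Only the finitely many weights seen by \<open>w'\<close> occur, so the linear
      map \<open>G\<close> can be applied term by term.\<close>
    have "w' = (\<Sum>n\<in>?S. \<Sum>b\<in>B n. scl m3.dact (w' b) (\<phi> n b))"
    proof
      fix x
      have sum_apply: "sum h A x = (\<Sum>i\<in>A. h i x)" for h :: "'i \<Rightarrow> 'c \<Rightarrow> complex" and A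
        by (induction A rule: infinite_finite_induct) auto
      have "w' x = (\<Sum>n\<in>?S. w' (m3.pr n x))"
        unfolding m3.dual_expand[OF w', of x]
        by (rule Sum_any.expand_superset)
          (use m3.finite_dual_support[OF w'] m3.dual_support_outside m3.wt.comp_mem in blast)+
      also have "\<dots> = (\<Sum>n\<in>?S. \<Sum>b\<in>B n. scl m3.dact (w' b) (\<phi> n b)) x"
        unfolding sum_apply by (simp add: B(4) m3.dual_sum[OF w'] m3.dual_scale[OF w'] mult.commute)
      finally show "w' x = (\<Sum>n\<in>?S. \<Sum>b\<in>B n. scl m3.dact (w' b) (\<phi> n b)) x" .
    qed
    then have "G w' = G (\<Sum>n\<in>?S. \<Sum>b\<in>B n. scl m3.dact (w' b) (\<phi> n b))"
      by simp
    also have "\<dots> = (\<Sum>n\<in>?S. \<Sum>b\<in>B n. tensor_dual_scl (w' b) (G (\<phi> n b)))"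
    proof -
      note lin = CHD(1)[OF G]
      have mem: "scl m3.dact (w' b) (\<phi> n b) \<in> m3.dual" if "b \<in> B n" for n b
        using m3.dvs.subspace_scale[OF m3.subspace_dual B(3)[OF that]] .
      have "G (\<Sum>n\<in>?S. \<Sum>b\<in>B n. scl m3.dact (w' b) (\<phi> n b)) = (\<Sum>n\<in>?S. G (\<Sum>b\<in>B n. scl m3.dact (w' b) (\<phi> n b)))"
        by (rule linear_on_sum[OF lin m3.subspace_dual m3.vector_space_dact])
          (intro m3.dvs.subspace_sum m3.subspace_dual mem)
      also have "\<dots> = (\<Sum>n\<in>?S. \<Sum>b\<in>B n. G (scl m3.dact (w' b) (\<phi> n b)))"
        by (intro sum.cong refl linear_on_sum[OF lin m3.subspace_dual m3.vector_space_dact] mem)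
      also have "\<dots> = (\<Sum>n\<in>?S. \<Sum>b\<in>B n. tensor_dual_scl (w' b) (G (\<phi> n b)))"
        by (intro sum.cong refl linear_on_scale[OF lin] B(3))
      finally show ?thesis .
    qed
    finally have Gw: "G w' = (\<Sum>n\<in>?S. \<Sum>b\<in>B n. tensor_dual_scl (w' b) (G (\<phi> n b)))" .
    have sum_apply: "sum h A x y = (\<Sum>i\<in>A. h i x y)" for h :: "'i \<Rightarrow> 'a \<Rightarrow> 'b \<Rightarrow> complex" and A x y
      by (induction A rule: infinite_finite_induct) auto
    show ?thesis
    proof (intro ext)
      fix w1 w2
      have "tm F w' w1 w2 = (\<Sum>n\<in>?S. w' (F w1 w2 n))"
        by (simp add: tm_apply[OF w'] m3.pairing_eq_sum[OF w' THD(1)[OF FTH]])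
      also have "\<dots> = G w' w1 w2"
        unfolding Gw sum_apply F_def
        by (simp add: m3.dual_sum[OF w'] m3.dual_scale[OF w'] tensor_dual_scl_def mult.commute)
      finally show "tm F w' w1 w2 = G w' w1 w2" .
    qed
  qed (simp add: tm_outside CHD(3)[OF G])
  then show ?thesis
    using FTH by blast
qed

lemma subspace_CH: "ch.subspace CH"
proof (rule ch.subspaceI)
  show "0 \<in> CH"
    using td.subspace_0[OF subspace_TD] by (auto simp: hom_space_def linear_on_def)
  show "G + G' \<in> CH" if "G \<in> CH" "G' \<in> CH" for G G'
    using that td.subspace_add[OF subspace_TD]
    by (auto simp: hom_space_def linear_on_def td.scale_right_distrib image_subset_iff)
  show "contragredient_hom_scl c G \<in> CH" if "G \<in> CH" for c G
    using that td.subspace_scale[OF subspace_TD]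
    by (auto simp: hom_space_def linear_on_def td.scale_right_distrib image_subset_iff contragredient_hom_scl_def
        td.scale_left_commute simp del: td.scale_scale)
qed

theorem transpose_iso: "linear_iso (tensor_hom_scl M3) TH contragredient_hom_scl CH tm"
  unfolding linear_iso_def bij_betw_def
  using subspace_TH subspace_CH tm_linear tm_inj tm_CH tm_surj by blast

text \<open>The defining identity of an intertwining map, paired with an element \<open>w'\<close> of the contragredient
  module and expressed through the transposed map \<open>G\<close>.\<close>

definition transposed_identity :: "(('c \<Rightarrow> complex) \<Rightarrow> 'a \<Rightarrow> 'b \<Rightarrow> complex) \<Rightarrow> ('c \<Rightarrow> complex) \<Rightarrow> 'v \<Rightarrow> int \<Rightarrow> int \<Rightarrow> 'a \<Rightarrow> 'b \<Rightarrow> bool" where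
  "transposed_identity G w' u a c w1 w2 \<longleftrightarrow>
     Sum_any (\<lambda>i. e1 c i * G (\<lambda>w. w' (vop M3 u (a + 1 + c + int i) w)) w1 w2) = inner (G w') u a c w1 w2"

text \<open>W_3' separates points of the completion, so nothing is lost by pairing. A mode of Y_3
  passes to the functional, which stays in W_3' by \<open>dual_vop\<close>, and so the identity can
  be written with the transposed map alone.\<close>

lemma intertwining_iff:
  assumes F: "F \<in> TH"
  shows "F \<in> intertwining_maps V z M1 M2 M3 \<longleftrightarrow>
    (\<forall>w'\<in>m3.dual. \<forall>u a c w1 w2. transposed_identity (tm F) w' u a c w1 w2)"
proof -
  define X where "X u a c w1 w2 n = Sum_any (\<lambda>i. scl M3 (e1 c i) (vop_completion V M3 u (a + 1 + c + int i) (F w1 w2) n))"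
    for u a c w1 w2 n
  define Y1 where "Y1 u a c w1 w2 n = Sum_any (\<lambda>i. scl M3 (e2 a i) (F (vop M1 u (c - int i) w1) w2 n))" for u a c w1 w2 n
  define Y2 where "Y2 u a c w1 w2 n = Sum_any (\<lambda>i. scl M3 (e3 c i) (F w1 (vop M2 u (a - int i) w2) n))" for u a c w1 w2 n
  have F0: "F 0 w2 = 0" "F w1 0 = 0" for w1 w2
    using THD(2)[OF F, of 0 0 w2] THD(4)[OF F, of w1 0 0] by simp_all
  have X: "Sum_any (\<lambda>a'. scl M3 (delta_y_z_x0 z a' c) (vop_completion V M3 u (a - a') (F w1 w2) n)) = X u a c w1 w2 n"
    for u a c w1 w2 n
  proof -
    have "Sum_any (\<lambda>a'. scl M3 (delta_y_z_x0 z a' c) (vop_completion V M3 u (a - a') (F w1 w2) n))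
        = Sum_any (\<lambda>i. scl M3 (delta_y_z_x0 z (- 1 - c - int i) c) (vop_completion V M3 u (a - (- 1 - c - int i)) (F w1 w2) n))"
    proof (rule Sum_any_reindex_inj)
    qed (simp_all add: inj_def delta_y_z_x0_outside)
    also have "\<dots> = X u a c w1 w2 n"
    proof -
      have "a - (- 1 - c - int i) = a + 1 + c + int i" for i
        by simp
      then show ?thesis
        by (simp only: X_def delta_y_z_x0_eq)
    qed
    finally show ?thesis .
  qed
  have Y1: "Sum_any (\<lambda>c'. scl M3 (delta_y_x0_z z a c') (F (vop M1 u (c - c') w1) w2 n)) = Y1 u a c w1 w2 n" for u a c w1 w2 n
  proof -
    have "Sum_any (\<lambda>c'. scl M3 (delta_y_x0_z z a c') (F (vop M1 u (c - c') w1) w2 n))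
        = Sum_any (\<lambda>i. scl M3 (delta_y_x0_z z a (int i)) (F (vop M1 u (c - int i) w1) w2 n))"
      by (rule Sum_any_reindex_inj) (simp_all add: inj_def delta_y_x0_z_outside)
    then show ?thesis
      by (simp only: Y1_def delta_y_x0_z_eq)
  qed
  have Y2: "Sum_any (\<lambda>a'. scl M3 (delta_z_y_x0 z a' c) (F w1 (vop M2 u (a - a') w2) n)) = Y2 u a c w1 w2 n" for u a c w1 w2 n
  proof -
    have "Sum_any (\<lambda>a'. scl M3 (delta_z_y_x0 z a' c) (F w1 (vop M2 u (a - a') w2) n))
        = Sum_any (\<lambda>i. scl M3 (delta_z_y_x0 z (int i) c) (F w1 (vop M2 u (a - int i) w2) n))"
      by (rule Sum_any_reindex_inj) (simp_all add: inj_def delta_z_y_x0_outside)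
    then show ?thesis
      by (simp only: Y2_def delta_z_y_x0_eq)
  qed
  have Xm: "X u a c w1 w2 \<in> m3.compl" for u a c w1 w2
    unfolding X_def[abs_def] by (rule m3.compl_Sum_any[OF m3.vop_completion_mem])
  have Y1m: "Y1 u a c w1 w2 \<in> m3.compl" for u a c w1 w2
    unfolding Y1_def[abs_def] by (rule m3.compl_Sum_any[OF THD(1)[OF F]])
  have Y2m: "Y2 u a c w1 w2 \<in> m3.compl" for u a c w1 w2
    unfolding Y2_def[abs_def] by (rule m3.compl_Sum_any[OF THD(1)[OF F]])
  have pX: "pairing w' (X u a c w1 w2) = Sum_any (\<lambda>i. e1 c i * tm F (\<lambda>w. w' (vop M3 u (a + 1 + c + int i) w)) w1 w2)"
    if w': "w' \<in> m3.dual" for w' u a c w1 w2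
  proof -
    have fin: "finite {i. vop_completion V M3 u (a + 1 + c + int i) (F w1 w2) n \<noteq> 0}" for n
    proof -
      obtain K where K: "\<forall>k\<ge>K. vop_completion V M3 u k (F w1 w2) n = 0"
        using m3.vop_completion_trunc by blast
      show ?thesis
        by (rule finite_support_natI[of "nat (K - a - 1 - c)"]) (simp add: K)
    qed
    show ?thesis
      unfolding X_def[abs_def] m3.pairing_Sum_any[OF w' m3.vop_completion_mem fin]
      by (simp only: m3.pairing_vop_completion[OF w' THD(1)[OF F]] tm_apply[OF m3.dual_vop[OF w']])
  qed
  have pY: "pairing w' (Y1 u a c w1 w2 + Y2 u a c w1 w2) = inner (tm F w') u a c w1 w2"
    if w': "w' \<in> m3.dual" for w' u a c w1 w2
  proof -
    have fin1: "finite {i. F (vop M1 u (c - int i) w1) w2 n \<noteq> 0}" for n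
    proof -
      obtain N where N: "\<forall>k<N. vop M1 u k w1 = 0"
        by (rule m1.vop_trunc)
      show ?thesis
        by (rule finite_support_natI[of "nat (c - N + 1)"]) (simp add: N F0)
    qed
    have fin2: "finite {i. F w1 (vop M2 u (a - int i) w2) n \<noteq> 0}" for n
    proof -
      obtain N where N: "\<forall>k<N. vop M2 u k w2 = 0"
        by (rule m2.vop_trunc)
      show ?thesis
        by (rule finite_support_natI[of "nat (a - N + 1)"]) (simp add: N F0)
    qed
    have "pairing w' (Y1 u a c w1 w2) = Sum_any (\<lambda>i. e2 a i * tm F w' (vop M1 u (c - int i) w1) w2)"
      unfolding Y1_def[abs_def] m3.pairing_Sum_any[OF w' THD(1)[OF F] fin1] by (simp only: tm_apply[OF w'])
    moreover have "pairing w' (Y2 u a c w1 w2) = Sum_any (\<lambda>i. e3 c i * tm F w' w1 (vop M2 u (a - int i) w2))"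
      unfolding Y2_def[abs_def] m3.pairing_Sum_any[OF w' THD(1)[OF F] fin2] by (simp only: tm_apply[OF w'])
    ultimately show ?thesis
      by (simp only: m3.pairing_add[OF w' Y1m Y2m] inner_def)
  qed
  have "F \<in> intertwining_maps V z M1 M2 M3 \<longleftrightarrow> (\<forall>u w1 w2 a c. X u a c w1 w2 = Y1 u a c w1 w2 + Y2 u a c w1 w2)"
    using F unfolding intertwining_maps_def by (simp only: X Y1 Y2 mem_Collect_eq fun_eq_iff plus_fun_apply simp_thms)
  also have "\<dots> \<longleftrightarrow> (\<forall>u w1 w2 a c. \<forall>w'\<in>m3.dual.
      pairing w' (X u a c w1 w2) = pairing w' (Y1 u a c w1 w2 + Y2 u a c w1 w2))"
    using m3.completion_eqI[OF Xm m3.compl_add[OF Y1m Y2m]] by metis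
  also have "\<dots> \<longleftrightarrow> (\<forall>w'\<in>m3.dual. \<forall>u a c w1 w2. transposed_identity (tm F) w' u a c w1 w2)"
    unfolding transposed_identity_def using pX pY by auto
  finally show ?thesis .
qed

section \<open>From intertwining maps to maps into the sum of compatible modules\<close>

definition dual_identity :: "(('c \<Rightarrow> complex) \<Rightarrow> 'a \<Rightarrow> 'b \<Rightarrow> complex) \<Rightarrow> ('c \<Rightarrow> complex) \<Rightarrow> 'v \<Rightarrow> int \<Rightarrow> int \<Rightarrow> 'a \<Rightarrow> 'b \<Rightarrow> bool" where
  "dual_identity G w' v a c w1 w2 \<longleftrightarrow>
     Sum_any (\<lambda>i. e1 c i * G (vop m3.dact v (a - 1 - c - int i) w') w1 w2) = TR v a c (G w') w1 w2"

lemma CH_add: "G \<in> CH \<Longrightarrow> f \<in> m3.dual \<Longrightarrow> g \<in> m3.dual \<Longrightarrow> G (\<lambda>w. f w + g w) = G f + G g"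
  using linear_on_add[OF CHD(1), of G f g] by (simp add: plus_fun_def)

lemma CH_scale:
  assumes "G \<in> CH" "f \<in> m3.dual"
  shows "G (\<lambda>w. c * f w) = tensor_dual_scl c (G f)"
proof -
  have "(\<lambda>w. c * f w) = scl m3.dact c f"
    by (simp add: fun_eq_iff)
  then show ?thesis
    using linear_on_scale[OF CHD(1)[OF assms(1)] assms(2)] by simp
qed

lemma CH_0: "G \<in> CH \<Longrightarrow> G 0 = 0"
  using linear_on_0[OF CHD(1)] m3.dvs.subspace_0[OF m3.subspace_dual] by blast

text \<open>Substituting \<open>\<theta>(v)\<close> for \<open>u\<close> turns the transposed identity into the \<open>P(z)\<close>-compatibility condition.
  Conversely, \<open>\<theta>\<close> is triangular with respect to the weight, up to powers of \<open>x\<close>, hence it can be undone.\<close>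

lemma transposed_iff_dual_identity:
  assumes G: "G \<in> CH" and w': "w' \<in> m3.dual"
  shows "(\<forall>u a c. transposed_identity G w' u a c w1 w2) \<longleftrightarrow> (\<forall>v a c. dual_identity G w' v a c w1 w2)"
proof -
  define H where "H u k = G (\<lambda>w. w' (vop M3 u k w)) w1 w2" for u k
  define L where "L u a c = Sum_any (\<lambda>i. e1 c i * H u (a + 1 + c + int i))" for u a c
  \<comment> \<open>The defect of the transposed identity is linear in \<open>u\<close>, so the dual
    identity becomes a linear condition on its values at the coefficients of
    \<open>theta\<close>.\<close>
  define E where "E u a c = L u a c - inner (G w') u a c w1 w2" for u a c
  note l = CHD(2)[OF G w']
  have H_add: "H (u + v) k = H u k + H v k" for u v k
    unfolding H_def m3.vop_add_left m3.dual_add[OF w'] CH_add[OF G m3.dual_vop[OF w'] m3.dual_vop[OF w']] by simp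
  have H_scale: "H (sV t u) k = t * H u k" for t u k
    unfolding H_def m3.vop_scale_left m3.dual_scale[OF w'] CH_scale[OF G m3.dual_vop[OF w']]
    by (simp add: tensor_dual_scl_def)
  have H_0: "H 0 k = 0" for k
    using H_scale[of 0 0 k] by simp
  have H_trunc: "\<exists>K. \<forall>k\<ge>K. H u k = 0" for u
  proof -
    obtain K where K: "\<forall>k\<ge>K. \<forall>w. w' (vop M3 u k w) = 0"
      using m3.dual_vop_trunc[OF w'] by blast
    have "H u k = 0" if "k \<ge> K" for k
    proof -
      have "(\<lambda>w. w' (vop M3 u k w)) = 0"
        using K that by (simp add: fun_eq_iff)
      then show ?thesis
        by (simp add: H_def CH_0[OF G])
    qed
    then show ?thesis by blast
  qed
  have L_fin: "finite {i. e1 c i * H u (a + int i) \<noteq> 0}" for u a c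
  proof -
    obtain K where "\<forall>k\<ge>K. H u k = 0"
      using H_trunc by blast
    then show ?thesis
      by (intro finite_support_natI[of "nat (K - a)"]) simp
  qed
  have L_add: "L (u + v) a c = L u a c + L v a c" for u v a c
    unfolding L_def Sum_any.distrib[OF L_fin L_fin, symmetric] by (simp only: H_add distrib_left)
  have L_scale: "L (sV t u) a c = t * L u a c" for t u a c
    unfolding L_def Sum_any_right_distrib[OF L_fin] by (simp only: H_scale mult.left_commute)
  have E_add: "E (u + v) a c = E u a c + E v a c" for u v a c
    by (simp add: E_def L_add inner_add_vector[OF l])
  have E_scale: "E (sV t u) a c = t * E u a c" for t u a c
    by (simp add: E_def L_scale inner_scale_vector[OF l] right_diff_distrib)
  have E_0: "E 0 a c = 0" for a c
    using E_scale[of 0 0 a c] by simp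
  have star_H: "G (vop m3.dact v k w') w1 w2 = Sum_any (\<lambda>j. H (theta V v j) (j - k))" for v k
  proof -
    let ?J = "{j. theta V v j \<noteq> 0}"
    let ?f = "\<lambda>j w. w' (vop M3 (theta V v j) (j - k) w)"
    have sum_apply: "sum h A x = (\<Sum>i\<in>A. h i x)" for h :: "int \<Rightarrow> 'c \<Rightarrow> complex" and A x
      by (induction A rule: infinite_finite_induct) auto
    have "vop m3.dact v k w' = (\<Sum>j\<in>?J. ?f j)"
    proof
      fix w
      have "w' (m3.star v k w) = Sum_any (\<lambda>j. ?f j w)"
        unfolding vop_star_def by (rule m3.dual_Sum_any[OF w' m3.finite_star_summands])
      also have "\<dots> = (\<Sum>j\<in>?J. ?f j w)"
        by (rule Sum_any.expand_superset[OF theta_finite]) (use w' in auto)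
      finally show "vop m3.dact v k w' w = (\<Sum>j\<in>?J. ?f j) w"
        by (simp add: sum_apply)
    qed
    then have "G (vop m3.dact v k w') = (\<Sum>j\<in>?J. G (?f j))"
      using linear_on_sum[OF CHD(1)[OF G] m3.subspace_dual m3.vector_space_dact, where I = ?J and g = ?f]
        m3.dual_vop[OF w'] by simp
    moreover have "sum h A x y = (\<Sum>i\<in>A. h i x y)" for h :: "int \<Rightarrow> 'a \<Rightarrow> 'b \<Rightarrow> complex" and A x y
      by (induction A rule: infinite_finite_induct) auto
    ultimately have "G (vop m3.dact v k w') w1 w2 = (\<Sum>j\<in>?J. H (theta V v j) (j - k))"
      by (simp add: H_def)
    also have "\<dots> = Sum_any (\<lambda>j. H (theta V v j) (j - k))"
      by (rule Sum_any.expand_superset[OF theta_finite, symmetric]) (use H_0 in auto)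
    finally show ?thesis .
  qed
  have dual_E: "dual_identity G w' v a c w1 w2 \<longleftrightarrow> Sum_any (\<lambda>j. E (theta V v j) (j - a) c) = 0" for v a c
  proof -
    let ?J = "{j. theta V v j \<noteq> 0}"
    have "\<forall>j. \<exists>K. \<forall>k\<ge>K. H (theta V v j) k = 0"
      using H_trunc by blast
    then obtain K where K: "\<forall>j. \<forall>k\<ge>K j. H (theta V v j) k = 0"
      by metis
    \<comment> \<open>One bound for all \<open>j\<close> with nonzero coefficient of
      \<open>theta\<close>, so that the sums over \<open>i\<close> and \<open>j\<close> may be
      exchanged.\<close>
    define Q where "Q = Max (insert 0 ((\<lambda>j. nat (K j - (j - a + 1 + c))) ` ?J))"
    have Q: "nat (K j - (j - a + 1 + c)) \<le> Q" if "j \<in> ?J" for j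
      unfolding Q_def using that theta_finite[of v] by (intro Max_ge) auto
    have "Sum_any (\<lambda>i. e1 c i * G (vop m3.dact v (a - 1 - c - int i) w') w1 w2)
        = Sum_any (\<lambda>i. Sum_any (\<lambda>j. e1 c i * H (theta V v j) (j - a + 1 + c + int i)))"
    proof (rule Sum_any.cong)
      fix i
      have "finite {j. H (theta V v j) (j - (a - 1 - c - int i)) \<noteq> 0}"
        by (rule finite_subset[OF _ theta_finite[of v]]) (use H_0 in auto)
      then show "e1 c i * G (vop m3.dact v (a - 1 - c - int i) w') w1 w2
          = Sum_any (\<lambda>j. e1 c i * H (theta V v j) (j - a + 1 + c + int i))"
        unfolding star_H by (simp add: Sum_any_right_distrib algebra_simps)
    qed
    also have "\<dots> = Sum_any (\<lambda>j. Sum_any (\<lambda>i. e1 c i * H (theta V v j) (j - a + 1 + c + int i)))"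
    proof (rule Sum_any_nested_swap(1)[OF finite_lessThan[of Q] theta_finite[of v]])
      fix i j assume nz: "e1 c i * H (theta V v j) (j - a + 1 + c + int i) \<noteq> 0"
      then have j: "j \<in> ?J"
        using H_0 by auto
      moreover have "i < Q"
      proof (rule ccontr)
        assume "\<not> i < Q"
        then have "K j \<le> j - a + 1 + c + int i"
          using Q[OF j] by linarith
        then show False
          using nz K by simp
      qed
      ultimately show "i \<in> {..<Q} \<and> j \<in> ?J"
        by simp
    qed
    finally have "Sum_any (\<lambda>i. e1 c i * G (vop m3.dact v (a - 1 - c - int i) w') w1 w2)
        = Sum_any (\<lambda>j. L (theta V v j) (j - a) c)"
      by (simp only: L_def)
    moreover have fin: "finite {j. L (theta V v j) (j - a) c \<noteq> 0}"
      by (rule finite_subset[OF _ theta_finite[of v]]) (use L_scale[of 0 0] in auto)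
    moreover have "Sum_any (\<lambda>j. E (theta V v j) (j - a) c)
        = Sum_any (\<lambda>j. L (theta V v j) (j - a) c) - Sum_any (\<lambda>j. inner (G w') (theta V v j) (j - a) c w1 w2)"
      unfolding E_def by (rule Sum_any_diff[OF fin finite_inner_theta[OF l]])
    ultimately show ?thesis
      by (simp add: dual_identity_def tau_rhs_eq_inner[OF l])
  qed
  have trans_E: "transposed_identity G w' u a c w1 w2 \<longleftrightarrow> E u a c = 0" for u a c
    by (simp add: transposed_identity_def E_def L_def H_def)
  show ?thesis
    unfolding trans_E dual_E
  proof
    assume "\<forall>u a c. E u a c = 0"
    then show "\<forall>v a c. Sum_any (\<lambda>j. E (theta V v j) (j - a) c) = 0"
      by simp
  next
    assume dual: "\<forall>v a c. Sum_any (\<lambda>j. E (theta V v j) (j - a) c) = 0"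
    obtain N where N: "\<forall>n<N. \<forall>v\<in>Vwt n. v = 0"
      by (rule Vwt_bounded)
    have hom: "\<forall>u\<in>Vwt h. \<forall>a c. E u a c = 0" for h
    \<comment> \<open>The measure is 0 exactly for the weights below \<open>N\<close>, where V
      vanishes.\<close>
    proof (induction h rule: measure_induct_rule[where f = "\<lambda>h. nat (h - N + 1)"])
      case (less h)
      show ?case
      proof (intro ballI allI)
        fix u a c assume u: "u \<in> Vwt h"
        show "E u a c = 0"
        proof (cases "h < N")
          case True
          then show ?thesis
            using N u E_0 by metis
        next
          case False
          \<comment> \<open>The exponent \<open>- 2 * h - a\<close> is chosen so that the leading
            coefficient of \<open>theta\<close>, at x^{-2h}, contributes plus or minus the defect of
            \<open>u\<close> at \<open>a\<close>. The other coefficients are multiples of L(1)^i u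
            with i > 0, of smaller weight.\<close>
          have other: "E (theta V u j) (j - (- 2 * h - a)) c = 0" if "j \<noteq> - 2 * h" for j
          proof (cases "0 \<le> j + 2 * h")
            case True
            define i where "i = nat (j + 2 * h)"
            have "0 < i"
              using True that by (simp add: i_def)
            then have "nat (h - int i - N + 1) < nat (h - N + 1)"
              using False by simp
            then have "E ((L1 ^^ i) u) (j - (- 2 * h - a)) c = 0"
              using less L1_pow_Vwt[OF u, of i] by blast
            then show ?thesis
              using True by (simp add: theta_homogeneous[OF u] E_scale i_def)
          qed (simp add: theta_homogeneous[OF u] E_0)
          have "0 = Sum_any (\<lambda>j. E (theta V u j) (j - (- 2 * h - a)) c)"
            using dual by simp
          also have "\<dots> = E (theta V u (- 2 * h)) (- 2 * h - (- 2 * h - a)) c"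
            by (rule Sum_any_single) (rule other)
          also have "\<dots> = (-1) powi h * E u a c"
            by (simp add: theta_homogeneous[OF u] E_scale)
          finally show ?thesis
            by simp
        qed
      qed
    qed
    have "\<forall>a c. E u a c = 0" for u
      by (induction u rule: voa_induct) (use hom E_add in auto)
    then show "\<forall>u a c. E u a c = 0"
      by blast
  qed
qed

abbreviation "MM \<equiv> module_maps m3.dact m3.dual tact dia"

lemma module_maps_iff:
  "G \<in> MM \<longleftrightarrow> G \<in> CH \<and> (\<forall>w'\<in>m3.dual. \<forall>v a c w1 w2. dual_identity G w' v a c w1 w2)"
proof (intro iffI conjI ballI allI)
  assume G: "G \<in> MM"
  then have hom: "G (vop m3.dact v k w) = vop tact v k (G w)" if "w \<in> m3.dual" for v k w
    using that by (simp add: module_maps_def)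
  have dia: "G w \<in> dia" if "w \<in> m3.dual" for w
    using G that by (auto simp: module_maps_def hom_space_def)
  show CH: "G \<in> CH"
    using G diamond_subset by (auto simp: module_maps_def hom_space_def)
  fix w' v a c w1 w2 assume w': "w' \<in> m3.dual"
  note l = CHD(2)[OF CH w']
  obtain N where N: "\<forall>k<N. \<forall>w. w' (m3.star v k w) = 0"
    using m3.dual_star_trunc[OF w'] by blast
  have "vop tact v k (G w') = 0" if "k < N" for k
  proof -
    have "vop m3.dact v k w' = 0"
      using N that by (simp add: fun_eq_iff)
    then show ?thesis
      using hom[OF w', of v k] CH_0[OF CH] by simp
  qed
  then have fin: "finite {i. tensor_dual_scl (e1 c i) (vop tact v (a - 1 - c - int i) (G w')) \<noteq> 0}"
    by (intro compatible_support) blast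
  have "TR v a c (G w') = Sum_any (\<lambda>i. tensor_dual_scl (e1 c i) (vop tact v (a - 1 - c - int i) (G w')))"
    using diamond_compatible[OF dia[OF w']] unfolding P_compatible_iff[OF l] by blast
  then have "TR v a c (G w') w1 w2
      = Sum_any (\<lambda>i. tensor_dual_scl (e1 c i) (vop tact v (a - 1 - c - int i) (G w'))) w1 w2"
    by (rule arg_cong[where f = "\<lambda>l. l w1 w2"])
  also have "\<dots> = Sum_any (\<lambda>i. tensor_dual_scl (e1 c i) (vop tact v (a - 1 - c - int i) (G w')) w1 w2)"
  proof -
    have "finite {i. tensor_dual_scl (e1 c i) (vop tact v (a - 1 - c - int i) (G w')) w1 \<noteq> 0}"
      by (rule finite_subset[OF _ fin]) auto
    then show ?thesis
      by (simp only: Sum_any_apply[OF fin] Sum_any_apply)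
  qed
  finally show "dual_identity G w' v a c w1 w2"
    unfolding dual_identity_def hom[OF w'] tensor_dual_scl_def ..
next
  assume *: "G \<in> CH \<and> (\<forall>w'\<in>m3.dual. \<forall>v a c w1 w2. dual_identity G w' v a c w1 w2)"
  then have G: "G \<in> CH" ..
  have di: "Sum_any (\<lambda>i. e1 c i * G (vop m3.dact v (a - 1 - c - int i) w') w1 w2) = TR v a c (G w') w1 w2"
    if "w' \<in> m3.dual" for w' v a c w1 w2
    using * that by (auto simp: dual_identity_def)
  have hom: "G (vop m3.dact v k w') = vop tact v k (G w')" if w': "w' \<in> m3.dual" for v k w'
  proof (intro ext)
    fix w1 w2
    \<comment> \<open>The residue in x_0: at \<open>c = -1\<close> only the term with i = 0 has a
      nonzero coefficient.\<close>
    have "TR v k (- 1) (G w') w1 w2 = Sum_any (\<lambda>i. e1 (- 1) i * G (vop m3.dact v (k - 1 - - 1 - int i) w') w1 w2)"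
      using di[OF w', of "- 1" v k w1 w2] by simp
    also have "\<dots> = G (vop m3.dact v k w') w1 w2"
      by (subst Sum_any_single[of 0]) (auto simp: e1_minus_1)
    finally show "G (vop m3.dact v k w') w1 w2 = vop tact v k (G w') w1 w2"
      by (simp add: tact_vop[OF CHD(2)[OF G w']])
  qed
  have trunc: "\<exists>N. \<forall>k<N. vop tact v k (G w') = 0" if w': "w' \<in> m3.dual" for v w'
  proof -
    obtain N where N: "\<forall>k<N. \<forall>w. w' (m3.star v k w) = 0"
      using m3.dual_star_trunc[OF w'] by blast
    have "vop tact v k (G w') = 0" if "k < N" for k
    proof -
      have "vop m3.dact v k w' = 0"
        using N that by (simp add: fun_eq_iff)
      then show ?thesis
        using hom[OF w', of v k] CH_0[OF G] by simp
    qed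
    then show ?thesis by blast
  qed
  have comp: "P_compatible V z M1 M2 (G w')" if w': "w' \<in> m3.dual" for w'
    unfolding P_compatible_iff[OF CHD(2)[OF G w']]
  proof (intro allI conjI trunc[OF w'])
    fix v a c
    obtain N where "\<forall>k<N. vop tact v k (G w') = 0"
      using trunc[OF w'] by blast
    then have fin: "finite {i. tensor_dual_scl (e1 c i) (vop tact v (a - 1 - c - int i) (G w')) \<noteq> 0}"
      by (rule compatible_support)
    show "TR v a c (G w') = Sum_any (\<lambda>i. tensor_dual_scl (e1 c i) (vop tact v (a - 1 - c - int i) (G w')))"
    proof (intro ext)
      fix w1 w2
      have "finite {i. tensor_dual_scl (e1 c i) (vop tact v (a - 1 - c - int i) (G w')) w1 \<noteq> 0}"
        by (rule finite_subset[OF _ fin]) auto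
      then have "Sum_any (\<lambda>i. tensor_dual_scl (e1 c i) (vop tact v (a - 1 - c - int i) (G w'))) w1 w2
          = Sum_any (\<lambda>i. tensor_dual_scl (e1 c i) (vop tact v (a - 1 - c - int i) (G w')) w1 w2)"
        by (simp only: Sum_any_apply[OF fin] Sum_any_apply)
      then show "TR v a c (G w') w1 w2
          = Sum_any (\<lambda>i. tensor_dual_scl (e1 c i) (vop tact v (a - 1 - c - int i) (G w'))) w1 w2"
        unfolding di[OF w', symmetric] hom[OF w'] by (simp only: tensor_dual_scl_def)
    qed
  qed
  have "G ` m3.dual \<subseteq> dia"
  proof (rule subset_diamond)
    show "G ` m3.dual \<subseteq> TD"
      using CHD(2)[OF G] by blast
    show "vmodule V tact (G ` m3.dual)"
      by (rule vmodule_image[OF m3.vmodule_dual]) (use vector_space_tensor_dual CHD(1)[OF G] hom in auto)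
  qed (use comp in blast)
  then show "G \<in> MM"
    using G hom by (auto simp: module_maps_def hom_space_def)
qed

lemma intertwining_subset: "intertwining_maps V z M1 M2 M3 \<subseteq> TH"
  by (auto simp: intertwining_maps_def)

lemma intertwining_iff_module_map: "F \<in> intertwining_maps V z M1 M2 M3 \<longleftrightarrow> F \<in> TH \<and> tm F \<in> MM"
proof (cases "F \<in> TH")
  case True
  show ?thesis
    unfolding intertwining_iff[OF True] module_maps_iff
    using True tm_CH[OF True] transposed_iff_dual_identity[OF tm_CH[OF True]] by blast
qed (use intertwining_subset in blast)

lemma subspace_MM: "ch.subspace MM"
proof (rule ch.subspaceI)
  have MM: "G \<in> MM \<longleftrightarrow> G \<in> CH \<and> (\<forall>w\<in>m3.dual. G w \<in> dia) \<and>
      (\<forall>v k. \<forall>w\<in>m3.dual. G (vop m3.dact v k w) = vop tact v k (G w))" for G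
    using diamond_subset by (auto simp: module_maps_def hom_space_def)
  have "vop tact v k 0 = 0" for v k
    by (rule linear_on_0[OF tact_linear td.subspace_0[OF subspace_TD]])
  then show "0 \<in> MM"
    using ch.subspace_0[OF subspace_CH] td.subspace_0[OF subspace_diamond] by (simp add: MM zero_fun_def)
  show "G + G' \<in> MM" if "G \<in> MM" "G' \<in> MM" for G G'
    using that ch.subspace_add[OF subspace_CH] td.subspace_add[OF subspace_diamond]
      linear_on_add[OF tact_linear CHD(2) CHD(2)] by (simp add: MM)
  show "contragredient_hom_scl t G \<in> MM" if "G \<in> MM" for t G
    using that ch.subspace_scale[OF subspace_CH] td.subspace_scale[OF subspace_diamond]
      linear_on_scale[OF tact_linear CHD(2)] by (simp add: MM contragredient_hom_scl_def)
qed

theorem intertwining_iso: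
  "linear_iso (tensor_hom_scl M3) (intertwining_maps V z M1 M2 M3) contragredient_hom_scl MM tm"
  unfolding linear_iso_def
proof (intro conjI)
  show "ch.subspace MM"
    by (rule subspace_MM)
  show "th.subspace (intertwining_maps V z M1 M2 M3)"
  proof (rule th.subspaceI)
    show "0 \<in> intertwining_maps V z M1 M2 M3"
      using th.subspace_0[OF subspace_TH] ch.subspace_0[OF subspace_MM]
        linear_on_0[OF tm_linear th.subspace_0[OF subspace_TH]]
      by (simp only: intertwining_iff_module_map simp_thms)
    show "F + F' \<in> intertwining_maps V z M1 M2 M3"
      if "F \<in> intertwining_maps V z M1 M2 M3" "F' \<in> intertwining_maps V z M1 M2 M3" for F F'
      using that th.subspace_add[OF subspace_TH] ch.subspace_add[OF subspace_MM] linear_on_add[OF tm_linear]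
      by (simp add: intertwining_iff_module_map)
    show "tensor_hom_scl M3 c F \<in> intertwining_maps V z M1 M2 M3"
      if "F \<in> intertwining_maps V z M1 M2 M3" for c F
      using that th.subspace_scale[OF subspace_TH] ch.subspace_scale[OF subspace_MM] linear_on_scale[OF tm_linear]
      by (simp add: intertwining_iff_module_map)
  qed
  show "linear_on (tensor_hom_scl M3) (intertwining_maps V z M1 M2 M3) contragredient_hom_scl tm"
    using tm_linear intertwining_subset unfolding linear_on_def by blast
  show "bij_betw tm (intertwining_maps V z M1 M2 M3) MM"
    unfolding bij_betw_def
  proof
    show "inj_on tm (intertwining_maps V z M1 M2 M3)"
      by (rule inj_on_subset[OF tm_inj intertwining_subset])
    show "tm ` intertwining_maps V z M1 M2 M3 = MM"
      using tm_surj module_maps_iff intertwining_iff_module_map by blast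
  qed
qed

end

section \<open>Naturality in W_3\<close>

locale voa_module_triple_map = p3: voa_module_triple V M1 M2 z M3 + p4: voa_module_triple V M1 M2 z M4
  for V :: "'v::ab_group_add voa" and M1 :: "('v, 'a::ab_group_add) vact" and M2 :: "('v, 'b::ab_group_add) vact"
    and z :: complex and M3 :: "('v, 'c::ab_group_add) vact" and M4 :: "('v, 'd::ab_group_add) vact" +
  fixes h :: "'c \<Rightarrow> 'd"
  assumes module_map: "h \<in> module_maps M3 UNIV M4 UNIV"
begin

lemma h_add: "h (x + y) = h x + h y"
  and h_scale: "h (scl M3 c x) = scl M4 c (h x)"
  and h_vop: "h (vop M3 v k x) = vop M4 v k (h x)"
  using module_map by (auto simp: module_maps_def hom_space_def linear_on_def)

lemma h_weight: "x \<in> p3.m3.Wt n \<Longrightarrow> h x \<in> p4.m3.Wt n"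
  by (simp add: p3.m3.weight_space_iff p4.m3.weight_space_iff h_vop[symmetric] h_scale)

lemma dual_map:
  assumes w': "w' \<in> p4.m3.dual"
  shows "w' \<circ> h \<in> p3.m3.dual"
proof (rule p3.m3.dualI[of _ "p4.m3.dual_support w'"])
  show "(w' \<circ> h) x = 0" if "x \<in> p3.m3.Wt n" "n \<notin> p4.m3.dual_support w'" for n x
    using p4.m3.dual_support_outside[OF that(2) h_weight[OF that(1)]] by simp
qed (simp_all add: h_add h_scale p4.m3.dual_add[OF w'] p4.m3.dual_scale[OF w'] p4.m3.finite_dual_support[OF w'])

lemma map_TH:
  assumes F: "F \<in> p3.TH"
  shows "(\<lambda>w1 w2 n. h (F w1 w2 n)) \<in> p4.TH"
  using p3.THD[OF F] h_weight
  by (auto simp: tensor_hom_def bilinear_map_def linear_on_def scl_completion_def fun_eq_iff completion_def h_add h_scale)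

lemma transpose_map_compose:
  assumes "w' \<in> p4.m3.dual"
  shows "p4.tm (\<lambda>w1 w2 n. h (F w1 w2 n)) w' = p3.tm F (w' \<circ> h)"
  using assms dual_map[OF assms] by (intro ext) (simp add: transpose_map_def pairing_def)

text \<open>Paired with \<open>w'\<close>, the identity for the composite is the identity for
  \<open>F\<close> paired with \<open>w' \<circ> h\<close>, because \<open>h\<close> commutes with
  the modes of V.\<close>

lemma map_intertwining:
  assumes F: "F \<in> intertwining_maps V z M1 M2 M3"
  shows "(\<lambda>w1 w2 n. h (F w1 w2 n)) \<in> intertwining_maps V z M1 M2 M4"
proof -
  have TH: "F \<in> p3.TH"
    using F p3.intertwining_subset by blast
  have "p4.transposed_identity (p4.tm (\<lambda>w1 w2 n. h (F w1 w2 n))) w' u a c w1 w2" if w': "w' \<in> p4.m3.dual" for w' u a c w1 w2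
  proof -
    have "p3.transposed_identity (p3.tm F) (w' \<circ> h) u a c w1 w2"
      using F dual_map[OF w'] unfolding p3.intertwining_iff[OF TH] by blast
    moreover have "p4.tm (\<lambda>w1 w2 n. h (F w1 w2 n)) (\<lambda>w. w' (vop M4 u k w)) = p3.tm F (\<lambda>w. (w' \<circ> h) (vop M3 u k w))" for k
      unfolding transpose_map_compose[OF p4.m3.dual_vop[OF w']] by (simp add: comp_def h_vop)
    ultimately show ?thesis
      unfolding p3.transposed_identity_def p4.transposed_identity_def transpose_map_compose[OF w'] by simp
  qed
  then show ?thesis
    unfolding p4.intertwining_iff[OF map_TH[OF TH]] by blast
qed

end

text \<open>The last conjunct is naturality: composing an intertwining map with \<open>h\<close>
  corresponds, after transposition, to precomposing with the adjoint of \<open>h\<close>.\<close>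

theorem proposition13p4:
  fixes V :: "'v::ab_group_add voa" and z :: complex
    and M1 :: "('v, 'a::ab_group_add) vact" and M2 :: "('v, 'b::ab_group_add) vact"
  assumes "vertex_operator_algebra V" and "z \<noteq> 0"
    and "vmodule V M1 UNIV" and "vmodule V M2 UNIV"
  shows "generalized_module V (tensor_dual_act V z M1 M2) (diamond V z M1 M2) \<and>
    (\<forall>M3 :: ('v, 'c::ab_group_add) vact. vmodule V M3 UNIV \<longrightarrow>
       linear_iso (tensor_hom_scl M3) (tensor_hom V M1 M2 M3)
         contragredient_hom_scl
         (hom_space (scl (contragredient_act V M3)) (contragredient V M3)
            tensor_dual_scl (tensor_dual M1 M2))
         (transpose_map V M3) \<and>
       linear_iso (tensor_hom_scl M3) (intertwining_maps V z M1 M2 M3)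
         contragredient_hom_scl
         (module_maps (contragredient_act V M3) (contragredient V M3)
            (tensor_dual_act V z M1 M2) (diamond V z M1 M2))
         (transpose_map V M3) \<and>
       (\<forall>M4 :: ('v, 'd::ab_group_add) vact. \<forall>h. vmodule V M4 UNIV \<and> h \<in> module_maps M3 UNIV M4 UNIV \<longrightarrow>
          (\<forall>F\<in>intertwining_maps V z M1 M2 M3.
             (\<lambda>w1 w2 n. h (F w1 w2 n)) \<in> intertwining_maps V z M1 M2 M4 \<and>
             (\<forall>w'\<in>contragredient V M4.
                transpose_map V M4 (\<lambda>w1 w2 n. h (F w1 w2 n)) w' = transpose_map V M3 F (w' \<circ> h)))))"
proof -
  interpret voa_module_pair V M1 M2 z
    by unfold_locales (use assms in auto)
  show ?thesis
  proof (intro conjI allI impI ballI)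
    show "generalized_module V (tensor_dual_act V z M1 M2) (diamond V z M1 M2)"
      by (rule generalized_module_diamond)
    fix M3 :: "('v, 'c) vact"
    assume M3: "vmodule V M3 UNIV"
    interpret p3: voa_module_triple V M1 M2 z M3
      by unfold_locales (rule M3)
    show "linear_iso (tensor_hom_scl M3) p3.TH contragredient_hom_scl p3.CH p3.tm"
      by (rule p3.transpose_iso)
    show "linear_iso (tensor_hom_scl M3) (intertwining_maps V z M1 M2 M3) contragredient_hom_scl p3.MM p3.tm"
      by (rule p3.intertwining_iso)
    fix M4 :: "('v, 'd) vact" and h F
    assume h: "vmodule V M4 UNIV \<and> h \<in> module_maps M3 UNIV M4 UNIV" and F: "F \<in> intertwining_maps V z M1 M2 M3"
    interpret voa_module_triple_map V M1 M2 z M3 M4 h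
      by unfold_locales (use h in auto)
    show "(\<lambda>w1 w2 n. h (F w1 w2 n)) \<in> intertwining_maps V z M1 M2 M4"
      by (rule map_intertwining[OF F])
    fix w' assume "w' \<in> contragredient V M4"
    then show "transpose_map V M4 (\<lambda>w1 w2 n. h (F w1 w2 n)) w' = transpose_map V M3 F (w' \<circ> h)"
      by (rule transpose_map_compose)
  qed
qed

end
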